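(* Let $\Gamma$ be a finitely generated group and $n$ be a positive integer. Then $$\mathcal{X}^{\Phi_2}_{\mathrm{GL}(n,\mathbb{C})}(\Gamma) = \bigcup_{p+q = n} \mathcal{X}_{\mathrm{U}(p,q)}(\Gamma),$$ where the union is over pairs of non-negative integers $p,q$ with $p+q=n$.
   Context: $\mathrm{Hom}(\Gamma,\mathrm{GL}(n,\mathbb{C}))$ is an affine algebraic set (via the images of a finite generating set of $\Gamma$), on which $\mathrm{GL}(n,\mathbb{C})$ acts by conjugation. $\mathcal{X}_{\mathrm{GL}(n,\mathbb{C})}(\Gamma)=\mathrm{Hom}(\Gamma,\mathrm{GL}(n,\mathbb{C}))//\mathrm{GL}(n,\mathbb{C})$ is the GIT quotient, as an affine algebraic set; $\chi_\rho$ denotes the image of $\rho$, and $\chi_\rho=\chi_{\rho'}$ iff all conjugation-invariant regular functions take the same value at $\rho$ and $\rho'$ (equivalently, $\mathrm{tr}\,\rho(\gamma)=\mathrm{tr}\,\rho'(\gamma)$ for all $\gamma\in\Gamma$). $\Phi_2$ is the anti-holomorphic involution of $\mathcal{X}_{\mathrm{GL}(n,\mathbb{C})}(\Gamma)$ induced by $A\mapsto(\overline{A}^{T})^{-1}$, i.e. $\Phi_2(\chi_\rho)=\chi_{\rho_2}$ with $\rho_2(\gamma)=(\overline{\rho(\gamma)}^{T})^{-1}$, and $\mathcal{X}^{\Phi_2}_{\mathrm{GL}(n,\mathbb{C})}(\Gamma)$ is its set of fixed points. $\mathrm{U}(p,q)=\{M\in\mathrm{GL}(p+q,\mathbb{C}):\overline{M}^{T}I_{p,q}M=I_{p,q}\}$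 with $I_{p,q}=\begin{pmatrix}I_p&0\\0&-I_q\end{pmatrix}$. $\mathcal{X}_{\mathrm{U}(p,q)}(\Gamma)$ is the image of $\mathrm{Hom}(\Gamma,\mathrm{U}(p,q))$ under the projection $\mathrm{Hom}(\Gamma,\mathrm{GL}(n,\mathbb{C}))\to\mathcal{X}_{\mathrm{GL}(n,\mathbb{C})}(\Gamma)$. *)

theory Defs
  imports "HOL-Algebra.Generated_Groups" "Jordan_Normal_Form.Schur_Decomposition"
begin

definition GL :: "nat \<Rightarrow> complex mat monoid" where
  "GL n = units_of (ring_mat TYPE(complex) n ())"

definition Ipq :: "nat \<Rightarrow> nat \<Rightarrow> complex mat" where
  "Ipq p q = four_block_mat (1\<^sub>m p) (0\<^sub>m p q) (0\<^sub>m q p) (- 1\<^sub>m q)"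

definition Upq :: "nat \<Rightarrow> nat \<Rightarrow> complex mat monoid" where
  "Upq p q = (GL (p + q))
     \<lparr>carrier := {M \<in> carrier (GL (p + q)). mat_adjoint M * Ipq p q * M = Ipq p q}\<rparr>"

definition conj_rep :: "nat \<Rightarrow> complex mat \<Rightarrow> ('a \<Rightarrow> complex mat) \<Rightarrow> 'a \<Rightarrow> complex mat" where
  "conj_rep n g \<rho> = (\<lambda>\<gamma>. g \<otimes>\<^bsub>GL n\<^esub> \<rho> \<gamma> \<otimes>\<^bsub>GL n\<^esub> inv\<^bsub>GL n\<^esub> g)"

definition dual_rep :: "nat \<Rightarrow> ('a \<Rightarrow> complex mat) \<Rightarrow> 'a \<Rightarrow> complex mat" where
  "dual_rep n \<rho> = (\<lambda>\<gamma>. inv\<^bsub>GL n\<^esub> (mat_adjoint (\<rho> \<gamma>)))"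

text \<open>
  For a finite generating set \<open>S\<close> of \<open>\<Gamma>\<close>, restriction to \<open>S\<close> embeds \<open>hom \<Gamma> (GL n)\<close> as a Zariski
  closed subset of \<open>GL n\<close> to the power \<open>S\<close>. The coordinate ring of the latter is generated by the
  matrix entries at the elements of \<open>S\<close> together with the inverses of the determinants, and the
  regular functions on \<open>hom \<Gamma> (GL n)\<close> are the restrictions of its elements.
\<close>

inductive_set coord_functions :: "'a set \<Rightarrow> nat \<Rightarrow> (('a \<Rightarrow> complex mat) \<Rightarrow> complex) set"
  for S :: "'a set" and n :: nat where
  const: "(\<lambda>_. c) \<in> coord_functions S n"
| entry: "s \<in> S \<Longrightarrow> i < n \<Longrightarrow> j < n \<Longrightarrow> (\<lambda>\<rho>. \<rho> s $$ (i, j)) \<in> coord_functions S n"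
| inv_det: "s \<in> S \<Longrightarrow> (\<lambda>\<rho>. inverse (det (\<rho> s))) \<in> coord_functions S n"
| add: "f \<in> coord_functions S n \<Longrightarrow> g \<in> coord_functions S n \<Longrightarrow>
    (\<lambda>\<rho>. f \<rho> + g \<rho>) \<in> coord_functions S n"
| mult: "f \<in> coord_functions S n \<Longrightarrow> g \<in> coord_functions S n \<Longrightarrow>
    (\<lambda>\<rho>. f \<rho> * g \<rho>) \<in> coord_functions S n"

definition regular_functions ::
    "('a, 'b) monoid_scheme \<Rightarrow> 'a set \<Rightarrow> nat \<Rightarrow> (('a \<Rightarrow> complex mat) \<Rightarrow> complex) set" where
  "regular_functions \<Gamma> S n = (\<lambda>f. restrict f (hom \<Gamma> (GL n))) ` coord_functions S n"

definition invariant_functions ::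
    "('a, 'b) monoid_scheme \<Rightarrow> 'a set \<Rightarrow> nat \<Rightarrow> (('a \<Rightarrow> complex mat) \<Rightarrow> complex) set" where
  "invariant_functions \<Gamma> S n = {f \<in> regular_functions \<Gamma> S n.
     \<forall>\<rho> \<in> hom \<Gamma> (GL n). \<forall>g \<in> carrier (GL n). f (conj_rep n g \<rho>) = f \<rho>}"

type_synonym 'a character = "(('a \<Rightarrow> complex mat) \<Rightarrow> complex) \<Rightarrow> complex"

text \<open>
  A point of the GIT quotient is given by the values of all invariant regular functions at a
  representation, i.e. by the corresponding evaluation homomorphism on the ring of invariants.
  Every point of the quotient is of this form, as the quotient map is surjective on points.
\<close>

definition chi :: "('a, 'b) monoid_scheme \<Rightarrow> 'a set \<Rightarrow> nat \<Rightarrow> ('a \<Rightarrow> complex mat) \<Rightarrow> 'a character"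
  where "chi \<Gamma> S n \<rho> = (\<lambda>f \<in> invariant_functions \<Gamma> S n. f \<rho>)"

definition X_GL :: "('a, 'b) monoid_scheme \<Rightarrow> 'a set \<Rightarrow> nat \<Rightarrow> 'a character set" where
  "X_GL \<Gamma> S n = chi \<Gamma> S n ` hom \<Gamma> (GL n)"

definition X_U :: "('a, 'b) monoid_scheme \<Rightarrow> 'a set \<Rightarrow> nat \<Rightarrow> nat \<Rightarrow> 'a character set" where
  "X_U \<Gamma> S p q = chi \<Gamma> S (p + q) ` hom \<Gamma> (Upq p q)"

text \<open>The value is independent of the representative, see \<open>Phi2_chi\<close> below.\<close>

definition Phi2 :: "('a, 'b) monoid_scheme \<Rightarrow> 'a set \<Rightarrow> nat \<Rightarrow> 'a character \<Rightarrow> 'a character" where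
  "Phi2 \<Gamma> S n x =
     (THE y. \<exists>\<rho> \<in> hom \<Gamma> (GL n). x = chi \<Gamma> S n \<rho> \<and> y = chi \<Gamma> S n (dual_rep n \<rho>))"

definition X_GL_Phi2 :: "('a, 'b) monoid_scheme \<Rightarrow> 'a set \<Rightarrow> nat \<Rightarrow> 'a character set" where
  "X_GL_Phi2 \<Gamma> S n = {x \<in> X_GL \<Gamma> S n. Phi2 \<Gamma> S n x = x}"

lemma group_GL: "group (GL n)"
proof -
  interpret semiring "ring_mat TYPE(complex) n ()" by (rule semiring_mat)
  show ?thesis unfolding GL_def by (rule units_group)
qed

lemma mult_GL [simp]: "A \<otimes>\<^bsub>GL n\<^esub> B = A * B"
  by (simp add: GL_def units_of_mult ring_mat_simps)

lemma one_GL [simp]: "\<one>\<^bsub>GL n\<^esub> = 1\<^sub>m n"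
  by (simp add: GL_def units_of_one ring_mat_simps)

lemma carrier_GL:
  "carrier (GL n) =
     {A \<in> carrier_mat n n. \<exists>B \<in> carrier_mat n n. B * A = 1\<^sub>m n \<and> A * B = 1\<^sub>m n}"
  by (auto simp: GL_def units_of_carrier Units_def ring_mat_simps)

lemma GL_carrier_mat: "A \<in> carrier (GL n) \<Longrightarrow> A \<in> carrier_mat n n"
  by (simp add: carrier_GL)

lemma inv_GL:
  assumes "A \<in> carrier (GL n)"
  shows "inv\<^bsub>GL n\<^esub> A \<in> carrier (GL n)" "inv\<^bsub>GL n\<^esub> A * A = 1\<^sub>m n" "A * inv\<^bsub>GL n\<^esub> A = 1\<^sub>m n"
  using group.inv_closed[OF group_GL assms] group.l_inv[OF group_GL assms]
    group.r_inv[OF group_GL assms] by simp_all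

lemma det_GL: "A \<in> carrier (GL n) \<Longrightarrow> det A * det (inv\<^bsub>GL n\<^esub> A) = 1"
  by (metis inv_GL(1,3) GL_carrier_mat det_mult det_one)

lemma mat_adjoint_alt: "mat_adjoint (A :: complex mat) = map_mat cnj (transpose_mat A)"
  by (rule eq_matI) (auto simp: mat_adjoint_def mat_of_rows_def)

lemma mat_adjoint_mult:
  assumes "A \<in> carrier_mat n n" "B \<in> carrier_mat n n"
  shows "mat_adjoint (A * B :: complex mat) = mat_adjoint B * mat_adjoint A"
proof (rule eq_matI)
  fix i j
  assume ij: "i < dim_row (mat_adjoint B * mat_adjoint A)"
    "j < dim_col (mat_adjoint B * mat_adjoint A)"
  then show "mat_adjoint (A * B) $$ (i, j) = (mat_adjoint B * mat_adjoint A) $$ (i, j)"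
    using assms by (simp add: mat_adjoint_alt scalar_prod_def mult.commute)
qed (use assms in \<open>auto simp: mat_adjoint_alt\<close>)

lemma mat_adjoint_one: "mat_adjoint (1\<^sub>m n :: complex mat) = 1\<^sub>m n"
  by (rule eq_matI) (auto simp: mat_adjoint_alt)

lemma mat_adjoint_GL:
  assumes "A \<in> carrier (GL n)"
  shows "mat_adjoint A \<in> carrier (GL n)"
    and "inv\<^bsub>GL n\<^esub> (mat_adjoint A) = mat_adjoint (inv\<^bsub>GL n\<^esub> A)"
proof -
  note A = GL_carrier_mat[OF assms] and B = GL_carrier_mat[OF inv_GL(1)[OF assms]]
  have 1: "mat_adjoint (inv\<^bsub>GL n\<^esub> A) * mat_adjoint A = 1\<^sub>m n"
    "mat_adjoint A * mat_adjoint (inv\<^bsub>GL n\<^esub> A) = 1\<^sub>m n"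
    by (simp_all add: mat_adjoint_mult[OF A B, symmetric] mat_adjoint_mult[OF B A, symmetric]
        inv_GL[OF assms] mat_adjoint_one)
  have 2: "mat_adjoint A \<in> carrier_mat n n" "mat_adjoint (inv\<^bsub>GL n\<^esub> A) \<in> carrier_mat n n"
    using A B by (auto simp: mat_adjoint_alt)
  show 3: "mat_adjoint A \<in> carrier (GL n)"
    using 1 2 by (auto simp: carrier_GL)
  have 4: "mat_adjoint (inv\<^bsub>GL n\<^esub> A) \<in> carrier (GL n)"
    using 1 2 by (auto simp: carrier_GL)
  show "inv\<^bsub>GL n\<^esub> (mat_adjoint A) = mat_adjoint (inv\<^bsub>GL n\<^esub> A)"
    using group.inv_equality[OF group_GL[of n] _ 3 4] 1 by simp
qed

lemma dual_rep_hom: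
  assumes "\<rho> \<in> hom \<Gamma> (GL n)"
  shows "dual_rep n \<rho> \<in> hom \<Gamma> (GL n)"
proof (rule homI)
  fix x assume "x \<in> carrier \<Gamma>"
  then have "\<rho> x \<in> carrier (GL n)" using assms by (auto simp: hom_def)
  then show "dual_rep n \<rho> x \<in> carrier (GL n)"
    by (simp add: dual_rep_def mat_adjoint_GL inv_GL)
next
  fix x y assume xy: "x \<in> carrier \<Gamma>" "y \<in> carrier \<Gamma>"
  then have 1: "\<rho> x \<in> carrier (GL n)" "\<rho> y \<in> carrier (GL n)" using assms by (auto simp: hom_def)
  have "dual_rep n \<rho> (x \<otimes>\<^bsub>\<Gamma>\<^esub> y) = inv\<^bsub>GL n\<^esub> (mat_adjoint (\<rho> y) \<otimes>\<^bsub>GL n\<^esub> mat_adjoint (\<rho> x))"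
    using hom_mult[OF assms xy] 1 by (simp add: dual_rep_def mat_adjoint_mult[OF GL_carrier_mat GL_carrier_mat])
  then show "dual_rep n \<rho> (x \<otimes>\<^bsub>\<Gamma>\<^esub> y) = dual_rep n \<rho> x \<otimes>\<^bsub>GL n\<^esub> dual_rep n \<rho> y"
    using group.inv_mult_group[OF group_GL mat_adjoint_GL(1)[OF 1(2)] mat_adjoint_GL(1)[OF 1(1)]]
    by (simp add: dual_rep_def)
qed

lemma conj_rep_hom:
  assumes "\<rho> \<in> hom \<Gamma> (GL n)" "g \<in> carrier (GL n)"
  shows "conj_rep n g \<rho> \<in> hom \<Gamma> (GL n)"
proof -
  interpret group "GL n" by (rule group_GL)
  have \<rho>: "\<And>x. x \<in> carrier \<Gamma> \<Longrightarrow> \<rho> x \<in> carrier (GL n)" using assms by (auto simp: hom_def)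
  have [simp]: "inv\<^bsub>GL n\<^esub> g \<otimes>\<^bsub>GL n\<^esub> (g \<otimes>\<^bsub>GL n\<^esub> x) = x" if "x \<in> carrier (GL n)" for x
    using assms(2) that inv_solve_left' by (metis m_closed)
  show ?thesis
    using assms \<rho> unfolding conj_rep_def
    by (intro homI) (simp_all add: hom_mult m_assoc del: mult_GL one_GL)
qed

lemma dual_conj_rep:
  assumes "\<rho> \<in> hom \<Gamma> (GL n)" "g \<in> carrier (GL n)" "\<gamma> \<in> carrier \<Gamma>"
  shows "dual_rep n (conj_rep n g \<rho>) \<gamma> = conj_rep n (inv\<^bsub>GL n\<^esub> (mat_adjoint g)) (dual_rep n \<rho>) \<gamma>"
proof -
  interpret group "GL n" by (rule group_GL)
  have \<rho>: "\<rho> \<gamma> \<in> carrier (GL n)" using assms by (auto simp: hom_def)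
  have c: "mat_adjoint (A \<otimes>\<^bsub>GL n\<^esub> B) = mat_adjoint B \<otimes>\<^bsub>GL n\<^esub> mat_adjoint A"
    if "A \<in> carrier (GL n)" "B \<in> carrier (GL n)" for A B
    using that by (simp add: mat_adjoint_mult[OF GL_carrier_mat GL_carrier_mat])
  show ?thesis using \<rho> assms(2)
    by (simp add: dual_rep_def conj_rep_def c mat_adjoint_GL(1) mat_adjoint_GL(2)[symmetric]
        inv_mult_group m_assoc del: mult_GL one_GL)
qed

lemma coord_functions_cong:
  assumes "f \<in> coord_functions S n" "\<And>s. s \<in> S \<Longrightarrow> \<rho> s = \<rho>' s"
  shows "f \<rho> = f \<rho>'"
  using assms by (induction rule: coord_functions.induct) auto

lemma coord_functions_sum:
  "finite I \<Longrightarrow> (\<And>i. i \<in> I \<Longrightarrow> f i \<in> coord_functions S n) \<Longrightarrow>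
    (\<lambda>\<rho>. \<Sum>i\<in>I. f i \<rho>) \<in> coord_functions S n"
  by (induction I rule: finite_induct) (auto intro: coord_functions.intros)

lemma coord_functions_prod:
  "finite I \<Longrightarrow> (\<And>i. i \<in> I \<Longrightarrow> f i \<in> coord_functions S n) \<Longrightarrow>
    (\<lambda>\<rho>. \<Prod>i\<in>I. f i \<rho>) \<in> coord_functions S n"
  by (induction I rule: finite_induct) (auto intro: coord_functions.intros)

lemma coord_functions_det:
  assumes "\<And>i j. i < m \<Longrightarrow> j < m \<Longrightarrow> (\<lambda>\<rho>. F i j \<rho>) \<in> coord_functions S n"
  shows "(\<lambda>\<rho>. det (mat m m (\<lambda>(i, j). F i j \<rho>))) \<in> coord_functions S n"
proof -
  have p: "p i < m" if "p permutes {0..<m}" "i < m" for p i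
    using permutes_in_image[OF that(1), of i] that(2) by simp
  have "(\<lambda>\<rho>. \<Sum>p | p permutes {0..<m}. signof p * (\<Prod>i = 0..<m. F i (p i) \<rho>))
      \<in> coord_functions S n"
    by (intro coord_functions_sum coord_functions.mult coord_functions.const coord_functions_prod
        assms finite_permutations) (simp_all add: p)
  moreover have "(\<Sum>p | p permutes {0..<m}. signof p * (\<Prod>i = 0..<m. F i (p i) \<rho>)) =
      det (mat m m (\<lambda>(i, j). F i j \<rho>))" for \<rho>
    unfolding det_def'[OF mat_carrier] by (rule sum.cong) (simp_all add: p)
  ultimately show ?thesis by simp
qed

lemma inv_GL_entry:
  assumes A: "A \<in> carrier (GL n)" and ij: "i < n" "j < n"
  shows "(inv\<^bsub>GL n\<^esub> A) $$ (i, j) = inverse (det A) * ((-1) ^ (j + i) *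
    det (mat (n - 1) (n - 1) (\<lambda>(k, l). A $$ (insert_index j k, insert_index i l))))"
proof -
  note cA = GL_carrier_mat[OF A] and cB = GL_carrier_mat[OF inv_GL(1)[OF A]]
  note adj = adj_mat[OF cA]
  have "adj_mat A = (inv\<^bsub>GL n\<^esub> A * A) * adj_mat A" using adj(1) inv_GL[OF A] by simp
  also have "\<dots> = inv\<^bsub>GL n\<^esub> A * (det A \<cdot>\<^sub>m 1\<^sub>m n)"
    using adj assoc_mult_mat[OF cB cA adj(1)] by simp
  also have "\<dots> = det A \<cdot>\<^sub>m inv\<^bsub>GL n\<^esub> A"
    using cB by (simp add: mult_smult_distrib[OF cB one_carrier_mat])
  finally have "adj_mat A $$ (i, j) = det A * (inv\<^bsub>GL n\<^esub> A) $$ (i, j)" using cB ij by simp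
  moreover have "mat_delete A j i =
      mat (n - 1) (n - 1) (\<lambda>(k, l). A $$ (insert_index j k, insert_index i l))"
    using cA by (auto simp: mat_delete_def insert_index_def)
  ultimately show ?thesis
    using cA ij det_GL[OF A] by (auto simp: adj_mat_def cofactor_def field_simps)
qed

lemma coord_functions_dual:
  assumes "f \<in> coord_functions S n" "S \<subseteq> carrier \<Gamma>"
  shows "\<exists>g \<in> coord_functions S n. \<forall>\<rho> \<in> hom \<Gamma> (GL n). g \<rho> = cnj (f (dual_rep n \<rho>))"
  using assms(1)
proof (induction rule: coord_functions.induct)
  case (const c)
  show ?case by (rule bexI[OF _ coord_functions.const[of "cnj c"]]) simp
next
  case (entry s i j)
  let ?g = "\<lambda>\<rho> :: 'a \<Rightarrow> complex mat. inverse (det (\<rho> s)) * ((-1) ^ (i + j) *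
    det (mat (n - 1) (n - 1) (\<lambda>(k, l). \<rho> s $$ (insert_index i k, insert_index j l))))"
  have "?g \<in> coord_functions S n"
    using entry by (intro coord_functions.mult coord_functions.inv_det coord_functions.const
        coord_functions_det coord_functions.entry) (auto simp: insert_index_def)
  moreover have "?g \<rho> = cnj (dual_rep n \<rho> s $$ (i, j))" if "\<rho> \<in> hom \<Gamma> (GL n)" for \<rho>
  proof -
    have "\<rho> s \<in> carrier (GL n)" using that entry assms(2) by (auto simp: hom_def)
    then show ?thesis
      using entry inv_GL_entry[of "\<rho> s" n j i] GL_carrier_mat[OF inv_GL(1)[of "\<rho> s" n]]
      unfolding dual_rep_def mat_adjoint_GL(2)[OF \<open>\<rho> s \<in> carrier (GL n)\<close>]
      by (simp add: mat_adjoint_alt)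
  qed
  ultimately show ?case by (intro bexI[of _ ?g]) simp_all
next
  case (inv_det s)
  let ?g = "\<lambda>\<rho> :: 'a \<Rightarrow> complex mat. det (mat n n (\<lambda>(i, j). \<rho> s $$ (i, j)))"
  have "?g \<in> coord_functions S n"
    using inv_det by (intro coord_functions_det coord_functions.entry)
  moreover have "?g \<rho> = cnj (inverse (det (dual_rep n \<rho> s)))" if "\<rho> \<in> hom \<Gamma> (GL n)" for \<rho>
  proof -
    have A: "\<rho> s \<in> carrier (GL n)" using that inv_det assms(2) by (auto simp: hom_def)
    interpret cnj: comm_ring_hom cnj by unfold_locales auto
    have B: "inv\<^bsub>GL n\<^esub> (\<rho> s) \<in> carrier_mat n n" using A by (intro GL_carrier_mat inv_GL)
    have "det (dual_rep n \<rho> s) = cnj (det (inv\<^bsub>GL n\<^esub> (\<rho> s)))"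
      unfolding dual_rep_def mat_adjoint_GL(2)[OF A]
      by (simp add: mat_adjoint_alt det_transpose[OF B])
    moreover have "mat n n (\<lambda>(i, j). \<rho> s $$ (i, j)) = \<rho> s"
      using GL_carrier_mat[OF A] by auto
    ultimately show ?thesis using det_GL[OF A] by (simp add: inverse_unique mult.commute)
  qed
  ultimately show ?case by (intro bexI[of _ ?g]) simp_all
next
  case (add f g)
  then obtain f' g' where "f' \<in> coord_functions S n" "g' \<in> coord_functions S n"
    "\<forall>\<rho> \<in> hom \<Gamma> (GL n). f' \<rho> = cnj (f (dual_rep n \<rho>)) \<and> g' \<rho> = cnj (g (dual_rep n \<rho>))" by blast
  then show ?case by (intro bexI[OF _ coord_functions.add[of f' S n g']]) auto
next
  case (mult f g)
  then obtain f' g' where "f' \<in> coord_functions S n" "g' \<in> coord_functions S n"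
    "\<forall>\<rho> \<in> hom \<Gamma> (GL n). f' \<rho> = cnj (f (dual_rep n \<rho>)) \<and> g' \<rho> = cnj (g (dual_rep n \<rho>))" by blast
  then show ?case by (intro bexI[OF _ coord_functions.mult[of f' S n g']]) auto
qed

lemma chi_dual_rep_cong:
  assumes S: "S \<subseteq> carrier \<Gamma>"
    and \<rho>: "\<rho> \<in> hom \<Gamma> (GL n)" "\<rho>' \<in> hom \<Gamma> (GL n)" "chi \<Gamma> S n \<rho> = chi \<Gamma> S n \<rho>'"
  shows "chi \<Gamma> S n (dual_rep n \<rho>) = chi \<Gamma> S n (dual_rep n \<rho>')"
  unfolding chi_def
proof (rule restrict_ext)
  fix f assume f: "f \<in> invariant_functions \<Gamma> S n"
  then obtain p where p: "p \<in> coord_functions S n" "f = restrict p (hom \<Gamma> (GL n))"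
    by (auto simp: invariant_functions_def regular_functions_def)
  obtain q where q: "q \<in> coord_functions S n"
    "\<And>\<rho>. \<rho> \<in> hom \<Gamma> (GL n) \<Longrightarrow> q \<rho> = cnj (p (dual_rep n \<rho>))"
    using coord_functions_dual[OF p(1) S] by blast
  have "q (conj_rep n g \<sigma>) = q \<sigma>" if \<sigma>: "\<sigma> \<in> hom \<Gamma> (GL n)" and g: "g \<in> carrier (GL n)" for \<sigma> g
  proof -
    let ?h = "inv\<^bsub>GL n\<^esub> (mat_adjoint g)"
    have h: "?h \<in> carrier (GL n)" using g by (simp add: mat_adjoint_GL inv_GL)
    have "p (dual_rep n (conj_rep n g \<sigma>)) = p (conj_rep n ?h (dual_rep n \<sigma>))"
      using S by (intro coord_functions_cong[OF p(1)] dual_conj_rep[OF \<sigma> g]) auto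
    also have "\<dots> = f (conj_rep n ?h (dual_rep n \<sigma>))"
      using conj_rep_hom[OF dual_rep_hom[OF \<sigma>] h] by (simp add: p)
    also have "\<dots> = f (dual_rep n \<sigma>)"
      using f h dual_rep_hom[OF \<sigma>] by (auto simp: invariant_functions_def)
    also have "\<dots> = p (dual_rep n \<sigma>)" using dual_rep_hom[OF \<sigma>] by (simp add: p)
    finally show ?thesis by (simp add: q(2) \<sigma> conj_rep_hom[OF \<sigma> g])
  qed
  then have inv: "restrict q (hom \<Gamma> (GL n)) \<in> invariant_functions \<Gamma> S n"
    using q(1) by (auto simp: invariant_functions_def regular_functions_def conj_rep_hom)
  have "q \<rho> = q \<rho>'"
    using fun_cong[OF \<rho>(3), of "restrict q (hom \<Gamma> (GL n))"] inv \<rho>(1,2) by (simp add: chi_def)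
  then show "f (dual_rep n \<rho>) = f (dual_rep n \<rho>')"
    using \<rho>(1,2) by (simp add: p(2) q(2) dual_rep_hom)
qed

lemma Phi2_chi:
  assumes "S \<subseteq> carrier \<Gamma>" "\<rho> \<in> hom \<Gamma> (GL n)"
  shows "Phi2 \<Gamma> S n (chi \<Gamma> S n \<rho>) = chi \<Gamma> S n (dual_rep n \<rho>)"
  unfolding Phi2_def
proof (rule the_equality)
  fix y
  assume "\<exists>\<rho>' \<in> hom \<Gamma> (GL n). chi \<Gamma> S n \<rho> = chi \<Gamma> S n \<rho>' \<and> y = chi \<Gamma> S n (dual_rep n \<rho>')"
  then show "y = chi \<Gamma> S n (dual_rep n \<rho>)"
    using chi_dual_rep_cong[OF assms(1)] assms(2) by metis
qed (use assms(2) in blast)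

end

theory Submission
  imports Defs
begin

text \<open>
  A representation into \<open>U(p,q)\<close> preserves the form with matrix \<open>I\<^bsub>p,q\<^esub>\<close>, so this matrix conjugates it
  into its dual and its character is fixed by \<open>\<Phi>\<^sub>2\<close> (\<open>X_U_subset_fixed\<close>).

  For the converse, a fixed character has to be realised by a representation \<open>\<sigma>\<close> that preserves a
  nondegenerate Hermitian form \<open>h\<close>; writing \<open>h\<close> as \<open>R\<^sup>* I\<^bsub>p,q\<^esub> R\<close> (\<open>hermitian_congruent_Ipq\<close>) and
  conjugating by \<open>R\<close> then gives a representation into \<open>U(p,q)\<close>. Invariance of \<open>h\<close> says that \<open>h\<close>
  intertwines \<open>\<sigma>\<close> with its dual \<open>\<sigma>'\<close>. The two have the same character, hence the same traces
  (\<open>chi_eq_imp_tr_eq\<close>), so for a semisimple \<open>\<sigma>\<close> an intertwiner is to be expected, but it must also be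
  Hermitian and invertible.

  Semisimplicity is arranged metrically, in the spirit of Kempf and Ness. The set of all
  representations with the given character is closed and stable under conjugation. On it the sum of
  the squared norms of the matrices of the generators and of their inverses attains a minimum
  (\<open>minimal_rep_exists\<close>). Testing a minimal \<open>\<sigma>\<close> against conjugation by matrices that rescale one
  direction shows that the generators \<open>X\<^sub>k\<close> satisfy \<open>\<Sum>\<^sub>k |X\<^sub>k v|\<^sup>2 = \<Sum>\<^sub>k |X\<^sub>k\<^sup>* v|\<^sup>2\<close> for all vectors \<open>v\<close>
  (\<open>minimal_imp_balanced\<close>). Under such a balance condition a subspace that is invariant under all
  \<open>X\<^sub>k\<close> is also invariant under all \<open>X\<^sub>k\<^sup>*\<close> (\<open>adjoint_invariant\<close>). The dual of a balanced representation
  is balanced, so this applies to left multiplication on the span \<open>B\<close> of the pairs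
  \<open>(\<sigma> \<gamma>, \<sigma>' \<gamma>)\<close>. Thus \<open>B\<close> is an algebra of pairs of matrices that is closed under adjoints, under
  exchanging the two components, and whose members have components of equal trace.

  For such an algebra everything is explicit. If \<open>(a\<^sub>j, c\<^sub>j)\<close> is an orthonormal basis of \<open>B\<close>, then every
  Casimir sum \<open>\<Sum>\<^sub>j c\<^sub>j M a\<^sub>j\<^sup>*\<close> intertwines, and equality of traces prevents all of them from vanishing
  (\<open>nonzero_intertwiner\<close>). Passing to a Hermitian combination and diagonalising it unitarily splits \<open>B\<close>
  into blocks: on the first block the intertwiner is invertible, and the block of its kernel is again
  an algebra of the same kind and smaller size. Induction on the size produces an invertible Hermitian
  intertwiner (\<open>invertible_hermitian_intertwiner\<close>).
\<close>

section \<open>Finite-dimensional Hilbert spaces of functions\<close>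

definition ip :: "'i set \<Rightarrow> ('i \<Rightarrow> complex) \<Rightarrow> ('i \<Rightarrow> complex) \<Rightarrow> complex" where
  "ip I u v = (\<Sum>i\<in>I. cnj (u i) * v i)"

definition nrm2 :: "'i set \<Rightarrow> ('i \<Rightarrow> complex) \<Rightarrow> real" where
  "nrm2 I u = (\<Sum>i\<in>I. (cmod (u i))\<^sup>2)"

definition kernel_app :: "'i set \<Rightarrow> ('i \<Rightarrow> 'i \<Rightarrow> complex) \<Rightarrow> ('i \<Rightarrow> complex) \<Rightarrow> 'i \<Rightarrow> complex" where
  "kernel_app I M u = (\<lambda>i. \<Sum>j\<in>I. M i j * u j)"

definition kernel_adj :: "('i \<Rightarrow> 'i \<Rightarrow> complex) \<Rightarrow> 'i \<Rightarrow> 'i \<Rightarrow> complex" where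
  "kernel_adj M = (\<lambda>i j. cnj (M j i))"

text \<open>
  Functions stand for vectors indexed by \<open>I\<close>, so membership is required to depend only on the values on \<open>I\<close>.
\<close>

definition subspace_on :: "'i set \<Rightarrow> ('i \<Rightarrow> complex) set \<Rightarrow> bool" where
  "subspace_on I A \<longleftrightarrow> (\<lambda>_. 0) \<in> A \<and>
     (\<forall>u\<in>A. \<forall>v\<in>A. (\<lambda>i. u i + v i) \<in> A) \<and> (\<forall>c. \<forall>u\<in>A. (\<lambda>i. c * u i) \<in> A) \<and>
     (\<forall>u\<in>A. \<forall>v. (\<forall>i\<in>I. v i = u i) \<longrightarrow> v \<in> A)"

lemma subspace_onD:
  assumes "subspace_on I A"
  shows "(\<lambda>_. 0) \<in> A"
    and "u \<in> A \<Longrightarrow> v \<in> A \<Longrightarrow> (\<lambda>i. u i + v i) \<in> A"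
    and "u \<in> A \<Longrightarrow> (\<lambda>i. c * u i) \<in> A"
    and "u \<in> A \<Longrightarrow> (\<And>i. i \<in> I \<Longrightarrow> v i = u i) \<Longrightarrow> v \<in> A"
  using assms by (simp_all add: subspace_on_def)

lemma subspace_on_sum:
  fixes m :: nat
  assumes "subspace_on I A" "\<And>j. j < m \<Longrightarrow> f j \<in> A"
  shows "(\<lambda>i. \<Sum>j<m. c j * f j i) \<in> A"
  using assms(2)
proof (induction m)
  case (Suc m)
  show ?case
    using subspace_onD(2)[OF assms(1) Suc.IH subspace_onD(3)[OF assms(1), of "f m" "c m"]] Suc.prems by simp
qed (use subspace_onD(1)[OF assms(1)] in simp)

definition orthonormal :: "'i set \<Rightarrow> nat \<Rightarrow> (nat \<Rightarrow> 'i \<Rightarrow> complex) \<Rightarrow> bool" where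
  "orthonormal I d e \<longleftrightarrow> (\<forall>j<d. \<forall>k<d. ip I (e j) (e k) = (if j = k then 1 else 0))"

lemma ip_self: "ip I u u = of_real (nrm2 I u)"
  by (simp add: ip_def nrm2_def complex_norm_square mult.commute del: of_real_power)

lemma ip_cnj: "cnj (ip I u v) = ip I v u"
  by (simp add: ip_def mult.commute)

lemma ip_sum_right: "ip I u (\<lambda>i. \<Sum>j\<in>J. c j * f j i) = (\<Sum>j\<in>J. c j * ip I u (f j))"
  unfolding ip_def sum_distrib_left by (subst sum.swap) (simp add: mult.left_commute)

lemma ip_diff_right: "ip I u (\<lambda>i. v i - w i) = ip I u v - ip I u w"
  by (simp add: ip_def right_diff_distrib sum_subtractf)

lemma ip_diff_left: "ip I (\<lambda>i. v i - w i) u = ip I v u - ip I w u"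
  by (simp add: ip_def left_diff_distrib sum_subtractf)

lemma ip_kernel_adj: "ip I (kernel_app I (kernel_adj M) u) v = ip I u (kernel_app I M v)"
proof -
  have "ip I (kernel_app I (kernel_adj M) u) v = (\<Sum>i\<in>I. \<Sum>j\<in>I. M j i * cnj (u j) * v i)"
    by (simp add: ip_def kernel_app_def kernel_adj_def sum_distrib_right)
  also have "\<dots> = (\<Sum>j\<in>I. \<Sum>i\<in>I. M j i * cnj (u j) * v i)" by (rule sum.swap)
  also have "\<dots> = ip I u (kernel_app I M v)"
    by (simp add: ip_def kernel_app_def sum_distrib_left mult.commute mult.left_commute)
  finally show ?thesis .
qed

lemma nrm2_nonneg: "nrm2 I u \<ge> 0" by (simp add: nrm2_def sum_nonneg)

lemma nrm2_eq_0: "finite I \<Longrightarrow> nrm2 I u = 0 \<Longrightarrow> i \<in> I \<Longrightarrow> u i = 0"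
  by (simp add: nrm2_def sum_nonneg_eq_0_iff)

text \<open>
  Pythagoras for the orthogonal projection onto the span of an orthonormal family.
\<close>

lemma nrm2_residual:
  assumes "orthonormal I d e"
  shows "nrm2 I (\<lambda>i. u i - (\<Sum>j<d. ip I (e j) u * e j i)) =
    nrm2 I u - (\<Sum>j<d. (cmod (ip I (e j) u))\<^sup>2)"
proof -
  let ?p = "\<lambda>i. \<Sum>j<d. ip I (e j) u * e j i"
  have ep: "ip I (e k) ?p = ip I (e k) u" if "k < d" for k
  proof -
    have "ip I (e k) ?p = (\<Sum>j<d. ip I (e j) u * ip I (e k) (e j))" by (rule ip_sum_right)
    also have "\<dots> = (\<Sum>j<d. if j = k then ip I (e j) u else 0)"
      using assms that by (intro sum.cong) (auto simp: orthonormal_def)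
    finally show ?thesis using that by simp
  qed
  have up: "ip I u ?p = of_real (\<Sum>j<d. (cmod (ip I (e j) u))\<^sup>2)"
    by (simp add: ip_sum_right complex_norm_square ip_cnj del: of_real_power)
  have "ip I ?p ?p = (\<Sum>j<d. ip I (e j) u * ip I ?p (e j))" by (rule ip_sum_right)
  also have "\<dots> = (\<Sum>j<d. ip I (e j) u * cnj (ip I (e j) u))"
    unfolding ip_cnj[of I _ ?p, symmetric] using ep by (intro sum.cong) auto
  also have "\<dots> = of_real (\<Sum>j<d. (cmod (ip I (e j) u))\<^sup>2)"
    by (simp add: complex_norm_square del: of_real_power)
  finally have pp: "ip I ?p ?p = of_real (\<Sum>j<d. (cmod (ip I (e j) u))\<^sup>2)" .
  have pu: "ip I ?p u = of_real (\<Sum>j<d. (cmod (ip I (e j) u))\<^sup>2)"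
    unfolding ip_cnj[of I u ?p, symmetric] up by simp
  have "complex_of_real (nrm2 I (\<lambda>i. u i - ?p i)) =
    of_real (nrm2 I u - (\<Sum>j<d. (cmod (ip I (e j) u))\<^sup>2))"
    unfolding ip_self[symmetric] ip_diff_left ip_diff_right up pp pu
    by (simp add: ip_self)
  then show ?thesis by (simp only: of_real_eq_iff)
qed

lemma bessel: "orthonormal I d e \<Longrightarrow> (\<Sum>j<d. (cmod (ip I (e j) u))\<^sup>2) \<le> nrm2 I u"
  using nrm2_residual[of I d e u] nrm2_nonneg[of I "\<lambda>i. u i - (\<Sum>j<d. ip I (e j) u * e j i)"] by simp

text \<open>
  Summing Bessel's inequality over the coordinate vectors bounds the sum of the squared norms of the
  family, which is its length, by the number of coordinates.
\<close>

lemma orthonormal_card: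
  assumes "finite I" "orthonormal I d e"
  shows "d \<le> card I"
proof -
  have "real d = (\<Sum>j<d. nrm2 I (e j))"
  proof -
    have "nrm2 I (e j) = 1" if "j < d" for j
      using assms(2) that ip_self[of I "e j"] by (simp add: orthonormal_def)
    then show ?thesis by simp
  qed
  also have "\<dots> = (\<Sum>i\<in>I. \<Sum>j<d. (cmod (e j i))\<^sup>2)"
    unfolding nrm2_def by (rule sum.swap)
  also have "\<dots> \<le> (\<Sum>i\<in>I. 1)"
  proof (rule sum_mono)
    fix i assume i: "i \<in> I"
    let ?u = "\<lambda>k. if k = i then 1 else 0 :: complex"
    have "ip I (e j) ?u = cnj (e j i)" for j
    proof -
      have "ip I (e j) ?u = (\<Sum>k\<in>I. if k = i then cnj (e j k) else 0)"
        unfolding ip_def by (rule sum.cong) auto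
      then show ?thesis using assms(1) i by simp
    qed
    moreover have "nrm2 I ?u = 1"
    proof -
      have "nrm2 I ?u = (\<Sum>k\<in>I. if k = i then 1 else 0)"
        unfolding nrm2_def by (rule sum.cong) auto
      then show ?thesis using assms(1) i by simp
    qed
    ultimately show "(\<Sum>j<d. (cmod (e j i))\<^sup>2) \<le> 1"
      using bessel[OF assms(2), of ?u] by simp
  qed
  finally show ?thesis by simp
qed

text \<open>
  An orthonormal family in \<open>A\<close> of maximal length spans \<open>A\<close>: otherwise the normalised residual of a
  vector outside its span would extend it.
\<close>

lemma orthonormal_basis_exists:
  assumes fin: "finite I" and A: "subspace_on I A"
  obtains d e where "orthonormal I d e" "\<And>j. j < d \<Longrightarrow> e j \<in> A"
    "\<And>u i. u \<in> A \<Longrightarrow> i \<in> I \<Longrightarrow> u i = (\<Sum>j<d. ip I (e j) u * e j i)"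
proof -
  define Q where "Q d \<longleftrightarrow> (\<exists>e. orthonormal I d e \<and> (\<forall>j<d. e j \<in> A))" for d
  have "Q 0" by (simp add: Q_def orthonormal_def)
  moreover have "\<forall>d. Q d \<longrightarrow> d \<le> card I" using orthonormal_card[OF fin] by (auto simp: Q_def)
  ultimately obtain d where d: "Q d" "\<And>d'. Q d' \<Longrightarrow> d' \<le> d"
    using Nat.ex_has_greatest_nat[of Q 0 "card I"] by blast
  then obtain e where e: "orthonormal I d e" "\<And>j. j < d \<Longrightarrow> e j \<in> A" by (auto simp: Q_def)
  have "u i = (\<Sum>j<d. ip I (e j) u * e j i)" if u: "u \<in> A" and i: "i \<in> I" for u i
  proof (rule ccontr)
    assume ne: "u i \<noteq> (\<Sum>j<d. ip I (e j) u * e j i)"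
    define w where "w = (\<lambda>i. u i - (\<Sum>j<d. ip I (e j) u * e j i))"
    have w: "w \<in> A"
    proof -
      have "(\<lambda>i. \<Sum>j<d. (- ip I (e j) u) * e j i) \<in> A"
        by (rule subspace_on_sum[OF A e(2)])
      from subspace_onD(2)[OF A u this] show ?thesis by (simp add: w_def sum_negf)
    qed
    have ew: "ip I (e k) w = 0" if "k < d" for k
    proof -
      have "(\<Sum>j<d. ip I (e j) u * ip I (e k) (e j)) = (\<Sum>j<d. if j = k then ip I (e j) u else 0)"
        using e(1) that by (intro sum.cong) (auto simp: orthonormal_def)
      then show ?thesis using that by (simp add: w_def ip_diff_right ip_sum_right)
    qed
    have pos: "nrm2 I w > 0"
      using nrm2_eq_0[OF fin, of w i] i ne nrm2_nonneg[of I w] by (fastforce simp: w_def)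
    define r where "r = complex_of_real (1 / sqrt (nrm2 I w))"
    define e' where "e' = e(d := \<lambda>i. r * w i)"
    have cr: "cnj r = r" by (simp add: r_def)
    have ip_r: "ip I v (\<lambda>i. r * w i) = r * ip I v w" "ip I (\<lambda>i. r * w i) v = r * ip I w v" for v
      by (simp_all add: ip_def cr sum_distrib_left ac_simps)
    have we: "ip I w (e k) = 0" if "k < d" for k
      using ew[OF that] by (metis ip_cnj complex_cnj_zero)
    have "r * (r * ip I w w) = 1"
    proof -
      have "1 / sqrt (nrm2 I w) * (1 / sqrt (nrm2 I w) * nrm2 I w) = 1"
        using pos by (simp add: field_simps)
      then show ?thesis unfolding r_def ip_self by (metis of_real_mult of_real_1)
    qed
    then have "orthonormal I (Suc d) e'"
      using e(1) ew we by (auto simp: orthonormal_def e'_def less_Suc_eq ip_r)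
    moreover have "\<forall>j<Suc d. e' j \<in> A"
      using e(2) subspace_onD(3)[OF A w] by (auto simp: e'_def less_Suc_eq)
    ultimately show False using d(2)[of "Suc d"] by (auto simp: Q_def)
  qed
  with e show ?thesis using that by blast
qed

text \<open>
  Let \<open>e\<^sub>j\<close> be an orthonormal basis of \<open>A\<close>. As \<open>M\<^sub>k e\<^sub>j\<close> lies in \<open>A\<close>, Parseval gives
  \<open>\<Sum>\<^sub>j |M\<^sub>k e\<^sub>j|\<^sup>2 = \<Sum>\<^sub>j\<^sub>,\<^sub>l |<e\<^sub>l, M\<^sub>k e\<^sub>j>|\<^sup>2\<close>, while the same double sum only accounts for the part of
  \<open>\<Sum>\<^sub>j |M\<^sub>k\<^sup>* e\<^sub>j|\<^sup>2\<close> that comes from the projections of \<open>M\<^sub>k\<^sup>* e\<^sub>j\<close> to \<open>A\<close>. Since the two sums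
  agree after summation over \<open>k\<close>, all distances of the \<open>M\<^sub>k\<^sup>* e\<^sub>j\<close> from \<open>A\<close> are zero.
\<close>

lemma adjoint_invariant:
  assumes fin: "finite I" "finite K" and A: "subspace_on I A"
    and inv: "\<And>k u. k \<in> K \<Longrightarrow> u \<in> A \<Longrightarrow> kernel_app I (M k) u \<in> A"
    and bal: "\<And>u. (\<Sum>k\<in>K. nrm2 I (kernel_app I (kernel_adj (M k)) u)) = (\<Sum>k\<in>K. nrm2 I (kernel_app I (M k) u))"
    and k: "k \<in> K" and u: "u \<in> A"
  shows "kernel_app I (kernel_adj (M k)) u \<in> A"
proof -
  obtain d e where on: "orthonormal I d e" and eA: "\<And>j. j < d \<Longrightarrow> e j \<in> A"
    and exp: "\<And>u i. u \<in> A \<Longrightarrow> i \<in> I \<Longrightarrow> u i = (\<Sum>j<d. ip I (e j) u * e j i)"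
    using orthonormal_basis_exists[OF fin(1) A] by blast
  define res where "res k j = nrm2 I (\<lambda>i. kernel_app I (kernel_adj (M k)) (e j) i -
     (\<Sum>l<d. ip I (e l) (kernel_app I (kernel_adj (M k)) (e j)) * e l i))" for k j
  have parseval: "nrm2 I u = (\<Sum>j<d. (cmod (ip I (e j) u))\<^sup>2)" if "u \<in> A" for u
  proof -
    have "nrm2 I (\<lambda>i. u i - (\<Sum>j<d. ip I (e j) u * e j i)) = 0"
      unfolding nrm2_def using exp[OF that] by simp
    then show ?thesis using nrm2_residual[OF on, of u] by simp
  qed
  have "(\<Sum>j<d. nrm2 I (kernel_app I (M k) (e j))) =
      (\<Sum>j<d. \<Sum>l<d. (cmod (ip I (e l) (kernel_app I (M k) (e j))))\<^sup>2)" if "k \<in> K" for k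
    by (intro sum.cong refl parseval inv that eA) simp
  also have "(\<Sum>j<d. \<Sum>l<d. (cmod (ip I (e l) (kernel_app I (M k) (e j))))\<^sup>2) =
      (\<Sum>j<d. \<Sum>l<d. (cmod (ip I (e l) (kernel_app I (kernel_adj (M k)) (e j))))\<^sup>2)" for k
  proof -
    have "cmod (ip I (e l) (kernel_app I (M k) (e j))) = cmod (ip I (e j) (kernel_app I (kernel_adj (M k)) (e l)))" for l j
      by (metis ip_kernel_adj ip_cnj complex_mod_cnj)
    then show ?thesis by (subst sum.swap) simp
  qed
  finally have "(\<Sum>j<d. res k j) =
     (\<Sum>j<d. nrm2 I (kernel_app I (kernel_adj (M k)) (e j))) - (\<Sum>j<d. nrm2 I (kernel_app I (M k) (e j)))"
    if "k \<in> K" for k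
    using that by (simp add: res_def nrm2_residual[OF on] sum_subtractf)
  then have "(\<Sum>k\<in>K. \<Sum>j<d. res k j) =
     (\<Sum>k\<in>K. \<Sum>j<d. nrm2 I (kernel_app I (kernel_adj (M k)) (e j))) - (\<Sum>k\<in>K. \<Sum>j<d. nrm2 I (kernel_app I (M k) (e j)))"
    by (simp add: sum_subtractf)
  also have "\<dots> = 0"
  proof -
    have "(\<Sum>k\<in>K. \<Sum>j<d. nrm2 I (kernel_app I (M' k) (e j))) =
      (\<Sum>j<d. \<Sum>k\<in>K. nrm2 I (kernel_app I (M' k) (e j)))" for M'
      by (rule sum.swap)
    then show ?thesis using bal by simp
  qed
  finally have "(\<Sum>k\<in>K. \<Sum>j<d. res k j) = 0" .
  moreover have nn: "res k j \<ge> 0" for k j by (simp add: res_def nrm2_nonneg)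
  ultimately have "(\<Sum>j<d. res k j) = 0"
    using fin(2) k by (subst (asm) sum_nonneg_eq_0_iff) (auto intro: sum_nonneg)
  then have z: "res k j = 0" if "j < d" for j
    using nn that by (subst (asm) sum_nonneg_eq_0_iff) auto
  have eM: "kernel_app I (kernel_adj (M k)) (e j) \<in> A" if "j < d" for j
  proof -
    have "kernel_app I (kernel_adj (M k)) (e j) i = (\<Sum>l<d. ip I (e l) (kernel_app I (kernel_adj (M k)) (e j)) * e l i)"
      if "i \<in> I" for i
      using nrm2_eq_0[OF fin(1) z[OF \<open>j < d\<close>, unfolded res_def] that] by simp
    moreover have "(\<lambda>i. \<Sum>l<d. ip I (e l) (kernel_app I (kernel_adj (M k)) (e j)) * e l i) \<in> A"
      by (rule subspace_on_sum[OF A]) (rule eA)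
    ultimately show ?thesis using subspace_onD(4)[OF A] by blast
  qed
  have "kernel_app I (kernel_adj (M k)) u = (\<lambda>i. \<Sum>j<d. ip I (e j) u * kernel_app I (kernel_adj (M k)) (e j) i)"
  proof
    fix i
    have "kernel_app I (kernel_adj (M k)) u i = (\<Sum>l\<in>I. kernel_adj (M k) i l * (\<Sum>j<d. ip I (e j) u * e j l))"
      unfolding kernel_app_def using exp[OF u] by (intro sum.cong) auto
    also have "\<dots> = (\<Sum>j<d. \<Sum>l\<in>I. kernel_adj (M k) i l * (ip I (e j) u * e j l))"
      unfolding sum_distrib_left by (rule sum.swap)
    finally show "kernel_app I (kernel_adj (M k)) u i = (\<Sum>j<d. ip I (e j) u * kernel_app I (kernel_adj (M k)) (e j) i)"
      by (simp add: kernel_app_def sum_distrib_left mult.left_commute)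
  qed
  then show ?thesis using subspace_on_sum[OF A, of d "\<lambda>j. kernel_app I (kernel_adj (M k)) (e j)"] eM by simp
qed

section \<open>Unitary diagonalisation of Hermitian matrices\<close>

lemma mat_adjoint_carrier [simp, intro]:
  "A \<in> carrier_mat n m \<Longrightarrow> mat_adjoint (A :: complex mat) \<in> carrier_mat m n"
  by (auto simp: mat_adjoint_alt)

lemma mat_adjoint_index:
  "i < dim_col A \<Longrightarrow> j < dim_row A \<Longrightarrow> mat_adjoint A $$ (i, j) = cnj (A $$ (j, i))"
  by (simp add: mat_adjoint_alt)

lemma mat_adjoint_dim [simp]:
  "dim_row (mat_adjoint (A :: complex mat)) = dim_col A"
  "dim_col (mat_adjoint (A :: complex mat)) = dim_row A"
  by (simp_all add: mat_adjoint_alt)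

lemma mat_adjoint_adjoint [simp]: "mat_adjoint (mat_adjoint A) = (A :: complex mat)"
  by (rule eq_matI) (auto simp: mat_adjoint_alt)

lemma mat_adjoint_four_block:
  assumes "A \<in> carrier_mat r r" "B \<in> carrier_mat r m" "C \<in> carrier_mat m r" "D \<in> carrier_mat m m"
  shows "mat_adjoint (four_block_mat A B C D :: complex mat) =
    four_block_mat (mat_adjoint A) (mat_adjoint C) (mat_adjoint B) (mat_adjoint D)"
  using assms by (intro eq_matI) (auto simp: mat_adjoint_index)

lemma four_block_diag_mult:
  assumes "A \<in> carrier_mat r r" "D \<in> carrier_mat m m" "A' \<in> carrier_mat r r" "D' \<in> carrier_mat m m"
  shows "four_block_mat A (0\<^sub>m r m) (0\<^sub>m m r) D * four_block_mat A' (0\<^sub>m r m) (0\<^sub>m m r) D' =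
    four_block_mat (A * A' :: complex mat) (0\<^sub>m r m) (0\<^sub>m m r) (D * D')"
  using assms by (subst mult_four_block_mat[of _ r r _ m _ m _ _ r _ m]) auto

lemma four_block_one: "four_block_mat (1\<^sub>m r) (0\<^sub>m r m) (0\<^sub>m m r) (1\<^sub>m m) = (1\<^sub>m (r + m) :: complex mat)"
  by (intro eq_matI) auto

definition unitary :: "nat \<Rightarrow> complex mat \<Rightarrow> bool" where
  "unitary n U \<longleftrightarrow> U \<in> carrier_mat n n \<and> mat_adjoint U * U = 1\<^sub>m n \<and> U * mat_adjoint U = 1\<^sub>m n"

lemma unitaryD:
  assumes "unitary n U"
  shows "U \<in> carrier_mat n n" "mat_adjoint U \<in> carrier_mat n n"
    "mat_adjoint U * U = 1\<^sub>m n" "U * mat_adjoint U = 1\<^sub>m n"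
  using assms by (auto simp: unitary_def)

lemma unitaryI:
  assumes "U \<in> carrier_mat n n" "mat_adjoint U * U = 1\<^sub>m n"
  shows "unitary n U"
  using mat_mult_left_right_inverse[OF _ assms(1,2)] assms by (auto simp: unitary_def)

lemma unitary_adjoint: "unitary n U \<Longrightarrow> unitary n (mat_adjoint U)"
  by (auto simp: unitary_def)

lemma mat_assoc:
  assumes "A \<in> carrier_mat n n" "B \<in> carrier_mat n n" "C \<in> carrier_mat n n"
  shows "(A * B) * C = A * (B * C :: complex mat)"
  using assms by (rule assoc_mult_mat)

lemma mat_closed:
  "A \<in> carrier_mat n n \<Longrightarrow> B \<in> carrier_mat n n \<Longrightarrow> A * B \<in> carrier_mat n n"
  by simp

text \<open>
  Rewriting with \<open>mat_simps\<close> and \<open>mat_cancel\<close> brings products of \<open>n \<times> n\<close> matrices into right-nested form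
  and removes adjacent inverses.
\<close>

lemmas mat_simps = mat_assoc mat_closed

lemma mat_cancel:
  assumes "A \<in> carrier_mat n n" "B \<in> carrier_mat n n" "C \<in> carrier_mat n n" "A * B = 1\<^sub>m n"
  shows "A * (B * C) = (C :: complex mat)"
  using assms by (metis assoc_mult_mat left_mult_one_mat)

lemma unitary_mult:
  assumes "unitary n U" "unitary n V"
  shows "unitary n (U * V)"
proof (rule unitaryI)
  note U = unitaryD[OF assms(1)] and V = unitaryD[OF assms(2)]
  show "U * V \<in> carrier_mat n n" using U V by simp
  show "mat_adjoint (U * V) * (U * V) = 1\<^sub>m n"
    using U V by (simp add: mat_adjoint_mult mat_simps[of _ n] mat_cancel[of _ n])
qed

text \<open>
  Complete \<open>v\<close> to a basis, apply Gram-Schmidt, which keeps the first vector, and normalise the columns.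
\<close>

lemma unitary_with_first_column:
  assumes v: "v \<in> carrier_vec n" "v \<noteq> 0\<^sub>v n"
  obtains U c where "unitary n U" "c > 0" "col U 0 = complex_of_real c \<cdot>\<^sub>v v"
proof -
  interpret cof_vec_space n "TYPE(complex)" .
  have n: "n \<noteq> 0" using v by auto
  define b where "b = basis_completion v"
  define ws where "ws = gram_schmidt n b"
  from basis_completion[OF v, folded b_def]
  have dist_b: "distinct b" and indep: "\<not> lin_dep (set b)" and b: "set b \<subseteq> carrier_vec n"
    and hdb: "hd b = v" and len_b: "length b = n" by auto
  from hdb len_b n obtain vs where bv: "b = v # vs" by (cases b, auto)
  from gram_schmidt_result[OF b dist_b indep refl, folded ws_def]
  have ws: "set ws \<subseteq> carrier_vec n" "corthogonal ws" "length ws = n"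
    by (auto simp: len_b)
  from gram_schmidt_hd[OF v(1), of vs, folded bv] have "hd ws = v" unfolding ws_def .
  then have ws0: "ws ! 0 = v" using ws(3) n by (metis hd_conv_nth list.size(3))
  have wsc: "ws ! i \<in> carrier_vec n" if "i < n" for i using ws that by auto
  define q where "q i = sqrt (\<Sum>k<n. (cmod (ws ! i $ k))\<^sup>2)" for i
  have sp: "ws ! j \<bullet>c ws ! i = (\<Sum>k<n. cnj (ws ! i $ k) * ws ! j $ k)" if "i < n" "j < n" for i j
    using wsc[OF that(1)] wsc[OF that(2)]
    by (auto simp: scalar_prod_def lessThan_atLeast0 mult.commute intro!: sum.cong)
  have sp2: "(\<Sum>k<n. cnj (ws ! i $ k) * ws ! i $ k) = complex_of_real ((q i)\<^sup>2)" for i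
  proof -
    have "(\<Sum>k<n. cnj (ws ! i $ k) * ws ! i $ k) = complex_of_real (\<Sum>k<n. (cmod (ws ! i $ k))\<^sup>2)"
      by (simp add: complex_norm_square mult.commute del: of_real_power)
    then show ?thesis by (simp add: q_def sum_nonneg)
  qed
  have q: "q i > 0" if "i < n" for i
  proof -
    have "ws ! i \<bullet>c ws ! i \<noteq> 0" using corthogonalD[OF ws(2)] that ws(3) by auto
    then have "q i \<noteq> 0" using sp[OF that that] sp2[of i] by auto
    moreover have "q i \<ge> 0" by (simp add: q_def sum_nonneg)
    ultimately show ?thesis by simp
  qed
  define U where "U = mat n n (\<lambda>(i, j). ws ! j $ i / of_real (q j))"
  have U: "U \<in> carrier_mat n n" by (simp add: U_def)
  have "unitary n U"
  proof (rule unitaryI[OF U], rule eq_matI)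
    fix i j assume "i < dim_row (1\<^sub>m n :: complex mat)" "j < dim_col (1\<^sub>m n :: complex mat)"
    then have ij: "i < n" "j < n" by auto
    have "(mat_adjoint U * U) $$ (i, j) = (\<Sum>k<n. cnj (U $$ (k, i)) * U $$ (k, j))"
      using ij U by (auto simp: scalar_prod_def mat_adjoint_index lessThan_atLeast0)
    also have "\<dots> = (\<Sum>k<n. cnj (ws ! i $ k) * ws ! j $ k) / of_real (q i * q j)"
      using ij by (simp add: U_def sum_divide_distrib)
    also have "\<dots> = (if i = j then 1 else 0)"
      using sp[OF ij] sp2[of i] q[OF ij(1)] corthogonalD[OF ws(2), of j i] ij ws(3)
      by (auto simp: power2_eq_square)
    finally show "(mat_adjoint U * U) $$ (i, j) = 1\<^sub>m n $$ (i, j)" using ij by simp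
  qed (use U in auto)
  moreover have "col U 0 = complex_of_real (1 / q 0) \<cdot>\<^sub>v v"
    using n v(1) by (intro eq_vecI) (auto simp: U_def ws0)
  moreover have "1 / q 0 > 0" using q n by simp
  ultimately show ?thesis using that by blast
qed

text \<open>
  The eigenvalues may be listed in any order, which is what later allows the kernel, or the negative
  part, of a Hermitian form to be moved to the last coordinates. Each step splits off an eigenvector as
  the first column of a unitary matrix; being Hermitian, the conjugated matrix then has a zero first
  row as well as a zero first column apart from the corner.
\<close>

lemma hermitian_diagonalizable:
  assumes "H \<in> carrier_mat n n" "mat_adjoint H = H"
    and "char_poly H = (\<Prod>e \<leftarrow> es. [:- e, 1:])"
  shows "\<exists>U. unitary n U \<and>
    mat_adjoint U * H * U = mat n n (\<lambda>(i, j). if i = j then es ! i else 0)"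
  using assms
proof (induction es arbitrary: n H)
  case Nil
  then have n: "n = 0" using degree_monic_char_poly[OF Nil(1)] by simp
  then have "unitary n (1\<^sub>m n)" by (auto simp: unitary_def mat_adjoint_one)
  then show ?case using Nil(1) n by (intro exI[of _ "1\<^sub>m n"] conjI eq_matI) auto
next
  case (Cons e es)
  note H = Cons.prems(1)
  have "eigenvalue H e" unfolding eigenvalue_root_char_poly[OF H] Cons.prems(3) by simp
  then obtain v where v: "v \<in> carrier_vec n" "v \<noteq> 0\<^sub>v n" "H *\<^sub>v v = e \<cdot>\<^sub>v v"
    using H by (auto simp: eigenvalue_def eigenvector_def)
  then have "n \<noteq> 0" by auto
  then obtain m where n: "n = Suc m" using not0_implies_Suc by blast
  obtain U c where U: "unitary n U" and c: "col U 0 = complex_of_real c \<cdot>\<^sub>v v"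
    using unitary_with_first_column[OF v(1,2)] by metis
  note U' = unitaryD[OF U]
  define A where "A = mat_adjoint U * H * U"
  have A: "A \<in> carrier_mat n n" using U' H by (simp add: A_def mat_simps[of _ n])
  have Aherm: "mat_adjoint A = A"
    using U' H Cons.prems(2) by (simp add: A_def mat_adjoint_mult[of _ n] mat_simps[of _ n])
  have colU: "col U 0 \<in> carrier_vec n" using col_carrier_vec[of 0 n U n] U' n by simp
  have col0: "col A 0 = e \<cdot>\<^sub>v unit_vec n 0"
  proof -
    have "col A 0 = mat_adjoint U *\<^sub>v (H *\<^sub>v col U 0)"
      using U' H n by (simp add: A_def mat_simps[of _ n] col_mult2[of _ n n _ n] mult_mat_vec_def)
    also have "H *\<^sub>v col U 0 = e \<cdot>\<^sub>v col U 0"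
      unfolding c using v H by (simp add: mult_mat_vec[of _ n n] smult_smult_assoc mult.commute)
    also have "mat_adjoint U *\<^sub>v (e \<cdot>\<^sub>v col U 0) = e \<cdot>\<^sub>v (mat_adjoint U *\<^sub>v col U 0)"
      using U' colU by (intro mult_mat_vec[of _ n n])
    also have "mat_adjoint U *\<^sub>v col U 0 = col (mat_adjoint U * U) 0"
      using U'(1,2) n by (simp add: col_mult2[of _ n n _ n] mult_mat_vec_def)
    also have "\<dots> = unit_vec n 0"
      unfolding U'(3) using n by simp
    finally show ?thesis .
  qed
  have A0: "A $$ (i, 0) = (if i = 0 then e else 0)" if "i < n" for i
    using arg_cong[OF col0, of "\<lambda>w. w $ i"] A that n by (auto simp: unit_vec_def)
  have A0': "A $$ (0, i) = (if i = 0 then e else 0)" if "i < n" for i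
    using A0[OF that] A0[of 0] arg_cong[OF Aherm, of "\<lambda>B. B $$ (0, i)"] A that n
    by (auto simp: mat_adjoint_index split: if_splits)
  define A3 where "A3 = mat m m (\<lambda>(i, j). A $$ (Suc i, Suc j))"
  define E where "E = mat 1 1 (\<lambda>_. e)"
  have A3: "A3 \<in> carrier_mat m m" and E: "E \<in> carrier_mat 1 1" by (simp_all add: A3_def E_def)
  have Ablock: "A = four_block_mat E (0\<^sub>m 1 m) (0\<^sub>m m 1) A3"
    using A A0 A0' n E A3 by (intro eq_matI) (auto simp: E_def A3_def)
  have A3herm: "mat_adjoint A3 = A3"
  proof (rule eq_matI)
    fix i j assume "i < dim_row A3" "j < dim_col A3"
    then show "mat_adjoint A3 $$ (i, j) = A3 $$ (i, j)"
      using arg_cong[OF Aherm, of "\<lambda>B. B $$ (Suc i, Suc j)"] A A3 n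
      by (simp add: mat_adjoint_index A3_def)
  qed (use A3 in auto)
  have "similar_mat_wit A H (mat_adjoint U) U"
    using U' H A by (intro similar_mat_witI[of _ _ n]) (auto simp: A_def)
  then have "char_poly A = char_poly H"
    using char_poly_similar similar_mat_def by blast
  moreover have "char_poly E = [:- e, 1:]"
    by (simp add: E_def char_poly_defs det_def sign_def)
  ultimately have "char_poly A3 = (\<Prod>e \<leftarrow> es. [:- e, 1:])"
    using char_poly_four_block_zeros_col[OF E zero_carrier_mat A3] Cons.prems(3)
    by (simp add: Ablock del: mult_pCons_left)
  then obtain V where V: "unitary m V"
    and Vd: "mat_adjoint V * A3 * V = mat m m (\<lambda>(i, j). if i = j then es ! i else 0)"
    using Cons.IH[OF A3 A3herm] by blast
  note V' = unitaryD[OF V]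
  define F where "F = four_block_mat (1\<^sub>m 1) (0\<^sub>m 1 m) (0\<^sub>m m 1) V"
  have Fadj: "mat_adjoint F = four_block_mat (1\<^sub>m 1) (0\<^sub>m 1 m) (0\<^sub>m m 1) (mat_adjoint V)"
  proof -
    have "mat_adjoint (0\<^sub>m 1 m) = (0\<^sub>m m 1 :: complex mat)" "mat_adjoint (0\<^sub>m m 1) = (0\<^sub>m 1 m :: complex mat)"
      by (auto intro!: eq_matI simp: mat_adjoint_index)
    then show ?thesis
      unfolding F_def using V' by (subst mat_adjoint_four_block[of _ 1 _ m]) (simp_all add: mat_adjoint_one)
  qed
  have F: "unitary n F"
  proof (rule unitaryI)
    show "F \<in> carrier_mat n n" using V' n by (auto simp: F_def)
    show "mat_adjoint F * F = 1\<^sub>m n"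
      unfolding Fadj unfolding F_def using V' n
      by (subst four_block_diag_mult) (simp_all add: four_block_one)
  qed
  note F' = unitaryD[OF F]
  have "mat_adjoint (U * F) * H * (U * F) = mat_adjoint F * A * F"
    using U' F' H by (simp add: A_def mat_adjoint_mult[of _ n] mat_simps[of _ n])
  also have "\<dots> = four_block_mat E (0\<^sub>m 1 m) (0\<^sub>m m 1) (mat_adjoint V * A3 * V)"
    unfolding Fadj unfolding Ablock F_def using V' E A3
    by (simp add: four_block_diag_mult[of _ "Suc 0" _ m] mat_simps[of _ m])
  also have "\<dots> = mat n n (\<lambda>(i, j). if i = j then (e # es) ! i else 0)"
    unfolding Vd using E n by (intro eq_matI) (auto simp: E_def nth_Cons')
  finally show ?case using unitary_mult[OF U F] by blast
qed

section \<open>Algebras of pairs of matrices\<close>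

definition tr :: "complex mat \<Rightarrow> complex" where
  "tr A = (\<Sum>i<dim_row A. A $$ (i, i))"

lemma index_mult_sum:
  assumes "A \<in> carrier_mat n m" "B \<in> carrier_mat m l" "i < n" "j < l"
  shows "(A * B) $$ (i, j) = (\<Sum>k<m. A $$ (i, k) * B $$ (k, j))"
  using assms by (auto simp: scalar_prod_def lessThan_atLeast0)

lemma tr_comm:
  assumes "A \<in> carrier_mat n n" "B \<in> carrier_mat n n"
  shows "tr (A * B) = tr (B * A)"
proof -
  have "tr (A * B) = (\<Sum>i<n. \<Sum>k<n. A $$ (i, k) * B $$ (k, i))"
    using assms by (simp add: tr_def index_mult_sum[of _ n n _ n] del: index_mult_mat(1))
  also have "\<dots> = (\<Sum>k<n. \<Sum>i<n. A $$ (i, k) * B $$ (k, i))" by (rule sum.swap)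
  also have "\<dots> = tr (B * A)"
    using assms by (simp add: tr_def index_mult_sum[of _ n n _ n] mult.commute del: index_mult_mat(1))
  finally show ?thesis .
qed

lemma mat_adjoint_add:
  "A \<in> carrier_mat n n \<Longrightarrow> B \<in> carrier_mat n n \<Longrightarrow>
    mat_adjoint (A + B :: complex mat) = mat_adjoint A + mat_adjoint B"
  by (intro eq_matI) (auto simp: mat_adjoint_index)

lemma mat_adjoint_smult:
  "A \<in> carrier_mat n n \<Longrightarrow> mat_adjoint (c \<cdot>\<^sub>m A :: complex mat) = cnj c \<cdot>\<^sub>m mat_adjoint A"
  by (intro eq_matI) (auto simp: mat_adjoint_index)

text \<open>
  A pair of \<open>n \<times> n\<close> matrices is regarded as a vector indexed by triples: the truth value selects the
  component of the pair, the numbers are the row and the column. In this picture left multiplication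
  by a pair is an operator with an explicit kernel, whose adjoint is left multiplication by the
  adjoint pair.
\<close>

definition pair_index :: "nat \<Rightarrow> (bool \<times> nat \<times> nat) set" where
  "pair_index n = UNIV \<times> {..<n} \<times> {..<n}"

definition pair_vec :: "complex mat \<Rightarrow> complex mat \<Rightarrow> bool \<times> nat \<times> nat \<Rightarrow> complex" where
  "pair_vec x y = (\<lambda>(b, i, j). (if b then y else x) $$ (i, j))"

definition left_mult :: "complex mat \<Rightarrow> complex mat \<Rightarrow>
    bool \<times> nat \<times> nat \<Rightarrow> bool \<times> nat \<times> nat \<Rightarrow> complex" where
  "left_mult x y = (\<lambda>(b, i, j) (b', i', j'). if b = b' \<and> j = j' then (if b then y else x) $$ (i, i') else 0)"

lemma finite_pair_index [simp]: "finite (pair_index n)"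
  by (simp add: pair_index_def)

lemma kernel_app_left_mult:
  assumes "b \<in> (UNIV :: bool set)" "j < n"
  shows "kernel_app (pair_index n) (left_mult x y) u (b, i, j) =
    (\<Sum>k<n. (if b then y else x) $$ (i, k) * u (b, k, j))"
proof -
  let ?f = "\<lambda>p. left_mult x y (b, i, j) p * u p"
  have "kernel_app (pair_index n) (left_mult x y) u (b, i, j) = sum ?f (pair_index n)"
    by (simp add: kernel_app_def)
  also have "\<dots> = sum ?f ((\<lambda>k. (b, k, j)) ` {..<n})"
    using assms by (intro sum.mono_neutral_right) (auto simp: pair_index_def left_mult_def)
  also have "\<dots> = (\<Sum>k<n. ?f (b, k, j))"
    by (subst sum.reindex) (auto simp: inj_on_def)
  finally show ?thesis by (simp add: left_mult_def)
qed

lemma kernel_app_left_mult_pair_vec: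
  assumes "x \<in> carrier_mat n n" "y \<in> carrier_mat n n" "a \<in> carrier_mat n n" "c \<in> carrier_mat n n"
    and p: "p \<in> pair_index n"
  shows "kernel_app (pair_index n) (left_mult x y) (pair_vec a c) p = pair_vec (x * a) (y * c) p"
proof -
  obtain b i j where p': "p = (b, i, j)" "i < n" "j < n" using p by (auto simp: pair_index_def)
  show ?thesis unfolding p'(1) kernel_app_left_mult[OF UNIV_I p'(3)]
    using assms p' by (simp add: pair_vec_def index_mult_sum[of _ n n _ n] del: index_mult_mat(1))
qed

lemma kernel_adj_left_mult:
  assumes "x \<in> carrier_mat n n" "y \<in> carrier_mat n n" "p \<in> pair_index n" "q \<in> pair_index n"
  shows "kernel_adj (left_mult x y) p q = left_mult (mat_adjoint x) (mat_adjoint y) p q"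
  using assms by (auto simp: kernel_adj_def left_mult_def pair_index_def mat_adjoint_index)

lemma ip_cong: "(\<And>p. p \<in> I \<Longrightarrow> u p = u' p) \<Longrightarrow> (\<And>p. p \<in> I \<Longrightarrow> v p = v' p) \<Longrightarrow> ip I u v = ip I u' v'"
  by (simp add: ip_def)

lemma kernel_app_cong:
  "(\<And>q. q \<in> I \<Longrightarrow> M p q = M' p q) \<Longrightarrow> (\<And>q. q \<in> I \<Longrightarrow> u q = v q) \<Longrightarrow> kernel_app I M u p = kernel_app I M' v p"
  by (simp add: kernel_app_def)

lemma ip_left_mult:
  assumes "x \<in> carrier_mat n n" "y \<in> carrier_mat n n" "a \<in> carrier_mat n n" "c \<in> carrier_mat n n"
    "a' \<in> carrier_mat n n" "c' \<in> carrier_mat n n"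
  shows "ip (pair_index n) (pair_vec (mat_adjoint x * a) (mat_adjoint y * c)) (pair_vec a' c') =
    ip (pair_index n) (pair_vec a c) (pair_vec (x * a') (y * c'))"
proof -
  let ?I = "pair_index n"
  have "ip ?I (pair_vec (mat_adjoint x * a) (mat_adjoint y * c)) (pair_vec a' c') =
    ip ?I (kernel_app ?I (kernel_adj (left_mult x y)) (pair_vec a c)) (pair_vec a' c')"
  proof (rule ip_cong)
    fix p assume p: "p \<in> ?I"
    have "kernel_app ?I (kernel_adj (left_mult x y)) (pair_vec a c) p =
      kernel_app ?I (left_mult (mat_adjoint x) (mat_adjoint y)) (pair_vec a c) p"
      using assms p by (intro kernel_app_cong kernel_adj_left_mult) auto
    then show "pair_vec (mat_adjoint x * a) (mat_adjoint y * c) p =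
        kernel_app ?I (kernel_adj (left_mult x y)) (pair_vec a c) p"
      using assms p kernel_app_left_mult_pair_vec[of "mat_adjoint x" n "mat_adjoint y" a c p] by simp
  qed simp
  also have "\<dots> = ip ?I (pair_vec a c) (kernel_app ?I (left_mult x y) (pair_vec a' c'))"
    by (rule ip_kernel_adj)
  also have "\<dots> = ip ?I (pair_vec a c) (pair_vec (x * a') (y * c'))"
    using assms by (intro ip_cong kernel_app_left_mult_pair_vec) auto
  finally show ?thesis .
qed

definition pair_vecs :: "nat \<Rightarrow> (complex mat \<times> complex mat) set \<Rightarrow> (bool \<times> nat \<times> nat \<Rightarrow> complex) set" where
  "pair_vecs n B = {u. \<exists>(x, y) \<in> B. \<forall>p \<in> pair_index n. u p = pair_vec x y p}"

locale pair_algebra =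
  fixes n :: nat and B :: "(complex mat \<times> complex mat) set"
  assumes carr: "(x, y) \<in> B \<Longrightarrow> x \<in> carrier_mat n n \<and> y \<in> carrier_mat n n"
    and one: "(1\<^sub>m n, 1\<^sub>m n) \<in> B"
    and add: "(x, y) \<in> B \<Longrightarrow> (x', y') \<in> B \<Longrightarrow> (x + x', y + y') \<in> B"
    and mult: "(x, y) \<in> B \<Longrightarrow> (x', y') \<in> B \<Longrightarrow> (x * x', y * y') \<in> B"
    and smult: "(x, y) \<in> B \<Longrightarrow> (c \<cdot>\<^sub>m x, c \<cdot>\<^sub>m y) \<in> B"
begin

lemma subspace_pair_vecs: "subspace_on (pair_index n) (pair_vecs n B)"
proof -
  have z: "(\<lambda>_. 0) \<in> pair_vecs n B"
    unfolding pair_vecs_def using smult[OF one, of 0]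
    by (auto simp: pair_vec_def pair_index_def intro!: bexI[of _ "(0 \<cdot>\<^sub>m 1\<^sub>m n, 0 \<cdot>\<^sub>m 1\<^sub>m n)"])
  have a: "(\<lambda>i. u i + v i) \<in> pair_vecs n B" if uv: "u \<in> pair_vecs n B" "v \<in> pair_vecs n B" for u v
  proof -
    from uv obtain x y x' y' where "(x, y) \<in> B" "(x', y') \<in> B"
      "\<forall>p \<in> pair_index n. u p = pair_vec x y p" "\<forall>p \<in> pair_index n. v p = pair_vec x' y' p"
      by (auto simp: pair_vecs_def)
    then show ?thesis unfolding pair_vecs_def using add[of x y x' y'] carr[of x y] carr[of x' y']
      by (auto simp: pair_vec_def pair_index_def intro!: bexI[of _ "(x + x', y + y')"])
  qed
  have s: "(\<lambda>i. c * u i) \<in> pair_vecs n B" if u: "u \<in> pair_vecs n B" for u c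
  proof -
    from u obtain x y where "(x, y) \<in> B" "\<forall>p \<in> pair_index n. u p = pair_vec x y p"
      by (auto simp: pair_vecs_def)
    then show ?thesis unfolding pair_vecs_def using smult[of x y c] carr[of x y]
      by (auto simp: pair_vec_def pair_index_def intro!: bexI[of _ "(c \<cdot>\<^sub>m x, c \<cdot>\<^sub>m y)"])
  qed
  have "v \<in> pair_vecs n B" if "u \<in> pair_vecs n B" "\<forall>i\<in>pair_index n. v i = u i" for u v
    using that unfolding pair_vecs_def by auto
  then show ?thesis unfolding subspace_on_def
    by (intro conjI ballI allI impI z a s) simp_all
qed

lemma pair_vecs_memD:
  assumes "pair_vec x y \<in> pair_vecs n B" "x \<in> carrier_mat n n" "y \<in> carrier_mat n n"
  shows "(x, y) \<in> B"
proof -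
  obtain x' y' where B: "(x', y') \<in> B" and e: "\<And>p. p \<in> pair_index n \<Longrightarrow> pair_vec x y p = pair_vec x' y' p"
    using assms(1) by (auto simp: pair_vecs_def)
  have "x = x'"
  proof (rule eq_matI)
    fix i j assume "i < dim_row x'" "j < dim_col x'"
    then show "x $$ (i, j) = x' $$ (i, j)" using e[of "(False, i, j)"] carr[OF B] by (auto simp: pair_vec_def pair_index_def)
  qed (use assms carr[OF B] in auto)
  moreover have "y = y'"
  proof (rule eq_matI)
    fix i j assume "i < dim_row y'" "j < dim_col y'"
    then show "y $$ (i, j) = y' $$ (i, j)" using e[of "(True, i, j)"] carr[OF B] by (auto simp: pair_vec_def pair_index_def)
  qed (use assms carr[OF B] in auto)
  ultimately show ?thesis using B by simp
qed

lemma pair_vec_mem: "(x, y) \<in> B \<Longrightarrow> pair_vec x y \<in> pair_vecs n B"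
  by (auto simp: pair_vecs_def)

text \<open>
  The orthonormal basis of the space of vectors, read as a family of pairs: the same coefficients expand
  both components of a member of \<open>B\<close>.
\<close>

lemma pair_basis:
  obtains d a c where "\<And>j :: nat. j < d \<Longrightarrow> (a j, c j) \<in> B"
    and "\<And>x y i k. (x, y) \<in> B \<Longrightarrow> i < n \<Longrightarrow> k < n \<Longrightarrow>
      x $$ (i, k) = (\<Sum>j<d. ip (pair_index n) (pair_vec (a j) (c j)) (pair_vec x y) * a j $$ (i, k))"
    and "\<And>x y i k. (x, y) \<in> B \<Longrightarrow> i < n \<Longrightarrow> k < n \<Longrightarrow>
      y $$ (i, k) = (\<Sum>j<d. ip (pair_index n) (pair_vec (a j) (c j)) (pair_vec x y) * c j $$ (i, k))"
proof -
  let ?I = "pair_index n"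
  obtain d e where "orthonormal ?I d e" and eA: "\<And>j. j < d \<Longrightarrow> e j \<in> pair_vecs n B"
    and exp: "\<And>u p. u \<in> pair_vecs n B \<Longrightarrow> p \<in> ?I \<Longrightarrow> u p = (\<Sum>j<d. ip ?I (e j) u * e j p)"
    using orthonormal_basis_exists[OF finite_pair_index subspace_pair_vecs] by blast
  have "\<forall>j\<in>{..<d}. \<exists>q. q \<in> B \<and> (\<forall>p\<in>?I. e j p = pair_vec (fst q) (snd q) p)"
  proof
    fix j assume "j \<in> {..<d}"
    then obtain x y where "(x, y) \<in> B" "\<forall>p\<in>?I. e j p = pair_vec x y p"
      using eA[of j] unfolding pair_vecs_def by auto
    then show "\<exists>q. q \<in> B \<and> (\<forall>p\<in>?I. e j p = pair_vec (fst q) (snd q) p)"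
      by (intro exI[of _ "(x, y)"]) simp
  qed
  then obtain q where q: "\<And>j. j < d \<Longrightarrow> q j \<in> B"
    "\<And>j p. j < d \<Longrightarrow> p \<in> ?I \<Longrightarrow> e j p = pair_vec (fst (q j)) (snd (q j)) p"
    by (metis bchoice lessThan_iff)
  have *: "pair_vec x y p = (\<Sum>j<d. ip ?I (pair_vec (fst (q j)) (snd (q j))) (pair_vec x y) *
      pair_vec (fst (q j)) (snd (q j)) p)" if "(x, y) \<in> B" "p \<in> ?I" for x y p
  proof -
    have "pair_vec x y p = (\<Sum>j<d. ip ?I (e j) (pair_vec x y) * e j p)"
      by (rule exp[OF pair_vec_mem[OF that(1)] that(2)])
    also have "\<dots> = (\<Sum>j<d. ip ?I (pair_vec (fst (q j)) (snd (q j))) (pair_vec x y) *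
      pair_vec (fst (q j)) (snd (q j)) p)"
      using q(2) that(2) by (intro sum.cong refl arg_cong2[of _ _ _ _ "(*)"] ip_cong) auto
    finally show ?thesis .
  qed
  show ?thesis
  proof (rule that[of d "\<lambda>j. fst (q j)" "\<lambda>j. snd (q j)"])
    fix x y i k assume "(x, y) \<in> B" "i < n" "k < n"
    then show "x $$ (i, k) = (\<Sum>j<d. ip ?I (pair_vec (fst (q j)) (snd (q j))) (pair_vec x y) * fst (q j) $$ (i, k))"
      "y $$ (i, k) = (\<Sum>j<d. ip ?I (pair_vec (fst (q j)) (snd (q j))) (pair_vec x y) * snd (q j) $$ (i, k))"
      using *[of x y "(False, i, k)"] *[of x y "(True, i, k)"]
      by (simp_all add: pair_vec_def pair_index_def)
  qed (use q(1) in simp)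
qed

end

text \<open>
  The graph of the correspondence \<open>\<rho> \<gamma> \<mapsto> \<rho>' \<gamma>\<close> between two representations is the motivating
  example of \<open>B\<close>; intertwining maps are then the same as homomorphisms from \<open>\<rho>\<close> to \<open>\<rho>'\<close>.
\<close>

definition intertwines :: "nat \<Rightarrow> (complex mat \<times> complex mat) set \<Rightarrow> complex mat \<Rightarrow> bool" where
  "intertwines n B h \<longleftrightarrow> h \<in> carrier_mat n n \<and> (\<forall>(x, y) \<in> B. y * h = h * x)"

locale selfdual_pairs = pair_algebra +
  assumes star: "(x, y) \<in> B \<Longrightarrow> (mat_adjoint x, mat_adjoint y) \<in> B"
    and swap: "(x, y) \<in> B \<Longrightarrow> (y, x) \<in> B"
    and tr_eq: "(x, y) \<in> B \<Longrightarrow> tr x = tr y"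
begin

text \<open>
  The adjoint of a homomorphism from \<open>\<rho>\<close> to \<open>\<rho>'\<close> goes between the adjoints in the reverse direction;
  closure under adjoints and under exchange of the components turns it into a homomorphism from
  \<open>\<rho>\<close> to \<open>\<rho>'\<close> again.
\<close>

lemma intertwines_adjoint:
  assumes "intertwines n B h"
  shows "intertwines n B (mat_adjoint h)"
proof -
  have h: "h \<in> carrier_mat n n" using assms by (simp add: intertwines_def)
  have "y * mat_adjoint h = mat_adjoint h * x" if xy: "(x, y) \<in> B" for x y
  proof -
    have c: "x \<in> carrier_mat n n" "y \<in> carrier_mat n n" using carr[OF xy] by auto
    have "mat_adjoint x * h = h * mat_adjoint y"
      using assms swap[OF star[OF xy]] by (auto simp: intertwines_def)
    then have "mat_adjoint (mat_adjoint x * h) = mat_adjoint (h * mat_adjoint y)" by simp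
    then show ?thesis using c h by (simp add: mat_adjoint_mult[of _ n])
  qed
  then show ?thesis using h by (auto simp: intertwines_def)
qed

text \<open>
  Let \<open>(a\<^sub>j, c\<^sub>j)\<close> be an orthonormal basis of \<open>B\<close>. For the matrix unit \<open>M\<close> at \<open>(k, l)\<close> the Casimir sum
  \<open>\<Sum>\<^sub>j c\<^sub>j M a\<^sub>j\<^sup>*\<close> has the entries \<open>\<Sum>\<^sub>j (c\<^sub>j)\<^sub>p\<^sub>k cnj (a\<^sub>j)\<^sub>q\<^sub>l\<close>. It intertwines, since left
  multiplication by \<open>(x, y)\<close> and by its adjoint have adjoint matrices with respect to the basis. If
  these matrices all vanished, then contracting \<open>p\<close> with \<open>k\<close> and \<open>q\<close> with \<open>l\<close> would give
  \<open>\<Sum>\<^sub>j |tr a\<^sub>j|\<^sup>2 = 0\<close>; the trace would be zero on all first components, in particular on the identity.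
\<close>

lemma nonzero_intertwiner:
  assumes "n > 0"
  obtains h where "intertwines n B h" "h \<noteq> 0\<^sub>m n n"
proof -
  let ?I = "pair_index n"
  obtain d a c where ac: "\<And>j :: nat. j < d \<Longrightarrow> (a j, c j) \<in> B"
    and expx: "\<And>x y i k. (x, y) \<in> B \<Longrightarrow> i < n \<Longrightarrow> k < n \<Longrightarrow>
      x $$ (i, k) = (\<Sum>j<d. ip ?I (pair_vec (a j) (c j)) (pair_vec x y) * a j $$ (i, k))"
    and expy: "\<And>x y i k. (x, y) \<in> B \<Longrightarrow> i < n \<Longrightarrow> k < n \<Longrightarrow>
      y $$ (i, k) = (\<Sum>j<d. ip ?I (pair_vec (a j) (c j)) (pair_vec x y) * c j $$ (i, k))"
    using pair_basis by blast
  have cac: "a j \<in> carrier_mat n n" "c j \<in> carrier_mat n n" if "j < d" for j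
    using carr[OF ac[OF that]] by auto
  have dac: "dim_row (a j) = n" "dim_row (c j) = n" if "j < d" for j
    using cac[OF that] by auto
  define h where "h k l = mat n n (\<lambda>(p, q). \<Sum>j<d. c j $$ (p, k) * cnj (a j $$ (q, l)))" for k l
  have h: "h k l \<in> carrier_mat n n" for k l by (simp add: h_def)
  have int: "y * h k l = h k l * x" if xy: "(x, y) \<in> B" and kl: "k < n" "l < n" for x y k l
  proof -
    have cxy: "x \<in> carrier_mat n n" "y \<in> carrier_mat n n" using carr[OF xy] by auto
    \<comment> \<open>The matrix of left multiplication by \<open>(x, y)\<close> in the orthonormal basis.\<close>
    define \<beta> where "\<beta> i j = ip ?I (pair_vec (a i) (c i)) (pair_vec (x * a j) (y * c j))" for i j
    have 1: "(y * c j) $$ (p, k) = (\<Sum>i<d. \<beta> i j * c i $$ (p, k))" if "j < d" "p < n" for j p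
      unfolding \<beta>_def by (rule expy[OF mult[OF xy ac[OF that(1)]] that(2) kl(1)])
    have 2: "cnj ((mat_adjoint x * a i) $$ (q, l)) = (\<Sum>j<d. \<beta> i j * cnj (a j $$ (q, l)))"
      if "i < d" "q < n" for i q
    proof -
      have "cnj (ip ?I (pair_vec (a j) (c j)) (pair_vec (mat_adjoint x * a i) (mat_adjoint y * c i))) = \<beta> i j"
        if "j < d" for j
        unfolding \<beta>_def ip_cnj using cxy cac that \<open>i < d\<close> by (intro ip_left_mult) auto
      then show ?thesis
        unfolding expx[OF mult[OF star[OF xy] ac[OF that(1)]] that(2) kl(2)] by simp
    qed
    show ?thesis
    proof (rule eq_matI)
      fix p q assume "p < dim_row (h k l * x)" "q < dim_col (h k l * x)"
      then have pq: "p < n" "q < n" using cxy by (auto simp: h_def)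
      have "(y * h k l) $$ (p, q) = (\<Sum>m<n. \<Sum>j<d. y $$ (p, m) * (c j $$ (m, k) * cnj (a j $$ (q, l))))"
        using pq h cxy by (simp add: index_mult_sum[of _ n n _ n] h_def sum_distrib_left del: index_mult_mat(1))
      also have "\<dots> = (\<Sum>j<d. \<Sum>m<n. y $$ (p, m) * (c j $$ (m, k) * cnj (a j $$ (q, l))))"
        by (rule sum.swap)
      also have "\<dots> = (\<Sum>j<d. (y * c j) $$ (p, k) * cnj (a j $$ (q, l)))"
        using pq kl cxy cac
        by (intro sum.cong refl) (simp add: index_mult_sum[of _ n n _ n] sum_distrib_right mult.assoc del: index_mult_mat(1))
      also have "\<dots> = (\<Sum>j<d. \<Sum>i<d. \<beta> i j * c i $$ (p, k) * cnj (a j $$ (q, l)))"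
        using pq by (simp add: 1 sum_distrib_right)
      also have "\<dots> = (\<Sum>i<d. \<Sum>j<d. \<beta> i j * c i $$ (p, k) * cnj (a j $$ (q, l)))"
        by (rule sum.swap)
      also have "\<dots> = (\<Sum>i<d. c i $$ (p, k) * cnj ((mat_adjoint x * a i) $$ (q, l)))"
        using pq by (simp add: 2 sum_distrib_left mult.left_commute mult.assoc)
      also have "\<dots> = (\<Sum>i<d. \<Sum>m<n. c i $$ (p, k) * cnj (a i $$ (m, l)) * x $$ (m, q))"
        using pq kl cxy cac
        by (intro sum.cong refl)
          (simp add: index_mult_sum[of _ n n _ n] mat_adjoint_index sum_distrib_left mult.left_commute mult.commute del: index_mult_mat(1))
      also have "\<dots> = (\<Sum>m<n. \<Sum>i<d. c i $$ (p, k) * cnj (a i $$ (m, l)) * x $$ (m, q))"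
        by (rule sum.swap)
      also have "\<dots> = (h k l * x) $$ (p, q)"
        using pq h cxy by (simp add: index_mult_sum[of _ n n _ n] h_def sum_distrib_right del: index_mult_mat(1))
      finally show "(y * h k l) $$ (p, q) = (h k l * x) $$ (p, q)" .
    qed (use cxy in \<open>auto simp: h_def\<close>)
  qed
  have "\<exists>k<n. \<exists>l<n. h k l \<noteq> 0\<^sub>m n n"
  proof (rule ccontr)
    assume "\<not> ?thesis"
    then have z: "h k l $$ (k, l) = 0" if "k < n" "l < n" for k l using that by auto
    have "(\<Sum>j<d. (cmod (tr (a j)))\<^sup>2) = 0"
    proof -
      have "complex_of_real (\<Sum>j<d. (cmod (tr (a j)))\<^sup>2) = (\<Sum>j<d. tr (c j) * cnj (tr (a j)))"
        using tr_eq[OF ac] by (simp add: complex_norm_square del: of_real_power)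
      also have "\<dots> = (\<Sum>j<d. \<Sum>k<n. \<Sum>l<n. c j $$ (k, k) * cnj (a j $$ (l, l)))"
        by (intro sum.cong refl) (simp add: tr_def sum_product dac)
      also have "\<dots> = (\<Sum>k<n. \<Sum>j<d. \<Sum>l<n. c j $$ (k, k) * cnj (a j $$ (l, l)))"
        by (rule sum.swap)
      also have "\<dots> = (\<Sum>k<n. \<Sum>l<n. \<Sum>j<d. c j $$ (k, k) * cnj (a j $$ (l, l)))"
        by (intro sum.cong refl sum.swap)
      also have "\<dots> = (\<Sum>k<n. \<Sum>l<n. h k l $$ (k, l))" by (simp add: h_def)
      also have "\<dots> = 0" by (simp add: z)
      finally show ?thesis by (simp only: of_real_eq_0_iff)
    qed
    then have t0: "tr (a j) = 0" if "j < d" for j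
      using that by (subst (asm) sum_nonneg_eq_0_iff) auto
    have "tr (1\<^sub>m n) = (\<Sum>i<n. \<Sum>j<d. ip ?I (pair_vec (a j) (c j)) (pair_vec (1\<^sub>m n) (1\<^sub>m n)) * a j $$ (i, i))"
      unfolding tr_def by (rule sum.cong, simp, rule expx[OF one]) simp_all
    also have "\<dots> = (\<Sum>j<d. \<Sum>i<n. ip ?I (pair_vec (a j) (c j)) (pair_vec (1\<^sub>m n) (1\<^sub>m n)) * a j $$ (i, i))"
      by (rule sum.swap)
    also have "\<dots> = (\<Sum>j<d. ip ?I (pair_vec (a j) (c j)) (pair_vec (1\<^sub>m n) (1\<^sub>m n)) * tr (a j))"
      by (intro sum.cong refl) (simp add: tr_def sum_distrib_left dac)
    also have "\<dots> = 0" using t0 by simp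
    finally show False using assms by (simp add: tr_def)
  qed
  then obtain k l where "k < n" "l < n" "h k l \<noteq> 0\<^sub>m n n" by blast
  moreover from this have "intertwines n B (h k l)" using h int by (auto simp: intertwines_def)
  ultimately show ?thesis using that by blast
qed

text \<open>
  Either \<open>h + h\<^sup>*\<close> is nonzero, or \<open>h\<close> is skew-Hermitian and \<open>\<i> h\<close> is Hermitian.
\<close>

lemma nonzero_hermitian_intertwiner:
  assumes "n > 0"
  obtains h where "intertwines n B h" "mat_adjoint h = h" "h \<noteq> 0\<^sub>m n n"
proof -
  obtain h where h: "intertwines n B h" "h \<noteq> 0\<^sub>m n n" using nonzero_intertwiner[OF assms] by blast
  have c: "h \<in> carrier_mat n n" "mat_adjoint h \<in> carrier_mat n n" using h by (auto simp: intertwines_def)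
  show ?thesis
  proof (cases "h + mat_adjoint h = 0\<^sub>m n n")
    case False
    have "y * (h + mat_adjoint h) = (h + mat_adjoint h) * x" if xy: "(x, y) \<in> B" for x y
    proof -
      have "x \<in> carrier_mat n n" "y \<in> carrier_mat n n" using carr[OF xy] by auto
      moreover have "y * h = h * x" "y * mat_adjoint h = mat_adjoint h * x"
        using h(1) intertwines_adjoint[OF h(1)] xy by (auto simp: intertwines_def)
      ultimately show ?thesis using c
        by (simp add: mult_add_distrib_mat[of _ n n _ n] add_mult_distrib_mat[of _ n n _ _ n])
    qed
    then have "intertwines n B (h + mat_adjoint h)" using c by (auto simp: intertwines_def)
    moreover have "mat_adjoint (h + mat_adjoint h) = h + mat_adjoint h"
      using c by (simp add: mat_adjoint_add[of _ n] comm_add_mat[of _ n n])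
    ultimately show ?thesis using False that by blast
  next
    case True
    have skew: "cnj (h $$ (j, i)) = - h $$ (i, j)" if "i < n" "j < n" for i j
      using arg_cong[OF True, of "\<lambda>A. A $$ (i, j)"] that c by (simp add: mat_adjoint_index add_eq_0_iff)
    have "intertwines n B (\<i> \<cdot>\<^sub>m h)"
      using h(1) carr c unfolding intertwines_def
      by (force simp: mult_smult_distrib[of _ n n _ n] mult_smult_assoc_mat[of _ n n _ n])
    moreover have "mat_adjoint (\<i> \<cdot>\<^sub>m h) = \<i> \<cdot>\<^sub>m h"
      using c by (intro eq_matI) (auto simp: mat_adjoint_index skew)
    moreover have "\<i> \<cdot>\<^sub>m h \<noteq> 0\<^sub>m n n"
    proof
      assume z: "\<i> \<cdot>\<^sub>m h = 0\<^sub>m n n"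
      have "h = 0\<^sub>m n n"
      proof (rule eq_matI)
        fix i j assume "i < dim_row (0\<^sub>m n n :: complex mat)" "j < dim_col (0\<^sub>m n n :: complex mat)"
        then show "h $$ (i, j) = 0\<^sub>m n n $$ (i, j)"
          using arg_cong[OF z, of "\<lambda>A. A $$ (i, j)"] c by simp
      qed (use c in auto)
      then show False using h(2) by simp
    qed
    ultimately show ?thesis using that by blast
  qed
qed

end

section \<open>An invertible Hermitian intertwiner\<close>

abbreviation diag :: "nat \<Rightarrow> (nat \<Rightarrow> complex) \<Rightarrow> complex mat" where
  "diag n f \<equiv> mat n n (\<lambda>(i, j). if i = j then f i else 0)"

lemma diag_mult_left:
  assumes "A \<in> carrier_mat n n" "i < n" "j < n"
  shows "(diag n f * A) $$ (i, j) = f i * A $$ (i, j)"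
proof -
  have "(diag n f * A) $$ (i, j) = (\<Sum>k<n. (if i = k then f i else 0) * A $$ (k, j))"
    using assms by (subst index_mult_sum[of _ n n _ n]) simp_all
  also have "\<dots> = (\<Sum>k<n. if i = k then f i * A $$ (k, j) else 0)"
    by (rule sum.cong) auto
  finally show ?thesis using assms by simp
qed

lemma diag_mult_right:
  assumes "A \<in> carrier_mat n n" "i < n" "j < n"
  shows "(A * diag n f) $$ (i, j) = A $$ (i, j) * f j"
proof -
  have "(A * diag n f) $$ (i, j) = (\<Sum>k<n. A $$ (i, k) * (if k = j then f k else 0))"
    using assms by (subst index_mult_sum[of _ n n _ n]) simp_all
  also have "\<dots> = (\<Sum>k<n. if k = j then A $$ (i, k) * f k else 0)"
    by (rule sum.cong) auto
  finally show ?thesis using assms by simp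
qed

lemma diag_mult_diag: "diag n f * diag n g = diag n (\<lambda>i. f i * g i)"
proof (rule eq_matI)
  fix i j assume "i < dim_row (diag n (\<lambda>i. f i * g i))" "j < dim_col (diag n (\<lambda>i. f i * g i))"
  then show "(diag n f * diag n g) $$ (i, j) = diag n (\<lambda>i. f i * g i) $$ (i, j)"
    by (subst diag_mult_left[of _ n]) simp_all
qed simp_all

lemma unitary_conj_eq:
  assumes U: "unitary n U" and "A \<in> carrier_mat n n"
  shows "U * (mat_adjoint U * A * U) * mat_adjoint U = A"
  using unitaryD[OF U] assms(2)
  by (simp add: mat_simps[of _ n] mat_cancel[of _ n])

lemma unitary_conj_mult:
  assumes U: "unitary n U" and "A \<in> carrier_mat n n" "A' \<in> carrier_mat n n"
  shows "mat_adjoint U * (A * A') * U = (mat_adjoint U * A * U) * (mat_adjoint U * A' * U)"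
  using unitaryD[OF U] assms(2,3)
  by (simp add: mat_simps[of _ n] mat_cancel[of _ n])

lemma unitary_conj_adjoint:
  assumes U: "unitary n U" and "A \<in> carrier_mat n n"
  shows "mat_adjoint (mat_adjoint U * A * U) = mat_adjoint U * mat_adjoint A * U"
  using unitaryD[OF U] assms(2)
  by (simp add: mat_simps[of _ n] mat_adjoint_mult[of _ n])

text \<open>
  The diagonal entries may be listed in any order, so those that satisfy \<open>P\<close> can be put first.
\<close>

lemma hermitian_diag_sorted:
  assumes H: "H \<in> carrier_mat n n" "mat_adjoint H = H"
  obtains U f r where "unitary n U" "mat_adjoint U * H * U = diag n f"
    "r \<le> n" "\<And>i. i < r \<Longrightarrow> P (f i)" "\<And>i. r \<le> i \<Longrightarrow> i < n \<Longrightarrow> \<not> P (f i)"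
    "\<And>i. i < n \<Longrightarrow> cnj (f i) = f i"
proof -
  obtain es where es: "char_poly H = (\<Prod>e \<leftarrow> es. [:- e, 1:])" "length es = n"
    using char_poly_factorized[OF H(1)] by blast
  define xs where "xs = filter P es" 
  define ys where "ys = filter (\<lambda>e. \<not> P e) es"
  define fs where "fs = xs @ ys"
  have "mset fs = mset es" by (simp add: fs_def xs_def ys_def)
  then have len: "length fs = n" and "(\<Prod>e \<leftarrow> fs. [:- e, 1:]) = (\<Prod>e \<leftarrow> es. [:- e, 1:])"
    using es(2) mset_eq_length[of fs es] by (auto simp flip: prod_mset_prod_list)
  then obtain U where U: "unitary n U"
    and d: "mat_adjoint U * H * U = diag n (\<lambda>i. fs ! i)"
    using hermitian_diagonalizable[OF H, of fs] es(1) by auto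
  have real: "cnj (fs ! i) = fs ! i" if "i < n" for i
  proof -
    have "mat_adjoint (diag n (\<lambda>i. fs ! i)) = diag n (\<lambda>i. fs ! i)"
      unfolding d[symmetric] unitary_conj_adjoint[OF U H(1)] H(2) ..
    from arg_cong[OF this, of "\<lambda>A. A $$ (i, i)"] show ?thesis
      using that by (simp add: mat_adjoint_index)
  qed
  have l: "length xs + length ys = n" using len by (simp add: fs_def)
  show ?thesis
  proof (rule that[OF U d, of "length xs"])
    show "P (fs ! i)" if "i < length xs" for i
    proof -
      have "xs ! i \<in> set xs" using that by simp
      then show ?thesis using that by (auto simp: fs_def nth_append xs_def)
    qed
    show "\<not> P (fs ! i)" if "length xs \<le> i" "i < n" for i
    proof -
      have "ys ! (i - length xs) \<in> set ys" using that l by simp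
      then show ?thesis using that by (auto simp: fs_def nth_append ys_def)
    qed
  qed (use l real in auto)
qed

lemma sum_lessThan_add:
  fixes g :: "nat \<Rightarrow> 'a :: comm_monoid_add"
  shows "(\<Sum>i<r + m. g i) = (\<Sum>i<r. g i) + (\<Sum>i<m. g (r + i))"
  by (induction m) (simp_all add: add.assoc)

text \<open>
  Diagonalise a nonzero Hermitian intertwiner with its nonzero eigenvalues \<open>f\<^sub>0, \<dots>, f\<^bsub>r-1\<^esub>\<close> in front.
  In the new coordinates the intertwining relation reads \<open>y\<^sub>i\<^sub>j f\<^sub>j = f\<^sub>i x\<^sub>i\<^sub>j\<close>. Where exactly one of
  \<open>f\<^sub>i\<close> and \<open>f\<^sub>j\<close> vanishes it forces an entry to be zero, and by exchanging \<open>x\<close> and \<open>y\<close> the members of \<open>B\<close>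
  become block diagonal. On the diagonal it shows that the first blocks of \<open>x\<close> and \<open>y\<close> have equal trace, and
  hence so do the second blocks. The second blocks thus form an algebra of the same kind and of smaller size,
  and the intertwiner supplied by induction completes the invertible diagonal block.
\<close>

lemma invertible_hermitian_intertwiner:
  assumes "selfdual_pairs n B"
  shows "\<exists>h k. intertwines n B h \<and> mat_adjoint h = h \<and> k \<in> carrier_mat n n \<and> h * k = 1\<^sub>m n \<and> k * h = 1\<^sub>m n"
  using assms
proof (induction n arbitrary: B rule: less_induct)
  case (less n B)
  interpret selfdual_pairs n B by (rule less.prems)
  show ?case
  proof (cases "n = 0")
    case True
    have "y * 1\<^sub>m n = 1\<^sub>m n * x" if "(x, y) \<in> B" for x y
      using carr[OF that] True by (intro eq_matI) auto
    then have "intertwines n B (1\<^sub>m n)" by (auto simp: intertwines_def)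
    then show ?thesis
      by (intro exI[of _ "1\<^sub>m n"]) (simp add: mat_adjoint_one)
  next
    case False
    then obtain h0 where h0: "intertwines n B h0" "mat_adjoint h0 = h0" "h0 \<noteq> 0\<^sub>m n n"
      using nonzero_hermitian_intertwiner by blast
    have ch0: "h0 \<in> carrier_mat n n" using h0(1) by (simp add: intertwines_def)
    obtain U f r where U: "unitary n U" and d: "mat_adjoint U * h0 * U = diag n f"
      and r: "r \<le> n" "\<And>i. i < r \<Longrightarrow> f i \<noteq> 0" "\<And>i. r \<le> i \<Longrightarrow> i < n \<Longrightarrow> \<not> f i \<noteq> 0"
      and real: "\<And>i. i < n \<Longrightarrow> cnj (f i) = f i"
      using hermitian_diag_sorted[OF ch0 h0(2), of "\<lambda>e. e \<noteq> 0"] by blast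
    note U' = unitaryD[OF U]
    have "r \<noteq> 0"
    proof
      assume "r = 0"
      then have "diag n f = 0\<^sub>m n n" using r(3) by (intro eq_matI) auto
      then have "h0 = U * 0\<^sub>m n n * mat_adjoint U" using unitary_conj_eq[OF U ch0] d by simp
      then show False using U' h0(3) by simp
    qed
    define m where "m = n - r"
    have n: "n = r + m" and m: "m < n" using r(1) \<open>r \<noteq> 0\<close> by (auto simp: m_def)
    \<comment> \<open>\<open>J\<close> changes coordinates, \<open>T\<close> and \<open>C\<close> extract the two diagonal blocks.\<close>
    define J where "J x = mat_adjoint U * x * U" for x
    have cJ: "J x \<in> carrier_mat n n" if "x \<in> carrier_mat n n" for x
      using that U' by (simp add: J_def mat_closed[of _ n])
    define T where "T x = mat r r (\<lambda>(i, j). J x $$ (i, j))" for x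
    define C where "C x = mat m m (\<lambda>(i, j). J x $$ (r + i, r + j))" for x
    have cTC: "T x \<in> carrier_mat r r" "C x \<in> carrier_mat m m" for x by (simp_all add: T_def C_def)
    have int: "J y $$ (i, j) * f j = f i * J x $$ (i, j)"
      if xy: "(x, y) \<in> B" and ij: "i < n" "j < n" for x y i j
    proof -
      have c: "x \<in> carrier_mat n n" "y \<in> carrier_mat n n" using carr[OF xy] by auto
      have "J y * diag n f = J (y * h0)"
        unfolding J_def d[symmetric] unitary_conj_mult[OF U c(2) ch0] ..
      also have "y * h0 = h0 * x" using h0(1) xy by (auto simp: intertwines_def)
      also have "J (h0 * x) = diag n f * J x"
        unfolding J_def d[symmetric] unitary_conj_mult[OF U ch0 c(1)] ..
      finally have "J y * diag n f = diag n f * J x" .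
      then show ?thesis
        using diag_mult_left[OF cJ[OF c(1)] ij, of f] diag_mult_right[OF cJ[OF c(2)] ij, of f] by simp
    qed
    have block: "J x = four_block_mat (T x) (0\<^sub>m r m) (0\<^sub>m m r) (C x)" if xy: "(x, y) \<in> B" for x y
    proof (rule eq_matI)
      have c: "x \<in> carrier_mat n n" using carr[OF xy] by auto
      fix i j assume "i < dim_row (four_block_mat (T x) (0\<^sub>m r m) (0\<^sub>m m r) (C x))"
        "j < dim_col (four_block_mat (T x) (0\<^sub>m r m) (0\<^sub>m m r) (C x))"
      then have ij: "i < n" "j < n" using n by (auto simp: T_def C_def)
      have "J x $$ (i, j) = 0" if "i < r" "\<not> j < r"
        using int[OF xy ij] r(2)[OF that(1)] r(3)[of j] that ij by simp
      moreover have "J x $$ (i, j) = 0" if "j < r" "\<not> i < r"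
        using int[OF swap[OF xy] ij] r(2)[OF that(1)] r(3)[of i] that ij by simp
      ultimately show "J x $$ (i, j) = four_block_mat (T x) (0\<^sub>m r m) (0\<^sub>m m r) (C x) $$ (i, j)"
        using ij n by (auto simp: T_def C_def)
    qed (use cJ[of x] carr[OF xy] n in \<open>auto simp: T_def C_def\<close>)
    have C_mult: "C (x * x') = C x * C x'" if xy: "(x, y) \<in> B" "(x', y') \<in> B" for x y x' y'
    proof (rule eq_matI)
      have c: "x \<in> carrier_mat n n" "x' \<in> carrier_mat n n" using carr[OF xy(1)] carr[OF xy(2)] by auto
      fix i j assume "i < dim_row (C x * C x')" "j < dim_col (C x * C x')"
      then have ij: "i < m" "j < m" by (auto simp: C_def)
      have "J (x * x') = J x * J x'" unfolding J_def by (rule unitary_conj_mult[OF U c])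
      also have "\<dots> = four_block_mat (T x * T x') (0\<^sub>m r m) (0\<^sub>m m r) (C x * C x')"
        unfolding block[OF xy(1)] block[OF xy(2)] by (rule four_block_diag_mult) (rule cTC)+
      finally show "C (x * x') $$ (i, j) = (C x * C x') $$ (i, j)"
        using ij cTC[of x] cTC[of x'] by (simp add: C_def[of "x * x'"] del: index_mult_mat(1))
    qed (simp_all add: C_def)
    define B' where "B' = (\<lambda>(x, y). (C x, C y)) ` B"
    have memB': "(C x, C y) \<in> B'" if "(x, y) \<in> B" for x y using that by (force simp: B'_def)
    have elimB': "\<exists>x y. (x, y) \<in> B \<and> a = C x \<and> b = C y" if "(a, b) \<in> B'" for a b
      using that by (auto simp: B'_def)
    have C_add: "C (x + x') = C x + C x'" if "x \<in> carrier_mat n n" "x' \<in> carrier_mat n n" for x x'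
    proof -
      have "J (x + x') = J x + J x'"
        using that U' by (simp add: J_def mult_add_distrib_mat[of _ n n _ n]
          add_mult_distrib_mat[of _ n n _ _ n] mat_closed[of _ n])
      then show ?thesis using cJ[of x] cJ[of x'] that n by (intro eq_matI) (auto simp: C_def)
    qed
    have C_smult: "C (c \<cdot>\<^sub>m x) = c \<cdot>\<^sub>m C x" if "x \<in> carrier_mat n n" for c x
    proof -
      have "J (c \<cdot>\<^sub>m x) = c \<cdot>\<^sub>m J x"
        using that U' by (simp add: J_def mult_smult_distrib[of _ n n _ n]
          mult_smult_assoc_mat[of _ n n _ n] mat_closed[of _ n])
      then show ?thesis using cJ[of x] that n by (intro eq_matI) (auto simp: C_def)
    qed
    have C_one: "C (1\<^sub>m n) = 1\<^sub>m m"
      using U' n by (intro eq_matI) (auto simp: C_def J_def)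
    have C_adj: "C (mat_adjoint x) = mat_adjoint (C x)" if "x \<in> carrier_mat n n" for x
    proof -
      have "J (mat_adjoint x) = mat_adjoint (J x)"
        unfolding J_def using unitary_conj_adjoint[OF U that] by simp
      then show ?thesis using cJ[of x] that n by (intro eq_matI) (auto simp: C_def mat_adjoint_index)
    qed
    have tr_C: "tr (C x) = tr x - (\<Sum>i<r. J x $$ (i, i))" if "x \<in> carrier_mat n n" for x
    proof -
      have "tr x = tr (J x)"
        unfolding J_def using that U' tr_comm[of "mat_adjoint U * x" n U]
        by (simp add: mat_closed[of _ n] mat_assoc[of _ n, symmetric])
      also have "\<dots> = (\<Sum>i<r. J x $$ (i, i)) + (\<Sum>i<m. J x $$ (r + i, r + i))"
        using cJ[OF that] n by (simp add: tr_def sum_lessThan_add)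
      finally show ?thesis by (simp add: tr_def C_def)
    qed
    have "selfdual_pairs m B'"
    proof unfold_locales
      fix a b assume "(a, b) \<in> B'"
      then obtain x y where xy: "(x, y) \<in> B" "a = C x" "b = C y" using elimB' by blast
      have c: "x \<in> carrier_mat n n" "y \<in> carrier_mat n n" using carr[OF xy(1)] by auto
      show "a \<in> carrier_mat m m \<and> b \<in> carrier_mat m m" using xy cTC by simp
      show "(z \<cdot>\<^sub>m a, z \<cdot>\<^sub>m b) \<in> B'" for z
        using memB'[OF smult[OF xy(1)]] c by (simp add: xy C_smult)
      show "(mat_adjoint a, mat_adjoint b) \<in> B'"
        using memB'[OF star[OF xy(1)]] c by (simp add: xy C_adj)
      show "(b, a) \<in> B'" using memB'[OF swap[OF xy(1)]] by (simp add: xy)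
      have "J x $$ (i, i) = J y $$ (i, i)" if "i < r" for i
        using int[OF xy(1), of i i] r(2)[OF that] that n by simp
      then show "tr a = tr b" using tr_eq[OF xy(1)] c by (simp add: xy tr_C)
      fix a' b' assume "(a', b') \<in> B'"
      then obtain x' y' where xy': "(x', y') \<in> B" "a' = C x'" "b' = C y'" using elimB' by blast
      have c': "x' \<in> carrier_mat n n" "y' \<in> carrier_mat n n" using carr[OF xy'(1)] by auto
      show "(a + a', b + b') \<in> B'"
        using memB'[OF add[OF xy(1) xy'(1)]] c c' by (simp add: xy xy' C_add)
      show "(a * a', b * b') \<in> B'"
        using memB'[OF mult[OF xy(1) xy'(1)]]
        by (simp add: xy xy' C_mult[OF xy(1) xy'(1)] C_mult[OF swap[OF xy(1)] swap[OF xy'(1)]])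
    next
      show "(1\<^sub>m m, 1\<^sub>m m) \<in> B'" using memB'[OF one] by (simp add: C_one)
    qed
    then interpret C: selfdual_pairs m B' .
    obtain h1 k1 where h1: "intertwines m B' h1" "mat_adjoint h1 = h1"
      and k1: "k1 \<in> carrier_mat m m" "h1 * k1 = 1\<^sub>m m" "k1 * h1 = 1\<^sub>m m"
      using less.IH[OF m C.selfdual_pairs_axioms] by blast
    have ch1: "h1 \<in> carrier_mat m m" using h1 by (simp add: intertwines_def)
    define D where "D = diag r f"
    define D' where "D' = diag r (\<lambda>i. 1 / f i)"
    have cD: "D \<in> carrier_mat r r" "D' \<in> carrier_mat r r" by (simp_all add: D_def D'_def)
    have DD: "D * D' = 1\<^sub>m r" "D' * D = 1\<^sub>m r"
      unfolding D_def D'_def diag_mult_diag using r(2) by (auto intro!: eq_matI)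
    have Dherm: "mat_adjoint D = D"
      using real n by (intro eq_matI) (auto simp: D_def mat_adjoint_index)
    define H where "H = four_block_mat D (0\<^sub>m r m) (0\<^sub>m m r) h1"
    define K where "K = four_block_mat D' (0\<^sub>m r m) (0\<^sub>m m r) k1"
    have cHK: "H \<in> carrier_mat n n" "K \<in> carrier_mat n n"
      using cD ch1 k1 n by (auto simp: H_def K_def)
    have HK: "H * K = 1\<^sub>m n" "K * H = 1\<^sub>m n"
      unfolding H_def K_def using cD ch1 k1 n
      by (simp_all add: four_block_diag_mult DD four_block_one)
    have "mat_adjoint (0\<^sub>m a b :: complex mat) = 0\<^sub>m b a" for a b
      by (intro eq_matI) (auto simp: mat_adjoint_index)
    then have Hherm: "mat_adjoint H = H"
      unfolding H_def using cD ch1 by (simp add: mat_adjoint_four_block[of _ r _ m] Dherm h1(2))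
    have Hint: "J y * H = H * J x" if xy: "(x, y) \<in> B" for x y
    proof -
      have "T y * D = D * T x"
      proof (rule eq_matI)
        fix i j assume "i < dim_row (D * T x)" "j < dim_col (D * T x)"
        then have ij: "i < r" "j < r" by (auto simp: D_def T_def)
        then show "(T y * D) $$ (i, j) = (D * T x) $$ (i, j)"
          unfolding D_def diag_mult_left[OF cTC(1) ij] diag_mult_right[OF cTC(1) ij]
          using int[OF xy, of i j] n by (simp add: T_def)
      qed (simp_all add: D_def T_def)
      moreover have "C y * h1 = h1 * C x"
        using h1(1) memB'[OF xy] by (auto simp: intertwines_def)
      ultimately show ?thesis
        unfolding block[OF xy] block[OF swap[OF xy]] H_def
        using cTC cD ch1 by (simp add: four_block_diag_mult)
    qed
    define h where "h = U * H * mat_adjoint U"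
    define k where "k = U * K * mat_adjoint U"
    have chk: "h \<in> carrier_mat n n" "k \<in> carrier_mat n n"
      using U' cHK by (simp_all add: h_def k_def mat_closed[of _ n])
    have "h * k = 1\<^sub>m n" "k * h = 1\<^sub>m n"
      unfolding h_def k_def using U' cHK HK
      by (simp_all add: mat_simps[of _ n] mat_cancel[of _ n])
    moreover have "mat_adjoint h = h"
      unfolding h_def using U' cHK Hherm by (simp add: mat_adjoint_mult[of _ n] mat_simps[of _ n])
    moreover have "y * h = h * x" if xy: "(x, y) \<in> B" for x y
    proof -
      have c: "x \<in> carrier_mat n n" "y \<in> carrier_mat n n" using carr[OF xy] by auto
      have "y * h = U * (J y * H) * mat_adjoint U"
        using U' c cHK by (simp add: h_def J_def mat_simps[of _ n] mat_cancel[of _ n])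
      also have "\<dots> = U * (H * J x) * mat_adjoint U" by (simp add: Hint[OF xy])
      also have "\<dots> = h * x"
        using U' c cHK by (simp add: h_def J_def mat_simps[of _ n])
      finally show ?thesis .
    qed
    ultimately show ?thesis using chk by (intro exI[of _ h] exI[of _ k]) (auto simp: intertwines_def)
  qed
qed

section \<open>Balanced families of matrices\<close>

abbreviation entries :: "complex mat \<Rightarrow> nat \<Rightarrow> nat \<Rightarrow> complex" where
  "entries A \<equiv> \<lambda>i j. A $$ (i, j)"

text \<open>
  Equivalently \<open>\<Sum>\<^sub>k (X\<^sub>k X\<^sub>k\<^sup>* - X\<^sub>k\<^sup>* X\<^sub>k) = 0\<close>, the vanishing of the moment map for the conjugation
  action of the unitary group.
\<close>

definition balanced :: "nat \<Rightarrow> 'k set \<Rightarrow> ('k \<Rightarrow> complex mat) \<Rightarrow> bool" where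
  "balanced n K X \<longleftrightarrow> (\<forall>w. (\<Sum>k\<in>K. nrm2 {..<n} (kernel_app {..<n} (kernel_adj (entries (X k))) w)) =
     (\<Sum>k\<in>K. nrm2 {..<n} (kernel_app {..<n} (entries (X k)) w)))"

lemma nrm2_pair_index:
  "nrm2 (pair_index n) u =
    (\<Sum>j<n. nrm2 {..<n} (\<lambda>i. u (False, i, j))) + (\<Sum>j<n. nrm2 {..<n} (\<lambda>i. u (True, i, j)))"
proof -
  have "nrm2 (pair_index n) u = (\<Sum>b\<in>UNIV. \<Sum>i<n. \<Sum>j<n. (cmod (u (b, i, j)))\<^sup>2)"
    by (simp add: nrm2_def pair_index_def sum.cartesian_product)
  also have "\<dots> = (\<Sum>b\<in>UNIV. \<Sum>j<n. \<Sum>i<n. (cmod (u (b, i, j)))\<^sup>2)"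
    by (intro sum.cong refl sum.swap)
  finally show ?thesis by (simp add: nrm2_def UNIV_bool)
qed

lemma nrm2_cong: "(\<And>i. i \<in> I \<Longrightarrow> u i = v i) \<Longrightarrow> nrm2 I u = nrm2 I v"
  by (simp add: nrm2_def)

lemma nrm2_left_mult:
  "nrm2 (pair_index n) (kernel_app (pair_index n) (left_mult x y) u) =
    (\<Sum>j<n. nrm2 {..<n} (kernel_app {..<n} (entries x) (\<lambda>i. u (False, i, j)))) +
    (\<Sum>j<n. nrm2 {..<n} (kernel_app {..<n} (entries y) (\<lambda>i. u (True, i, j))))"
  unfolding nrm2_pair_index
  by (intro arg_cong2[of _ _ _ _ "(+)"] sum.cong refl nrm2_cong)
    (simp_all add: kernel_app_left_mult, simp_all add: kernel_app_def)

text \<open>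
  \<open>B\<close> is invariant under left multiplication by its own members, and the balance condition passes from
  vectors to pairs of matrices column by column. Hence \<open>B\<close> is invariant under left multiplication by
  the adjoint pairs, and applying this to the identity yields the adjoint pairs themselves.
\<close>

lemma (in pair_algebra) balanced_imp_adjoint_mem:
  assumes K: "finite K" and B: "\<And>k. k \<in> K \<Longrightarrow> (X k, Y k) \<in> B"
    and X: "balanced n K X" and Y: "balanced n K Y" and k: "k \<in> K"
  shows "(mat_adjoint (X k), mat_adjoint (Y k)) \<in> B"
proof -
  let ?I = "pair_index n" and ?M = "\<lambda>k. left_mult (X k) (Y k)"
  have c: "X k \<in> carrier_mat n n" "Y k \<in> carrier_mat n n" if "k \<in> K" for k
    using carr[OF B[OF that]] by auto
  have dagM: "kernel_app ?I (kernel_adj (?M k)) u p = kernel_app ?I (left_mult (mat_adjoint (X k)) (mat_adjoint (Y k))) u p"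
    if "k \<in> K" "p \<in> ?I" for k u p
    using c[OF that(1)] that(2) by (intro kernel_app_cong kernel_adj_left_mult) auto
  have eA: "nrm2 {..<n} (kernel_app {..<n} (entries (mat_adjoint A)) w) = nrm2 {..<n} (kernel_app {..<n} (kernel_adj (entries A)) w)"
    if "A \<in> carrier_mat n n" for A w
    using that by (intro nrm2_cong kernel_app_cong) (auto simp: kernel_adj_def mat_adjoint_index)
  have "kernel_app ?I (kernel_adj (?M k)) (pair_vec (1\<^sub>m n) (1\<^sub>m n)) \<in> pair_vecs n B"
  proof (rule adjoint_invariant[OF finite_pair_index K subspace_pair_vecs _ _ k pair_vec_mem[OF one]])
    fix k u assume k: "k \<in> K" and "u \<in> pair_vecs n B"
    then obtain x y where xy: "(x, y) \<in> B" "\<And>p. p \<in> ?I \<Longrightarrow> u p = pair_vec x y p"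
      by (auto simp: pair_vecs_def)
    have "kernel_app ?I (?M k) u p = pair_vec (X k * x) (Y k * y) p" if "p \<in> ?I" for p
    proof -
      have "kernel_app ?I (?M k) u p = kernel_app ?I (?M k) (pair_vec x y) p"
        using xy(2) by (intro kernel_app_cong) auto
      then show ?thesis using kernel_app_left_mult_pair_vec[of "X k" n "Y k" x y p] c[OF k] carr[OF xy(1)] that by simp
    qed
    then show "kernel_app ?I (?M k) u \<in> pair_vecs n B"
      using mult[OF B[OF k] xy(1)] unfolding pair_vecs_def by blast
  next
    fix u
    have "(\<Sum>k\<in>K. nrm2 ?I (kernel_app ?I (kernel_adj (?M k)) u)) =
      (\<Sum>k\<in>K. (\<Sum>j<n. nrm2 {..<n} (kernel_app {..<n} (kernel_adj (entries (X k))) (\<lambda>i. u (False, i, j)))) +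
        (\<Sum>j<n. nrm2 {..<n} (kernel_app {..<n} (kernel_adj (entries (Y k))) (\<lambda>i. u (True, i, j)))))"
    proof (rule sum.cong)
      fix k assume k: "k \<in> K"
      have "nrm2 ?I (kernel_app ?I (kernel_adj (?M k)) u) =
        nrm2 ?I (kernel_app ?I (left_mult (mat_adjoint (X k)) (mat_adjoint (Y k))) u)"
        by (rule nrm2_cong) (rule dagM[OF k])
      then show "nrm2 ?I (kernel_app ?I (kernel_adj (?M k)) u) =
        (\<Sum>j<n. nrm2 {..<n} (kernel_app {..<n} (kernel_adj (entries (X k))) (\<lambda>i. u (False, i, j)))) +
        (\<Sum>j<n. nrm2 {..<n} (kernel_app {..<n} (kernel_adj (entries (Y k))) (\<lambda>i. u (True, i, j))))"
        by (simp only: nrm2_left_mult eA[OF c(1)[OF k]] eA[OF c(2)[OF k]])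
    qed simp
    also have "\<dots> = (\<Sum>j<n. \<Sum>k\<in>K. nrm2 {..<n} (kernel_app {..<n} (kernel_adj (entries (X k))) (\<lambda>i. u (False, i, j)))) +
        (\<Sum>j<n. \<Sum>k\<in>K. nrm2 {..<n} (kernel_app {..<n} (kernel_adj (entries (Y k))) (\<lambda>i. u (True, i, j))))"
      unfolding sum.distrib by (intro arg_cong2[of _ _ _ _ "(+)"] sum.swap)
    also have "\<dots> = (\<Sum>j<n. \<Sum>k\<in>K. nrm2 {..<n} (kernel_app {..<n} (entries (X k)) (\<lambda>i. u (False, i, j)))) +
        (\<Sum>j<n. \<Sum>k\<in>K. nrm2 {..<n} (kernel_app {..<n} (entries (Y k)) (\<lambda>i. u (True, i, j))))"
      using X Y by (simp add: balanced_def)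
    also have "\<dots> = (\<Sum>k\<in>K. (\<Sum>j<n. nrm2 {..<n} (kernel_app {..<n} (entries (X k)) (\<lambda>i. u (False, i, j)))) +
        (\<Sum>j<n. nrm2 {..<n} (kernel_app {..<n} (entries (Y k)) (\<lambda>i. u (True, i, j)))))"
      unfolding sum.distrib by (intro arg_cong2[of _ _ _ _ "(+)"] sum.swap)
    finally show "(\<Sum>k\<in>K. nrm2 ?I (kernel_app ?I (kernel_adj (?M k)) u)) = (\<Sum>k\<in>K. nrm2 ?I (kernel_app ?I (?M k) u))"
      by (simp only: nrm2_left_mult)
  qed
  moreover have "kernel_app ?I (kernel_adj (?M k)) (pair_vec (1\<^sub>m n) (1\<^sub>m n)) p =
      pair_vec (mat_adjoint (X k)) (mat_adjoint (Y k)) p" if "p \<in> ?I" for p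
    using dagM[OF k that] kernel_app_left_mult_pair_vec[of "mat_adjoint (X k)" n "mat_adjoint (Y k)" "1\<^sub>m n" "1\<^sub>m n" p]
      c[OF k] that by (simp add: right_mult_one_mat[of _ n n])
  ultimately have "pair_vec (mat_adjoint (X k)) (mat_adjoint (Y k)) \<in> pair_vecs n B"
    using subspace_onD(4)[OF subspace_pair_vecs] by metis
  then show ?thesis using pair_vecs_memD c[OF k] by blast
qed

section \<open>Minimal norm implies balance\<close>

definition col_norm2 :: "complex mat \<Rightarrow> nat \<Rightarrow> real" where
  "col_norm2 A j = (\<Sum>i<dim_row A. (cmod (A $$ (i, j)))\<^sup>2)"

definition mat_norm2 :: "complex mat \<Rightarrow> real" where
  "mat_norm2 A = (\<Sum>j<dim_col A. col_norm2 A j)"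

lemma col_norm2_eq:
  assumes "A \<in> carrier_mat n n" "j < n"
  shows "complex_of_real (col_norm2 A j) = (mat_adjoint A * A) $$ (j, j)"
proof -
  have "(mat_adjoint A * A) $$ (j, j) = (\<Sum>i<n. cnj (A $$ (i, j)) * A $$ (i, j))"
    using assms by (subst index_mult_sum[of _ n n _ n]) (auto simp: mat_adjoint_index)
  then show ?thesis
    using assms by (simp add: col_norm2_def complex_norm_square mult.commute del: of_real_power)
qed

lemma col_norm2_unitary:
  assumes V: "unitary n V" and A: "A \<in> carrier_mat n n" and j: "j < n"
  shows "col_norm2 (V * A) j = col_norm2 A j"
proof -
  note V' = unitaryD[OF V]
  have "mat_adjoint (V * A) * (V * A) = mat_adjoint A * A"
    using V' A by (simp add: mat_adjoint_mult[of _ n] mat_simps[of _ n] mat_cancel[of _ n])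
  then have "complex_of_real (col_norm2 (V * A) j) = complex_of_real (col_norm2 A j)"
    using col_norm2_eq[of "V * A" n j] col_norm2_eq[OF A j] V' A j by simp
  then show ?thesis by (simp only: of_real_eq_iff)
qed

lemma mat_norm2_unitary:
  assumes "unitary n V" "A \<in> carrier_mat n n"
  shows "mat_norm2 (V * A) = mat_norm2 A"
  using assms col_norm2_unitary[OF assms] by (auto simp: mat_norm2_def unitary_def)

lemma mat_norm2_adjoint: "mat_norm2 (mat_adjoint A) = mat_norm2 A"
  unfolding mat_norm2_def col_norm2_def by (subst sum.swap) (auto simp: mat_adjoint_index)

lemma mat_norm2_unitary_conj:
  assumes U: "unitary n U" and A: "A \<in> carrier_mat n n"
  shows "mat_norm2 (mat_adjoint U * A * U) = mat_norm2 A"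
proof -
  note U' = unitaryD[OF U]
  have "mat_norm2 (mat_adjoint U * A * U) = mat_norm2 (A * U)"
    using mat_norm2_unitary[OF unitary_adjoint[OF U], of "A * U"] U' A by (simp add: mat_simps[of _ n])
  also have "\<dots> = mat_norm2 (mat_adjoint U * mat_adjoint A)"
    using mat_norm2_adjoint[of "A * U"] U' A by (simp add: mat_adjoint_mult[of _ n])
  also have "\<dots> = mat_norm2 A"
    using mat_norm2_unitary[OF unitary_adjoint[OF U], of "mat_adjoint A"] A by (simp add: mat_norm2_adjoint)
  finally show ?thesis .
qed

text \<open>
  The expression has a minimum at \<open>t = 1\<close>, where its derivative is \<open>2 (c - b)\<close>.
\<close>

lemma scaling_balance:
  fixes b c :: real
  assumes "b \<ge> 0" "c \<ge> 0" and le: "\<And>t. t > 0 \<Longrightarrow> (t\<^sup>2 - 1) * c + (1 / t\<^sup>2 - 1) * b \<ge> 0"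
  shows "b = c"
proof -
  have T: "(T - 1) * (c - b / T) \<ge> 0" if "T > 0" for T
  proof -
    have "(T - 1) * (c - b / T) = (T - 1) * c + (1 / T - 1) * b" using that by (simp add: field_simps)
    then show ?thesis using le[of "sqrt T"] that by simp
  qed
  show ?thesis
  proof (rule linorder_cases[of b c])
    assume bc: "b < c"
    \<comment> \<open>With \<open>T = t\<^sup>2\<close> the expression is \<open>(T - 1) (c - b / T)\<close>. It is negative here for \<open>b / c < T < 1\<close>, and in the case \<open>c < b\<close> for \<open>T > 1\<close> with \<open>c T < b\<close>.\<close>
    define T where "T = (b + c) / (2 * c)"
    have "T > 0" "T < 1" using bc assms by (auto simp: T_def field_simps)
    moreover have "c - b / T > 0"
    proof -
      have "b < c * T" using bc assms by (simp add: T_def)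
      then show ?thesis using \<open>T > 0\<close> by (simp add: field_simps)
    qed
    ultimately show ?thesis using T[of T] by (simp add: zero_le_mult_iff)
  next
    assume bc: "c < b"
    define T where "T = 2 * b / (b + c)"
    have "T > 1" using bc assms by (auto simp: T_def field_simps)
    moreover have "c - b / T < 0"
    proof -
      have "b / T = (b + c) / 2" using bc assms by (simp add: T_def)
      then show ?thesis using bc by simp
    qed
    ultimately show ?thesis using T[of T] by (simp add: zero_le_mult_iff)
  qed
qed

text \<open>
  Scaling the first coordinate by \<open>t\<close> multiplies the rest of the first row by \<open>t\<close> and the rest of the
  first column by \<open>1 / t\<close>.
\<close>

lemma mat_norm2_scale_first:
  assumes Y: "Y \<in> carrier_mat n n" and n: "n > 0" and t: "t > 0"
  shows "mat_norm2 (diag n (\<lambda>i. if i = 0 then complex_of_real t else 1) * Y *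
      diag n (\<lambda>i. if i = 0 then complex_of_real (1 / t) else 1)) =
    mat_norm2 Y + (t\<^sup>2 - 1) * (col_norm2 (mat_adjoint Y) 0 - (cmod (Y $$ (0, 0)))\<^sup>2) +
      (1 / t\<^sup>2 - 1) * (col_norm2 Y 0 - (cmod (Y $$ (0, 0)))\<^sup>2)"
proof -
  obtain m where m: "n = Suc m" using n not0_implies_Suc by blast
  let ?d = "\<lambda>i :: nat. if i = 0 then complex_of_real t else 1"
  let ?d' = "\<lambda>i :: nat. if i = 0 then complex_of_real (1 / t) else 1"
  have e: "(diag n ?d * Y * diag n ?d') $$ (i, j) = ?d i * Y $$ (i, j) * ?d' j" if "i < n" "j < n" for i j
    using that Y by (simp add: diag_mult_left[of _ n] diag_mult_right[of _ n] mat_closed[of _ n]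
      del: index_mult_mat(1))
  have "mat_norm2 (diag n ?d * Y * diag n ?d') = (\<Sum>j<n. \<Sum>i<n. (cmod (?d i * Y $$ (i, j) * ?d' j))\<^sup>2)"
    unfolding mat_norm2_def col_norm2_def using Y by (simp add: e del: index_mult_mat(1))
  moreover have "mat_norm2 Y = (\<Sum>j<n. \<Sum>i<n. (cmod (Y $$ (i, j)))\<^sup>2)"
    using Y by (simp add: mat_norm2_def col_norm2_def)
  moreover have "col_norm2 (mat_adjoint Y) 0 = (\<Sum>j<n. (cmod (Y $$ (0, j)))\<^sup>2)"
    using Y n by (simp add: col_norm2_def mat_adjoint_index)
  moreover have "col_norm2 Y 0 = (\<Sum>i<n. (cmod (Y $$ (i, 0)))\<^sup>2)"
    using Y by (simp add: col_norm2_def)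
  ultimately show ?thesis
    using t unfolding m
    by (simp add: sum.lessThan_Suc_shift sum.distrib norm_mult norm_divide power_mult_distrib
      power_divide sum_distrib_left[symmetric] sum_distrib_right[symmetric] sum_divide_distrib[symmetric] algebra_simps del: sum.lessThan_Suc)
qed

text \<open>
  For a given vector choose a unitary matrix \<open>U\<close> whose first column is proportional to it, and conjugate by
  \<open>D U\<^sup>*\<close>, where \<open>D\<close> scales the first coordinate by \<open>t\<close>. The norm is smallest at \<open>t = 1\<close> only if
  the first rows and the first columns of the matrices \<open>U\<^sup>* X\<^sub>k U\<close> have the same total norm.
\<close>

lemma minimal_imp_balanced:
  assumes K: "finite K" and X: "\<And>k. k \<in> K \<Longrightarrow> X k \<in> carrier_mat n n"
    and min: "\<And>g g'. g \<in> carrier_mat n n \<Longrightarrow> g' \<in> carrier_mat n n \<Longrightarrow> g * g' = 1\<^sub>m n \<Longrightarrow> g' * g = 1\<^sub>m n \<Longrightarrow>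
      (\<Sum>k\<in>K. mat_norm2 (X k)) \<le> (\<Sum>k\<in>K. mat_norm2 (g * X k * g'))"
  shows "balanced n K X"
proof (cases "n = 0")
  case True
  then show ?thesis by (simp add: balanced_def nrm2_def)
next
  case False
  show ?thesis unfolding balanced_def
  proof
    fix w :: "nat \<Rightarrow> complex"
    define v where "v = vec n w"
    show "(\<Sum>k\<in>K. nrm2 {..<n} (kernel_app {..<n} (kernel_adj (entries (X k))) w)) =
      (\<Sum>k\<in>K. nrm2 {..<n} (kernel_app {..<n} (entries (X k)) w))"
    proof (cases "v = 0\<^sub>v n")
      case True
      have "w i = 0" if "i < n" for i using arg_cong[OF True, of "\<lambda>v. v $ i"] that by (simp add: v_def)
      then show ?thesis by (simp add: kernel_app_def nrm2_def)
    next
      case vn: False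
      obtain U c where U: "unitary n U" and c: "c > 0" and col: "col U 0 = complex_of_real c \<cdot>\<^sub>v v"
        using unitary_with_first_column[OF _ vn] by (metis v_def vec_carrier)
      note U' = unitaryD[OF U]
      have U0: "U $$ (i, 0) = of_real c * w i" if "i < n" for i
        using arg_cong[OF col, of "\<lambda>v. v $ i"] that U' False by (simp add: v_def)
      define Y where "Y k = mat_adjoint U * X k * U" for k
      have Y: "Y k \<in> carrier_mat n n" if "k \<in> K" for k
        using X[OF that] U' by (simp add: Y_def mat_closed[of _ n])
      have colX: "col_norm2 (mat_adjoint U * A * U) 0 = c\<^sup>2 * nrm2 {..<n} (kernel_app {..<n} (entries A) w)"
        if A: "A \<in> carrier_mat n n" for A
      proof -
        have "col_norm2 (mat_adjoint U * A * U) 0 = col_norm2 (A * U) 0"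
          using col_norm2_unitary[OF unitary_adjoint[OF U], of "A * U" 0] U' A False
          by (simp add: mat_simps[of _ n])
        also have "\<dots> = (\<Sum>i<n. (cmod (of_real c * kernel_app {..<n} (entries A) w i))\<^sup>2)"
        proof -
          have "(A * U) $$ (i, 0) = of_real c * kernel_app {..<n} (entries A) w i" if "i < n" for i
            using that A U' False
            by (subst index_mult_sum[of _ n n _ n]) (auto simp: U0 kernel_app_def sum_distrib_left mult.left_commute)
          then show ?thesis using A by (simp add: col_norm2_def del: index_mult_mat(1))
        qed
        also have "\<dots> = c\<^sup>2 * nrm2 {..<n} (kernel_app {..<n} (entries A) w)"
          by (simp add: nrm2_def norm_mult power_mult_distrib sum_distrib_left)
        finally show ?thesis .
      qed
      have rowX: "col_norm2 (mat_adjoint (Y k)) 0 = c\<^sup>2 * nrm2 {..<n} (kernel_app {..<n} (kernel_adj (entries (X k))) w)"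
        if k: "k \<in> K" for k
      proof -
        have "mat_adjoint (Y k) = mat_adjoint U * mat_adjoint (X k) * U"
          unfolding Y_def by (rule unitary_conj_adjoint[OF U X[OF k]])
        moreover have "nrm2 {..<n} (kernel_app {..<n} (entries (mat_adjoint (X k))) w) =
            nrm2 {..<n} (kernel_app {..<n} (kernel_adj (entries (X k))) w)"
          using X[OF k] by (intro nrm2_cong kernel_app_cong) (auto simp: kernel_adj_def mat_adjoint_index)
        ultimately show ?thesis using colX[of "mat_adjoint (X k)"] X[OF k] by auto
      qed
      define R where "R = (\<Sum>k\<in>K. col_norm2 (mat_adjoint (Y k)) 0 - (cmod (Y k $$ (0, 0)))\<^sup>2)"
      define C where "C = (\<Sum>k\<in>K. col_norm2 (Y k) 0 - (cmod (Y k $$ (0, 0)))\<^sup>2)"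
      have nn: "col_norm2 A 0 - (cmod (A $$ (0, 0)))\<^sup>2 \<ge> 0" if "A \<in> carrier_mat n n" for A
        using member_le_sum[of 0 "{..<n}" "\<lambda>i. (cmod (A $$ (i, 0)))\<^sup>2"] that False by (simp add: col_norm2_def)
      have "R \<ge> 0" unfolding R_def
      proof (rule sum_nonneg)
        fix k assume k: "k \<in> K"
        show "0 \<le> col_norm2 (mat_adjoint (Y k)) 0 - (cmod (Y k $$ (0, 0)))\<^sup>2"
          using nn[of "mat_adjoint (Y k)"] Y[OF k] False by (auto simp: mat_adjoint_index)
      qed
      moreover have "C \<ge> 0" unfolding C_def by (intro sum_nonneg nn Y)
      moreover have "(t\<^sup>2 - 1) * R + (1 / t\<^sup>2 - 1) * C \<ge> 0" if t: "t > 0" for t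
      proof -
        let ?d = "diag n (\<lambda>i. if i = 0 then complex_of_real t else 1)"
        let ?d' = "diag n (\<lambda>i. if i = 0 then complex_of_real (1 / t) else 1)"
        have dd: "?d * ?d' = 1\<^sub>m n" "?d' * ?d = 1\<^sub>m n"
          unfolding diag_mult_diag using t by (auto intro!: eq_matI)
        have cd: "?d \<in> carrier_mat n n" "?d' \<in> carrier_mat n n" by simp_all
        define D where "D = ?d"
        define D' where "D' = ?d'"
        note [simp] = dd[folded D_def D'_def] cd[folded D_def D'_def]
        have "(\<Sum>k\<in>K. mat_norm2 (X k)) \<le>
            (\<Sum>k\<in>K. mat_norm2 ((D * mat_adjoint U) * X k * (U * D')))"
          using U' by (intro min) (simp_all add: mat_simps[of _ n] mat_cancel[of _ n])
        also have "\<dots> = (\<Sum>k\<in>K. mat_norm2 (D * Y k * D'))"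
          using U' X by (intro sum.cong refl) (simp add: Y_def mat_simps[of _ n])
        also have "\<dots> = (\<Sum>k\<in>K. mat_norm2 (Y k)) + (t\<^sup>2 - 1) * R + (1 / t\<^sup>2 - 1) * C"
          unfolding D_def D'_def R_def C_def sum_distrib_left sum.distrib[symmetric]
          using False t by (intro sum.cong refl mat_norm2_scale_first Y) auto
        also have "(\<Sum>k\<in>K. mat_norm2 (Y k)) = (\<Sum>k\<in>K. mat_norm2 (X k))"
          unfolding Y_def using mat_norm2_unitary_conj[OF U X] by (intro sum.cong) auto
        finally show ?thesis by simp
      qed
      ultimately have "C = R" by (intro scaling_balance)
      then have "(\<Sum>k\<in>K. col_norm2 (Y k) 0) = (\<Sum>k\<in>K. col_norm2 (mat_adjoint (Y k)) 0)"
        by (simp add: R_def C_def sum_subtractf)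
      moreover have "(\<Sum>k\<in>K. col_norm2 (Y k) 0) = c\<^sup>2 * (\<Sum>k\<in>K. nrm2 {..<n} (kernel_app {..<n} (entries (X k)) w))"
        unfolding sum_distrib_left Y_def using colX X by (intro sum.cong) auto
      moreover have "(\<Sum>k\<in>K. col_norm2 (mat_adjoint (Y k)) 0) =
          c\<^sup>2 * (\<Sum>k\<in>K. nrm2 {..<n} (kernel_app {..<n} (kernel_adj (entries (X k))) w))"
        unfolding sum_distrib_left using rowX by (intro sum.cong) auto
      ultimately show ?thesis using c by simp
    qed
  qed
qed

section \<open>The algebra spanned by a representation and its dual\<close>

inductive_set rep_pairs ::
    "'a set \<Rightarrow> ('a \<Rightarrow> complex mat) \<Rightarrow> ('a \<Rightarrow> complex mat) \<Rightarrow> (complex mat \<times> complex mat) set"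
  for G :: "'a set" and \<rho> \<rho>' :: "'a \<Rightarrow> complex mat" where
  gen: "g \<in> G \<Longrightarrow> (\<rho> g, \<rho>' g) \<in> rep_pairs G \<rho> \<rho>'"
| add: "(x, y) \<in> rep_pairs G \<rho> \<rho>' \<Longrightarrow> (x', y') \<in> rep_pairs G \<rho> \<rho>' \<Longrightarrow> (x + x', y + y') \<in> rep_pairs G \<rho> \<rho>'"
| smult: "(x, y) \<in> rep_pairs G \<rho> \<rho>' \<Longrightarrow> (c \<cdot>\<^sub>m x, c \<cdot>\<^sub>m y) \<in> rep_pairs G \<rho> \<rho>'"

lemma hom_GL_carrier: "\<rho> \<in> hom \<Gamma> (GL n) \<Longrightarrow> \<gamma> \<in> carrier \<Gamma> \<Longrightarrow> \<rho> \<gamma> \<in> carrier (GL n)"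
  by (auto simp: hom_def)

lemma hom_GL_carrier_mat: "\<rho> \<in> hom \<Gamma> (GL n) \<Longrightarrow> \<gamma> \<in> carrier \<Gamma> \<Longrightarrow> \<rho> \<gamma> \<in> carrier_mat n n"
  by (rule GL_carrier_mat[OF hom_GL_carrier])

lemma hom_GL_mult:
  "\<rho> \<in> hom \<Gamma> (GL n) \<Longrightarrow> a \<in> carrier \<Gamma> \<Longrightarrow> b \<in> carrier \<Gamma> \<Longrightarrow> \<rho> (a \<otimes>\<^bsub>\<Gamma>\<^esub> b) = \<rho> a * \<rho> b"
  by (simp add: hom_mult)

lemma hom_GL_one: "group \<Gamma> \<Longrightarrow> \<rho> \<in> hom \<Gamma> (GL n) \<Longrightarrow> \<rho> \<one>\<^bsub>\<Gamma>\<^esub> = 1\<^sub>m n"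
  using hom_one[of \<rho> \<Gamma> "GL n"] group_GL by simp

lemma hom_GL_inv:
  assumes "group \<Gamma>" "\<rho> \<in> hom \<Gamma> (GL n)" "\<gamma> \<in> carrier \<Gamma>"
  shows "\<rho> (inv\<^bsub>\<Gamma>\<^esub> \<gamma>) = inv\<^bsub>GL n\<^esub> (\<rho> \<gamma>)"
proof -
  interpret group_hom \<Gamma> "GL n" \<rho>
    using assms group_GL by (simp add: group_hom_def group_hom_axioms_def)
  show ?thesis using assms(3) by simp
qed

lemma dual_rep_eq:
  assumes "group \<Gamma>" "\<rho> \<in> hom \<Gamma> (GL n)" "\<gamma> \<in> carrier \<Gamma>"
  shows "dual_rep n \<rho> \<gamma> = mat_adjoint (\<rho> (inv\<^bsub>\<Gamma>\<^esub> \<gamma>))"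
  using hom_GL_inv[OF assms] mat_adjoint_GL(2)[OF hom_GL_carrier[OF assms(2,3)]]
  by (simp add: dual_rep_def)

lemma pair_algebra_rep_pairs:
  assumes \<Gamma>: "group \<Gamma>" and \<rho>: "\<rho> \<in> hom \<Gamma> (GL n)" and \<rho>': "\<rho>' \<in> hom \<Gamma> (GL n)"
  shows "pair_algebra n (rep_pairs (carrier \<Gamma>) \<rho> \<rho>')"
proof -
  interpret \<Gamma>: group \<Gamma> by (rule \<Gamma>)
  let ?B = "rep_pairs (carrier \<Gamma>) \<rho> \<rho>'"
  have carr: "x \<in> carrier_mat n n \<and> y \<in> carrier_mat n n" if "(x, y) \<in> ?B" for x y
    using that by induction (use hom_GL_carrier_mat[OF \<rho>] hom_GL_carrier_mat[OF \<rho>'] in auto)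
  have mult_gen: "(\<rho> g * x, \<rho>' g * y) \<in> ?B" if "(x, y) \<in> ?B" and g: "g \<in> carrier \<Gamma>" for g x y
    using that(1)
  proof induction
    case (gen h)
    then show ?case
      using rep_pairs.gen[of "g \<otimes>\<^bsub>\<Gamma>\<^esub> h" "carrier \<Gamma>" \<rho> \<rho>'] g by (simp add: hom_GL_mult[OF \<rho>] hom_GL_mult[OF \<rho>'])
  next
    case (add x y x' y')
    then show ?case
      using rep_pairs.add[OF add.IH] carr[OF add.hyps(1)] carr[OF add.hyps(2)]
        hom_GL_carrier_mat[OF \<rho> g] hom_GL_carrier_mat[OF \<rho>' g]
      by (simp add: mult_add_distrib_mat[of _ n n _ n])
  next
    case (smult x y c)
    then show ?case
      using rep_pairs.smult[OF smult.IH, of c] carr[OF smult.hyps(1)]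
        hom_GL_carrier_mat[OF \<rho> g] hom_GL_carrier_mat[OF \<rho>' g]
      by (simp add: mult_smult_distrib[of _ n n _ n])
  qed
  have mult: "(x * x', y * y') \<in> ?B" if "(x, y) \<in> ?B" and B': "(x', y') \<in> ?B" for x y x' y'
    using that(1)
  proof induction
    case (gen h)
    then show ?case by (rule mult_gen[OF B'])
  next
    case (add x y z w)
    then show ?case
      using rep_pairs.add[OF add.IH] carr[OF add.hyps(1)] carr[OF add.hyps(2)] carr[OF B']
      by (simp add: add_mult_distrib_mat[of _ n n _ _ n])
  next
    case (smult x y c)
    then show ?case
      using rep_pairs.smult[OF smult.IH, of c] carr[OF smult.hyps(1)] carr[OF B']
      by (simp add: mult_smult_assoc_mat[of _ n n _ n])
  qed
  have "(1\<^sub>m n, 1\<^sub>m n) \<in> ?B"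
    using rep_pairs.gen[of "\<one>\<^bsub>\<Gamma>\<^esub>" "carrier \<Gamma>" \<rho> \<rho>'] by (simp add: hom_GL_one[OF \<Gamma> \<rho>] hom_GL_one[OF \<Gamma> \<rho>'])
  then show ?thesis
    by unfold_locales (assumption | rule carr mult rep_pairs.add rep_pairs.smult)+
qed

text \<open>
  The generators enter together with their inverses: this makes the family of the dual representation
  the family of the adjoint matrices, and it bounds the inverses in the compactness argument for a
  minimum of the norm.
\<close>

definition gen_mat :: "('a, 'b) monoid_scheme \<Rightarrow> ('a \<Rightarrow> complex mat) \<Rightarrow> 'a \<times> bool \<Rightarrow> complex mat" where
  "gen_mat \<Gamma> \<rho> = (\<lambda>(s, b). if b then \<rho> s else \<rho> (inv\<^bsub>\<Gamma>\<^esub> s))"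

text \<open>
  The dual of the matrix of \<open>s\<close> is the adjoint of the matrix of the inverse of \<open>s\<close>, so dualising exchanges
  the two sides of the balance condition.
\<close>

lemma balanced_dual:
  assumes \<Gamma>: "group \<Gamma>" and S: "S \<subseteq> carrier \<Gamma>" and \<rho>: "\<rho> \<in> hom \<Gamma> (GL n)"
    and bal: "balanced n (S \<times> UNIV) (gen_mat \<Gamma> \<rho>)"
  shows "balanced n (S \<times> UNIV) (gen_mat \<Gamma> (dual_rep n \<rho>))"
  unfolding balanced_def
proof
  fix w :: "nat \<Rightarrow> complex"
  interpret \<Gamma>: group \<Gamma> by (rule \<Gamma>)
  let ?K = "S \<times> (UNIV :: bool set)"
  let ?f = "\<lambda>k. nrm2 {..<n} (kernel_app {..<n} (entries (gen_mat \<Gamma> \<rho> k)) w)"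
  let ?g = "\<lambda>k. nrm2 {..<n} (kernel_app {..<n} (kernel_adj (entries (gen_mat \<Gamma> \<rho> k))) w)"
  define opp where "opp = (\<lambda>(s :: 'a, b). (s, \<not> b))"
  have inS: "s \<in> carrier \<Gamma>" "inv\<^bsub>\<Gamma>\<^esub> s \<in> carrier \<Gamma>" if "s \<in> S" for s using S that by auto
  have dual: "gen_mat \<Gamma> (dual_rep n \<rho>) k = mat_adjoint (gen_mat \<Gamma> \<rho> (opp k))" if "k \<in> ?K" for k
    using that inS by (auto simp: gen_mat_def opp_def dual_rep_eq[OF \<Gamma> \<rho>])
  have c: "gen_mat \<Gamma> \<rho> (opp k) \<in> carrier_mat n n" if "k \<in> ?K" for k
    using that inS by (auto simp: gen_mat_def opp_def intro!: hom_GL_carrier_mat[OF \<rho>] inS \<Gamma>.inv_closed)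
  have 1: "nrm2 {..<n} (kernel_app {..<n} (entries (gen_mat \<Gamma> (dual_rep n \<rho>) k)) w) = ?g (opp k)"
    "nrm2 {..<n} (kernel_app {..<n} (kernel_adj (entries (gen_mat \<Gamma> (dual_rep n \<rho>) k))) w) = ?f (opp k)" if "k \<in> ?K" for k
    unfolding dual[OF that] using c[OF that]
    by (intro nrm2_cong kernel_app_cong, auto simp: kernel_adj_def mat_adjoint_index)+
  have re: "(\<Sum>k\<in>?K. F (opp k)) = (\<Sum>k\<in>?K. F k)" for F :: "'a \<times> bool \<Rightarrow> real"
    by (rule sum.reindex_bij_witness[of _ opp opp]) (auto simp: opp_def)
  show "(\<Sum>k\<in>?K. nrm2 {..<n} (kernel_app {..<n} (kernel_adj (entries (gen_mat \<Gamma> (dual_rep n \<rho>) k))) w)) =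
    (\<Sum>k\<in>?K. nrm2 {..<n} (kernel_app {..<n} (entries (gen_mat \<Gamma> (dual_rep n \<rho>) k)) w))"
    using bal re[of ?f] re[of ?g] by (simp add: 1 balanced_def del: mem_Sigma_iff)
qed

text \<open>
  Balance provides adjoints for the generators and their inverses, and multiplicativity spreads them over the
  group. Closure under exchange of the components follows, because the pair of \<open>g\<close> is exchanged by taking
  adjoints of the pair of the inverse of \<open>g\<close>.
\<close>

lemma selfdual_rep_pairs:
  assumes \<Gamma>: "group \<Gamma>" and S: "finite S" "S \<subseteq> carrier \<Gamma>" "generate \<Gamma> S = carrier \<Gamma>"
    and \<rho>: "\<rho> \<in> hom \<Gamma> (GL n)"
    and bal: "balanced n (S \<times> UNIV) (gen_mat \<Gamma> \<rho>)"
    and tr: "\<And>\<gamma>. \<gamma> \<in> carrier \<Gamma> \<Longrightarrow> tr (\<rho> \<gamma>) = tr (dual_rep n \<rho> \<gamma>)"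
  shows "selfdual_pairs n (rep_pairs (carrier \<Gamma>) \<rho> (dual_rep n \<rho>))"
proof -
  interpret \<Gamma>: group \<Gamma> by (rule \<Gamma>)
  let ?\<rho>' = "dual_rep n \<rho>"
  let ?B = "rep_pairs (carrier \<Gamma>) \<rho> ?\<rho>'"
  have \<rho>': "?\<rho>' \<in> hom \<Gamma> (GL n)" by (rule dual_rep_hom[OF \<rho>])
  interpret pair_algebra n ?B by (rule pair_algebra_rep_pairs[OF \<Gamma> \<rho> \<rho>'])
  have star_k: "(mat_adjoint (gen_mat \<Gamma> \<rho> k), mat_adjoint (gen_mat \<Gamma> ?\<rho>' k)) \<in> ?B" if "k \<in> S \<times> UNIV" for k
  proof (rule balanced_imp_adjoint_mem[OF _ _ bal balanced_dual[OF \<Gamma> S(2) \<rho> bal] that])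
    fix k assume "k \<in> S \<times> (UNIV :: bool set)"
    then show "(gen_mat \<Gamma> \<rho> k, gen_mat \<Gamma> ?\<rho>' k) \<in> ?B"
      using subsetD[OF S(2)] by (auto simp: gen_mat_def intro!: rep_pairs.gen)
  qed (use S(1) in simp)
  have star_gen: "(mat_adjoint (\<rho> \<gamma>), mat_adjoint (?\<rho>' \<gamma>)) \<in> ?B" if "\<gamma> \<in> generate \<Gamma> S" for \<gamma>
    using that
  proof induction
    case one
    then show ?case using pair_algebra.one[OF pair_algebra_axioms]
      by (simp add: hom_GL_one[OF \<Gamma> \<rho>] hom_GL_one[OF \<Gamma> \<rho>'] mat_adjoint_one)
  next
    case (incl s)
    then show ?case using star_k[of "(s, True)"] by (simp add: gen_mat_def)
  next
    case (inv s)
    then show ?case using star_k[of "(s, False)"] by (simp add: gen_mat_def)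
  next
    case (eng a b)
    then have ab: "a \<in> carrier \<Gamma>" "b \<in> carrier \<Gamma>" using S(3) by auto
    show ?case
      using mult[OF eng.IH(2,1)] hom_GL_carrier_mat[OF \<rho>] hom_GL_carrier_mat[OF \<rho>'] ab
      by (simp add: hom_GL_mult[OF \<rho>] hom_GL_mult[OF \<rho>'] mat_adjoint_mult[of _ n])
  qed
  have star: "(mat_adjoint x, mat_adjoint y) \<in> ?B" if "(x, y) \<in> ?B" for x y
    using that
  proof induction
    case (gen g) then show ?case using star_gen[of g] S(3) by simp
  next
    case (add x y x' y') then show ?case
      using rep_pairs.add[OF add.IH] carr[OF add.hyps(1)] carr[OF add.hyps(2)] by (simp add: mat_adjoint_add[of _ n])
  next
    case (smult x y c) then show ?case
      using rep_pairs.smult[OF smult.IH, of "cnj c"] carr[OF smult.hyps(1)] by (simp add: mat_adjoint_smult[of _ n])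
  qed
  have swap: "(y, x) \<in> ?B" if "(x, y) \<in> ?B" for x y
    using that
  proof induction
    case (gen g)
    have "mat_adjoint (?\<rho>' (inv\<^bsub>\<Gamma>\<^esub> g)) = \<rho> g"
      using gen by (simp add: dual_rep_eq[OF \<Gamma> \<rho>])
    then show ?case
      using star[OF rep_pairs.gen, of "inv\<^bsub>\<Gamma>\<^esub> g"] gen by (simp add: dual_rep_eq[OF \<Gamma> \<rho>, symmetric])
  qed (blast intro: rep_pairs.add rep_pairs.smult)+
  have "tr x = tr y" if "(x, y) \<in> ?B" for x y
    using that
  proof induction
    case (add x y x' y') then show ?case
      using carr[OF add.hyps(1)] carr[OF add.hyps(2)] by (auto simp: tr_def sum.distrib)
  next
    case (smult x y c) then show ?case
      using carr[OF smult.hyps(1)] by (auto simp: tr_def sum_distrib_left[symmetric])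
  qed (rule tr)
  with star swap show ?thesis by unfold_locales
qed

section \<open>Characters determine traces\<close>

lemma entry_coord_function:
  assumes \<Gamma>: "group \<Gamma>" and S: "S \<subseteq> carrier \<Gamma>" and \<gamma>: "\<gamma> \<in> generate \<Gamma> S" and ij: "i < n" "j < n"
  shows "\<exists>p \<in> coord_functions S n. \<forall>\<rho> \<in> hom \<Gamma> (GL n). p \<rho> = \<rho> \<gamma> $$ (i, j)"
  using \<gamma> ij
proof (induction arbitrary: i j)
  case one
  show ?case
    using one hom_GL_one[OF \<Gamma>] by (intro bexI[OF _ coord_functions.const[of "1\<^sub>m n $$ (i, j)"]]) auto
next
  case (incl s)
  then show ?case by (intro bexI[OF _ coord_functions.entry[of s S i n j]]) auto
next
  case (inv s)
  let ?p = "\<lambda>\<rho> :: 'a \<Rightarrow> complex mat. inverse (det (\<rho> s)) * ((-1) ^ (j + i) *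
    det (mat (n - 1) (n - 1) (\<lambda>(k, l). \<rho> s $$ (insert_index j k, insert_index i l))))"
  have "?p \<in> coord_functions S n"
    using inv by (intro coord_functions.mult coord_functions.inv_det coord_functions.const
        coord_functions_det coord_functions.entry) (auto simp: insert_index_def)
  moreover have "?p \<rho> = \<rho> (inv\<^bsub>\<Gamma>\<^esub> s) $$ (i, j)" if "\<rho> \<in> hom \<Gamma> (GL n)" for \<rho>
    using inv S inv_GL_entry[OF hom_GL_carrier[OF that], of s i j] hom_GL_inv[OF \<Gamma> that, of s] by auto
  ultimately show ?case by (intro bexI[of _ ?p]) simp_all
next
  case (eng a b)
  have ab: "a \<in> carrier \<Gamma>" "b \<in> carrier \<Gamma>"
    using group.generate_in_carrier[OF \<Gamma> S] eng.hyps by auto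
  have "\<forall>k\<in>{..<n}. \<exists>p. p \<in> coord_functions S n \<and> (\<forall>\<rho> \<in> hom \<Gamma> (GL n). p \<rho> = \<rho> a $$ (i, k))"
    using eng.IH(1)[OF eng.prems(1)] by blast
  then obtain p where p: "\<And>k. k < n \<Longrightarrow> p k \<in> coord_functions S n"
    "\<And>k \<rho>. k < n \<Longrightarrow> \<rho> \<in> hom \<Gamma> (GL n) \<Longrightarrow> p k \<rho> = \<rho> a $$ (i, k)"
    unfolding bchoice_iff by auto
  have "\<forall>k\<in>{..<n}. \<exists>p. p \<in> coord_functions S n \<and> (\<forall>\<rho> \<in> hom \<Gamma> (GL n). p \<rho> = \<rho> b $$ (k, j))"
    using eng.IH(2)[OF _ eng.prems(2)] by blast
  then obtain q where q: "\<And>k. k < n \<Longrightarrow> q k \<in> coord_functions S n"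
    "\<And>k \<rho>. k < n \<Longrightarrow> \<rho> \<in> hom \<Gamma> (GL n) \<Longrightarrow> q k \<rho> = \<rho> b $$ (k, j)"
    unfolding bchoice_iff by auto
  have "(\<lambda>\<rho>. \<Sum>k<n. p k \<rho> * q k \<rho>) \<in> coord_functions S n"
    using p(1) q(1) by (intro coord_functions_sum coord_functions.mult) auto
  moreover have "(\<Sum>k<n. p k \<rho> * q k \<rho>) = \<rho> (a \<otimes>\<^bsub>\<Gamma>\<^esub> b) $$ (i, j)" if \<rho>: "\<rho> \<in> hom \<Gamma> (GL n)" for \<rho>
    using eng.prems p(2)[OF _ \<rho>] q(2)[OF _ \<rho>]
      index_mult_sum[OF hom_GL_carrier_mat[OF \<rho> ab(1)] hom_GL_carrier_mat[OF \<rho> ab(2)], of i j]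
    by (simp add: hom_GL_mult[OF \<rho> ab] del: index_mult_mat(1))
  ultimately show ?case by (intro bexI[of _ "\<lambda>\<rho>. \<Sum>k<n. p k \<rho> * q k \<rho>"]) auto
qed

lemma tr_conj_rep:
  assumes \<rho>: "\<rho> \<in> hom \<Gamma> (GL n)" and g: "g \<in> carrier (GL n)" and \<gamma>: "\<gamma> \<in> carrier \<Gamma>"
  shows "tr (conj_rep n g \<rho> \<gamma>) = tr (\<rho> \<gamma>)"
proof -
  note c = GL_carrier_mat[OF g] GL_carrier_mat[OF inv_GL(1)[OF g]] hom_GL_carrier_mat[OF \<rho> \<gamma>]
  have "tr (conj_rep n g \<rho> \<gamma>) = tr (inv\<^bsub>GL n\<^esub> g * (g * \<rho> \<gamma>))"
    unfolding conj_rep_def mult_GL using c by (intro tr_comm[of _ n] mat_closed)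
  also have "inv\<^bsub>GL n\<^esub> g * (g * \<rho> \<gamma>) = \<rho> \<gamma>"
    using c inv_GL[OF g] by (simp add: mat_cancel[of _ n])
  finally show ?thesis .
qed

text \<open>
  For a fixed group element the trace is an invariant regular function.
\<close>

lemma chi_eq_imp_tr_eq:
  assumes \<Gamma>: "group \<Gamma>" and S: "S \<subseteq> carrier \<Gamma>" "generate \<Gamma> S = carrier \<Gamma>"
    and \<rho>: "\<rho> \<in> hom \<Gamma> (GL n)" and \<rho>': "\<rho>' \<in> hom \<Gamma> (GL n)" and chi: "chi \<Gamma> S n \<rho> = chi \<Gamma> S n \<rho>'"
    and \<gamma>: "\<gamma> \<in> carrier \<Gamma>"
  shows "tr (\<rho> \<gamma>) = tr (\<rho>' \<gamma>)"
proof -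
  have "\<forall>i\<in>{..<n}. \<exists>p. p \<in> coord_functions S n \<and> (\<forall>\<rho> \<in> hom \<Gamma> (GL n). p \<rho> = \<rho> \<gamma> $$ (i, i))"
    using entry_coord_function[OF \<Gamma> S(1), of \<gamma>] \<gamma> S(2) by (metis lessThan_iff)
  then obtain p where p: "\<And>i. i < n \<Longrightarrow> p i \<in> coord_functions S n"
    "\<And>i \<rho>. i < n \<Longrightarrow> \<rho> \<in> hom \<Gamma> (GL n) \<Longrightarrow> p i \<rho> = \<rho> \<gamma> $$ (i, i)"
    unfolding bchoice_iff by auto
  define f where "f = (\<lambda>\<rho>. \<Sum>i<n. p i \<rho>)"
  have f: "f \<in> coord_functions S n" unfolding f_def using p(1) by (intro coord_functions_sum) auto
  have ftr: "f \<sigma> = tr (\<sigma> \<gamma>)" if "\<sigma> \<in> hom \<Gamma> (GL n)" for \<sigma>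
    using p(2)[OF _ that] hom_GL_carrier_mat[OF that \<gamma>] by (simp add: f_def tr_def)
  have "restrict f (hom \<Gamma> (GL n)) \<in> invariant_functions \<Gamma> S n"
    unfolding invariant_functions_def regular_functions_def
    using f by (auto simp: ftr conj_rep_hom tr_conj_rep[OF _ _ \<gamma>])
  then show ?thesis
    using fun_cong[OF chi, of "restrict f (hom \<Gamma> (GL n))"] \<rho> \<rho>' by (simp add: chi_def ftr)
qed

lemma chi_conj_rep:
  assumes "\<rho> \<in> hom \<Gamma> (GL n)" "g \<in> carrier (GL n)"
  shows "chi \<Gamma> S n (conj_rep n g \<rho>) = chi \<Gamma> S n \<rho>"
  unfolding chi_def by (rule restrict_ext) (use assms in \<open>simp add: invariant_functions_def\<close>)

section \<open>Representations of minimal norm\<close>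

definition rep_norm2 :: "('a, 'b) monoid_scheme \<Rightarrow> 'a set \<Rightarrow> ('a \<Rightarrow> complex mat) \<Rightarrow> real" where
  "rep_norm2 \<Gamma> S \<rho> = (\<Sum>k\<in>S \<times> UNIV. mat_norm2 (gen_mat \<Gamma> \<rho> k))"

lemma bounded_real_convergent_subseq:
  fixes X :: "nat \<Rightarrow> real"
  assumes "\<And>k. \<bar>X k\<bar> \<le> b"
  obtains r where "strict_mono r" "convergent (\<lambda>k. X (r k))"
proof -
  obtain r :: "nat \<Rightarrow> nat" where r: "strict_mono r" "monoseq (\<lambda>k. X (r k))"
    using seq_monosub[of X] by blast
  have "Bseq (\<lambda>k. X (r k))" using assms by (intro BseqI'[of _ b]) simp
  then have "convergent (\<lambda>k. X (r k))" using r(2) by (rule Bseq_monoseq_convergent)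
  with r(1) show ?thesis using that by blast
qed

lemma convergent_subseq:
  "strict_mono (r :: nat \<Rightarrow> nat) \<Longrightarrow> convergent X \<Longrightarrow> convergent (\<lambda>k. X (r k))"
  using convergent_subseq_convergent[of X r] by (simp add: o_def)

lemma bounded_complex_convergent_subseq:
  fixes X :: "nat \<Rightarrow> complex"
  assumes "\<And>k. cmod (X k) \<le> b"
  obtains r where "strict_mono r" "convergent (\<lambda>k. X (r k))"
proof -
  have "\<bar>Re (X k)\<bar> \<le> b" for k using assms[of k] abs_Re_le_cmod[of "X k"] by linarith
  from bounded_real_convergent_subseq[of "\<lambda>k. Re (X k)", OF this]
  obtain r where r: "strict_mono r" "convergent (\<lambda>k. Re (X (r k)))" by blast
  have "\<bar>Im (X (r k))\<bar> \<le> b" for k using assms[of "r k"] abs_Im_le_cmod[of "X (r k)"] by linarith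
  from bounded_real_convergent_subseq[of "\<lambda>k. Im (X (r k))", OF this]
  obtain q where q: "strict_mono q" "convergent (\<lambda>k. Im (X (r (q k))))" by blast
  obtain x where x: "(\<lambda>k. Re (X (r (q k)))) \<longlonglongrightarrow> x"
    using convergent_subseq[OF q(1) r(2)] by (auto simp: convergent_def)
  obtain y where y: "(\<lambda>k. Im (X (r (q k)))) \<longlonglongrightarrow> y" using q(2) by (auto simp: convergent_def)
  have "(\<lambda>k. X (r (q k))) \<longlonglongrightarrow> Complex x y"
    using tendsto_Complex[OF x y] by simp
  then show ?thesis
    using that[of "\<lambda>k. r (q k)"] strict_mono_o[OF r(1) q(1)] by (auto simp: o_def convergent_def)
qed

lemma finite_convergent_subseq:
  fixes X :: "'i \<Rightarrow> nat \<Rightarrow> complex"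
  assumes "finite I" "\<And>i k. i \<in> I \<Longrightarrow> cmod (X i k) \<le> b"
  shows "\<exists>r :: nat \<Rightarrow> nat. strict_mono r \<and> (\<forall>i\<in>I. convergent (\<lambda>k. X i (r k)))"
  using assms
proof (induction I rule: finite_induct)
  case empty
  show ?case by (intro exI[of _ "\<lambda>k. k"]) (simp add: strict_mono_def)
next
  case (insert i I)
  then obtain r :: "nat \<Rightarrow> nat" where r: "strict_mono r" "\<And>j. j \<in> I \<Longrightarrow> convergent (\<lambda>k. X j (r k))"
    by auto
  from bounded_complex_convergent_subseq[of "\<lambda>k. X i (r k)" b]
  obtain q where q: "strict_mono q" "convergent (\<lambda>k. X i (r (q k)))" using insert.prems by blast
  show ?case
    using q convergent_subseq[OF q(1) r(2)] strict_mono_o[OF r(1) q(1)]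
    by (intro exI[of _ "\<lambda>k. r (q k)"]) (auto simp: o_def)
qed

lemma coord_functions_tendsto:
  assumes "f \<in> coord_functions S n"
    and "\<And>s k. s \<in> S \<Longrightarrow> \<rho> k s \<in> carrier (GL n)" "\<And>s. s \<in> S \<Longrightarrow> \<sigma> s \<in> carrier (GL n)"
    and "\<And>s i j. s \<in> S \<Longrightarrow> i < n \<Longrightarrow> j < n \<Longrightarrow> (\<lambda>k. \<rho> k s $$ (i, j)) \<longlonglongrightarrow> \<sigma> s $$ (i, j)"
  shows "(\<lambda>k. f (\<rho> k)) \<longlonglongrightarrow> f \<sigma>"
  using assms(1)
proof induction
  case (entry s i j)
  then show ?case by (rule assms(4))
next
  case (inv_det s)
  have p: "p i < n" if "p permutes {0..<n}" "i < n" for p i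
    using permutes_in_image[OF that(1), of i] that(2) by simp
  have "(\<lambda>k. det (\<rho> k s)) \<longlonglongrightarrow> det (\<sigma> s)"
    unfolding det_def'[OF GL_carrier_mat[OF assms(2)[OF inv_det]]]
      det_def'[OF GL_carrier_mat[OF assms(3)[OF inv_det]]]
    by (intro tendsto_sum tendsto_mult tendsto_const tendsto_prod assms(4) inv_det) (simp_all add: p)
  moreover have "det (\<sigma> s) \<noteq> 0" using det_GL[OF assms(3)[OF inv_det]] by auto
  ultimately show ?case by (rule tendsto_inverse)
qed (intro tendsto_const tendsto_add tendsto_mult; assumption)+

text \<open>
  Along a minimising sequence the matrices of the generators and of their inverses are bounded, so a
  subsequence converges on them, and therefore on every element of the group. The limit is a
  homomorphism; its values are invertible because it is defined on inverses as well. The invariant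
  regular functions are continuous, so the limit has the same character.
\<close>

lemma minimal_rep_exists:
  assumes \<Gamma>: "group \<Gamma>" and S: "finite S" "S \<subseteq> carrier \<Gamma>" "generate \<Gamma> S = carrier \<Gamma>"
    and \<rho>: "\<rho> \<in> hom \<Gamma> (GL n)"
  obtains \<sigma> where "\<sigma> \<in> hom \<Gamma> (GL n)" "chi \<Gamma> S n \<sigma> = chi \<Gamma> S n \<rho>"
    "\<And>\<tau>. \<tau> \<in> hom \<Gamma> (GL n) \<Longrightarrow> chi \<Gamma> S n \<tau> = chi \<Gamma> S n \<rho> \<Longrightarrow> rep_norm2 \<Gamma> S \<sigma> \<le> rep_norm2 \<Gamma> S \<tau>"
proof -
  interpret \<Gamma>: group \<Gamma> by (rule \<Gamma>)
  define F where "F = {\<tau> \<in> hom \<Gamma> (GL n). chi \<Gamma> S n \<tau> = chi \<Gamma> S n \<rho>}"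
  define N where "N = rep_norm2 \<Gamma> S"
  have nonneg: "mat_norm2 A \<ge> 0" for A by (simp add: mat_norm2_def col_norm2_def sum_nonneg)
  have N0: "N \<tau> \<ge> 0" for \<tau> by (simp add: N_def rep_norm2_def sum_nonneg nonneg)
  define m where "m = Inf (N ` F)"
  have ne: "N ` F \<noteq> {}" using \<rho> by (auto simp: F_def)
  have bdd: "bdd_below (N ` F)" using N0 by (auto intro!: bdd_belowI[of _ 0])
  have "\<exists>\<tau>\<in>F. N \<tau> < m + inverse (real (Suc k))" for k
    using cInf_lessD[OF ne, of "m + inverse (real (Suc k))"] by (auto simp: m_def)
  then obtain \<tau> where \<tau>: "\<And>k. \<tau> k \<in> F" "\<And>k. N (\<tau> k) < m + inverse (real (Suc k))" by metis
  have \<tau>hom: "\<tau> k \<in> hom \<Gamma> (GL n)" for k using \<tau>(1) by (simp add: F_def)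
  have inS: "s \<in> carrier \<Gamma>" if "s \<in> S" for s using S(2) that by auto
  have gen_carr: "gen_mat \<Gamma> \<theta> (s, b) \<in> carrier_mat n n" if "\<theta> \<in> hom \<Gamma> (GL n)" "s \<in> S" for \<theta> s b
    using hom_GL_carrier_mat[OF that(1)] inS[OF that(2)] by (simp add: gen_mat_def)
  define I where "I = (S \<times> (UNIV :: bool set)) \<times> {..<n} \<times> {..<n}"
  define X where "X = (\<lambda>(p, i, j) k. gen_mat \<Gamma> (\<tau> k) p $$ (i, j))"
  have "cmod (X q k) \<le> sqrt (m + 1)" if q: "q \<in> I" for q k
  proof -
    obtain s b i j where q': "q = ((s, b), i, j)" "s \<in> S" "i < n" "j < n" using q by (auto simp: I_def)
    let ?A = "gen_mat \<Gamma> (\<tau> k) (s, b)"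
    note A = gen_carr[OF \<tau>hom q'(2), of k b]
    have "(cmod (?A $$ (i, j)))\<^sup>2 \<le> col_norm2 ?A j"
      unfolding col_norm2_def using A q' by (intro member_le_sum) auto
    also have "\<dots> \<le> mat_norm2 ?A"
      unfolding mat_norm2_def using A q' by (intro member_le_sum) (auto simp: col_norm2_def sum_nonneg)
    also have "\<dots> \<le> N (\<tau> k)"
      unfolding N_def rep_norm2_def using S(1) q' nonneg by (intro member_le_sum) auto
    also have "\<dots> \<le> m + 1"
    proof -
      have "inverse (real (Suc k)) \<le> 1" by (simp add: field_simps)
      then show ?thesis using \<tau>(2)[of k] by linarith
    qed
    finally show ?thesis by (simp add: X_def q' real_le_rsqrt)
  qed
  then obtain r :: "nat \<Rightarrow> nat" where r: "strict_mono r" and conv: "\<And>q. q \<in> I \<Longrightarrow> convergent (\<lambda>k. X q (r k))"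
    using finite_convergent_subseq[of I X "sqrt (m + 1)"] S(1) by (auto simp: I_def)
  define T where "T k = \<tau> (r k)" for k
  have T: "T k \<in> hom \<Gamma> (GL n)" for k using \<tau>hom by (simp add: T_def)
  have conv_gen: "convergent (\<lambda>k. gen_mat \<Gamma> (T k) (s, b) $$ (i, j))" if "s \<in> S" "i < n" "j < n" for s b i j
    using conv[of "((s, b), i, j)"] that by (simp add: X_def I_def T_def)
  have conv_all: "convergent (\<lambda>k. T k \<gamma> $$ (i, j))" if "\<gamma> \<in> generate \<Gamma> S" "i < n" "j < n" for \<gamma> i j
    using that
  proof (induction arbitrary: i j)
    case one
    show ?case by (simp add: hom_GL_one[OF \<Gamma> T] convergent_const)
  next
    case (incl s)
    then show ?case using conv_gen[of s i j True] by (simp add: gen_mat_def)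
  next
    case (inv s)
    then show ?case using conv_gen[of s i j False] by (simp add: gen_mat_def)
  next
    case (eng a b)
    then have ab: "a \<in> carrier \<Gamma>" "b \<in> carrier \<Gamma>" using S(3) by auto
    have "T k (a \<otimes>\<^bsub>\<Gamma>\<^esub> b) $$ (i, j) = (\<Sum>l<n. T k a $$ (i, l) * T k b $$ (l, j))" for k
      unfolding hom_GL_mult[OF T ab] using eng.prems
      by (intro index_mult_sum[of _ n n _ n] hom_GL_carrier_mat[OF T] ab)
    moreover have "convergent (\<lambda>k. \<Sum>l<n. T k a $$ (i, l) * T k b $$ (l, j))"
      using eng.prems by (intro convergent_sum convergent_mult eng.IH) auto
    ultimately show ?case by simp
  qed
  define \<sigma> where "\<sigma> \<gamma> = mat n n (\<lambda>(i, j). lim (\<lambda>k. T k \<gamma> $$ (i, j)))" for \<gamma>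
  have c\<sigma>: "\<sigma> \<gamma> \<in> carrier_mat n n" for \<gamma> by (simp add: \<sigma>_def)
  have lim: "(\<lambda>k. T k \<gamma> $$ (i, j)) \<longlonglongrightarrow> \<sigma> \<gamma> $$ (i, j)" if "\<gamma> \<in> carrier \<Gamma>" "i < n" "j < n" for \<gamma> i j
    using conv_all[of \<gamma> i j] that S(3) by (simp add: \<sigma>_def convergent_LIMSEQ_iff)
  have \<sigma>mult: "\<sigma> (a \<otimes>\<^bsub>\<Gamma>\<^esub> b) = \<sigma> a * \<sigma> b" if ab: "a \<in> carrier \<Gamma>" "b \<in> carrier \<Gamma>" for a b
  proof (rule eq_matI)
    fix i j assume "i < dim_row (\<sigma> a * \<sigma> b)" "j < dim_col (\<sigma> a * \<sigma> b)"
    then have ij: "i < n" "j < n" by (auto simp: \<sigma>_def)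
    have "T k (a \<otimes>\<^bsub>\<Gamma>\<^esub> b) $$ (i, j) = (\<Sum>l<n. T k a $$ (i, l) * T k b $$ (l, j))" for k
      unfolding hom_GL_mult[OF T ab] using ij
      by (intro index_mult_sum[of _ n n _ n] hom_GL_carrier_mat[OF T] ab)
    then have "(\<lambda>k. \<Sum>l<n. T k a $$ (i, l) * T k b $$ (l, j)) \<longlonglongrightarrow> \<sigma> (a \<otimes>\<^bsub>\<Gamma>\<^esub> b) $$ (i, j)"
      using lim[of "a \<otimes>\<^bsub>\<Gamma>\<^esub> b" i j] ab ij by simp
    moreover have "(\<lambda>k. \<Sum>l<n. T k a $$ (i, l) * T k b $$ (l, j)) \<longlonglongrightarrow> (\<Sum>l<n. \<sigma> a $$ (i, l) * \<sigma> b $$ (l, j))"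
      using ab ij by (intro tendsto_sum tendsto_mult lim) auto
    ultimately have "\<sigma> (a \<otimes>\<^bsub>\<Gamma>\<^esub> b) $$ (i, j) = (\<Sum>l<n. \<sigma> a $$ (i, l) * \<sigma> b $$ (l, j))"
      by (rule LIMSEQ_unique)
    then show "\<sigma> (a \<otimes>\<^bsub>\<Gamma>\<^esub> b) $$ (i, j) = (\<sigma> a * \<sigma> b) $$ (i, j)"
      using index_mult_sum[OF c\<sigma> c\<sigma>, of i j a b] ij by simp
  qed (simp_all add: \<sigma>_def)
  have \<sigma>one: "\<sigma> \<one>\<^bsub>\<Gamma>\<^esub> = 1\<^sub>m n"
    by (rule eq_matI) (auto simp: \<sigma>_def hom_GL_one[OF \<Gamma> T])
  have \<sigma>hom: "\<sigma> \<in> hom \<Gamma> (GL n)"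
  proof (rule homI)
    fix a assume a: "a \<in> carrier \<Gamma>"
    have "\<sigma> (inv\<^bsub>\<Gamma>\<^esub> a) * \<sigma> a = 1\<^sub>m n" "\<sigma> a * \<sigma> (inv\<^bsub>\<Gamma>\<^esub> a) = 1\<^sub>m n"
      using \<sigma>mult[of "inv\<^bsub>\<Gamma>\<^esub> a" a] \<sigma>mult[of a "inv\<^bsub>\<Gamma>\<^esub> a"] a \<sigma>one by simp_all
    then show "\<sigma> a \<in> carrier (GL n)" using c\<sigma> by (auto simp: carrier_GL)
  qed (simp add: \<sigma>mult)
  have \<sigma>chi: "chi \<Gamma> S n \<sigma> = chi \<Gamma> S n \<rho>"
    unfolding chi_def
  proof (rule restrict_ext)
    fix f assume f: "f \<in> invariant_functions \<Gamma> S n"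
    then obtain p where p: "p \<in> coord_functions S n" "f = restrict p (hom \<Gamma> (GL n))"
      by (auto simp: invariant_functions_def regular_functions_def)
    have "(\<lambda>k. p (T k)) \<longlonglongrightarrow> p \<sigma>"
      by (rule coord_functions_tendsto[OF p(1)]) (use hom_GL_carrier[OF T] hom_GL_carrier[OF \<sigma>hom] inS lim in auto)
    moreover have "p (T k) = f \<rho>" for k
    proof -
      have "chi \<Gamma> S n (T k) = chi \<Gamma> S n \<rho>" using \<tau>(1) by (simp add: T_def F_def)
      from fun_cong[OF this, of f] show ?thesis using f T by (simp add: chi_def p(2))
    qed
    ultimately have "p \<sigma> = f \<rho>" by (simp add: LIMSEQ_const_iff)
    then show "f \<sigma> = f \<rho>" using \<sigma>hom by (simp add: p(2))
  qed
  have "(\<lambda>k. N (T k)) \<longlonglongrightarrow> N \<sigma>"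
  proof -
    have e: "N \<theta> = (\<Sum>p\<in>S \<times> UNIV. \<Sum>j<n. \<Sum>i<n. (cmod (gen_mat \<Gamma> \<theta> p $$ (i, j)))\<^sup>2)"
      if "\<theta> \<in> hom \<Gamma> (GL n)" for \<theta>
      unfolding N_def rep_norm2_def
    proof (rule sum.cong)
      fix p assume "p \<in> S \<times> (UNIV :: bool set)"
      then have "gen_mat \<Gamma> \<theta> p \<in> carrier_mat n n" using gen_carr[OF that] by (cases p) auto
      then show "mat_norm2 (gen_mat \<Gamma> \<theta> p) = (\<Sum>j<n. \<Sum>i<n. (cmod (gen_mat \<Gamma> \<theta> p $$ (i, j)))\<^sup>2)"
        by (simp add: mat_norm2_def col_norm2_def)
    qed simp
    show ?thesis unfolding e[OF T] e[OF \<sigma>hom]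
      by (intro tendsto_sum tendsto_power tendsto_norm)
        (auto simp: gen_mat_def inS intro!: lim)
  qed
  moreover have "(\<lambda>k. m + inverse (real (Suc (r k)))) \<longlonglongrightarrow> m + 0"
    using LIMSEQ_subseq_LIMSEQ[OF LIMSEQ_inverse_real_of_nat r] by (intro tendsto_add tendsto_const) (simp add: o_def)
  ultimately have "N \<sigma> \<le> m + 0"
    using \<tau>(2) by (intro LIMSEQ_le[of "\<lambda>k. N (T k)"]) (auto simp: T_def less_imp_le intro!: exI[of _ 0])
  then have "N \<sigma> \<le> N \<theta>" if "\<theta> \<in> F" for \<theta>
    using cInf_lower[OF imageI[OF that] bdd] by (simp add: m_def)
  then show ?thesis using that[OF \<sigma>hom \<sigma>chi] by (simp add: F_def N_def)
qed

lemma minimal_rep_balanced: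
  assumes \<Gamma>: "group \<Gamma>" and S: "finite S" "S \<subseteq> carrier \<Gamma>" and \<sigma>: "\<sigma> \<in> hom \<Gamma> (GL n)"
    and min: "\<And>\<tau>. \<tau> \<in> hom \<Gamma> (GL n) \<Longrightarrow> chi \<Gamma> S n \<tau> = chi \<Gamma> S n \<sigma> \<Longrightarrow> rep_norm2 \<Gamma> S \<sigma> \<le> rep_norm2 \<Gamma> S \<tau>"
  shows "balanced n (S \<times> UNIV) (gen_mat \<Gamma> \<sigma>)"
proof (rule minimal_imp_balanced)
  interpret \<Gamma>: group \<Gamma> by (rule \<Gamma>)
  show "finite (S \<times> (UNIV :: bool set))" using S(1) by simp
  show "gen_mat \<Gamma> \<sigma> k \<in> carrier_mat n n" if "k \<in> S \<times> UNIV" for k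
    using that subsetD[OF S(2)] hom_GL_carrier_mat[OF \<sigma>] by (auto simp: gen_mat_def)
  fix g g' :: "complex mat"
  assume g: "g \<in> carrier_mat n n" "g' \<in> carrier_mat n n" "g * g' = 1\<^sub>m n" "g' * g = 1\<^sub>m n"
  then have G: "g \<in> carrier (GL n)" "g' \<in> carrier (GL n)" by (auto simp: carrier_GL)
  have "inv\<^bsub>GL n\<^esub> g = g'"
    using group.inv_equality[OF group_GL[of n], of g' g] G g(4) by simp
  then have "gen_mat \<Gamma> (conj_rep n g \<sigma>) k = g * gen_mat \<Gamma> \<sigma> k * g'" for k
    by (simp add: gen_mat_def conj_rep_def split: prod.splits)
  then show "(\<Sum>k\<in>S \<times> UNIV. mat_norm2 (gen_mat \<Gamma> \<sigma> k)) \<le> (\<Sum>k\<in>S \<times> UNIV. mat_norm2 (g * gen_mat \<Gamma> \<sigma> k * g'))"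
    using min[OF conj_rep_hom[OF \<sigma> G(1)] chi_conj_rep[OF \<sigma> G(1)]] by (simp add: rep_norm2_def)
qed

section \<open>Indefinite unitary groups\<close>

lemma Ipq_diag: "Ipq p q = diag (p + q) (\<lambda>i. if i < p then 1 else - 1)"
  by (rule eq_matI) (auto simp: Ipq_def)

text \<open>
  Sylvester's law of inertia, existence part: diagonalise with the positive eigenvalues in front and rescale the coordinates by
  the square roots of the absolute values of the eigenvalues.
\<close>

lemma hermitian_congruent_Ipq:
  assumes h: "h \<in> carrier_mat n n" "mat_adjoint h = h"
    and k: "k \<in> carrier_mat n n" "h * k = 1\<^sub>m n"
  obtains R R' p q where "R \<in> carrier_mat n n" "R' \<in> carrier_mat n n" "R * R' = 1\<^sub>m n" "R' * R = 1\<^sub>m n"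
    "p + q = n" "h = mat_adjoint R * Ipq p q * R"
proof -
  obtain U f r where U: "unitary n U" and d: "mat_adjoint U * h * U = diag n f"
    and r: "r \<le> n" "\<And>i. i < r \<Longrightarrow> Re (f i) > 0" "\<And>i. r \<le> i \<Longrightarrow> i < n \<Longrightarrow> \<not> Re (f i) > 0"
    and real: "\<And>i. i < n \<Longrightarrow> cnj (f i) = f i"
    using hermitian_diag_sorted[OF h, of "\<lambda>e. Re e > 0"] by blast
  note U' = unitaryD[OF U]
  have fR: "f i = of_real (Re (f i))" if "i < n" for i
    using real[OF that] by (simp add: complex_eq_iff)
  have f0: "f i \<noteq> 0" if i: "i < n" for i
  proof
    assume z: "f i = 0"
    let ?k = "mat_adjoint U * k * U"
    have "diag n f * ?k = mat_adjoint U * (h * k) * U"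
      unfolding d[symmetric] by (rule unitary_conj_mult[OF U h(1) k(1), symmetric])
    also have "\<dots> = 1\<^sub>m n" using U' by (simp add: k(2))
    finally have "(diag n f * ?k) $$ (i, i) = 1" using i by simp
    moreover have "?k \<in> carrier_mat n n" using U' k by (simp add: mat_closed[of _ n])
    ultimately show False using diag_mult_left[of ?k n i i f] i z by simp
  qed
  define a where "a i = complex_of_real (sqrt \<bar>Re (f i)\<bar>)" for i
  have a0: "a i \<noteq> 0" if "i < n" for i
    using f0[OF that] fR[OF that] by (auto simp: a_def)
  have aa: "a i * (if i < r then 1 else - 1) * a i = f i" if i: "i < n" for i
  proof -
    have "a i * a i = complex_of_real \<bar>Re (f i)\<bar>" by (simp add: a_def flip: of_real_mult)
    moreover have "Re (f i) \<ge> 0" if "i < r" using r(2)[OF that] by simp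
    moreover have "Re (f i) \<le> 0" if "\<not> i < r" using r(3)[of i] that i by simp
    ultimately show ?thesis using fR[OF i] by (cases "i < r") simp_all
  qed
  define A where "A = diag n a"
  define A' where "A' = diag n (\<lambda>i. 1 / a i)"
  have c: "A \<in> carrier_mat n n" "A' \<in> carrier_mat n n" by (simp_all add: A_def A'_def)
  have AA: "A * A' = 1\<^sub>m n" "A' * A = 1\<^sub>m n"
    unfolding A_def A'_def diag_mult_diag using a0 by (auto intro!: eq_matI)
  have Aadj: "mat_adjoint A = A"
    by (rule eq_matI) (auto simp: A_def a_def mat_adjoint_index)
  have I: "Ipq r (n - r) = diag n (\<lambda>i. if i < r then 1 else - 1)" using r(1) by (simp add: Ipq_diag)
  have cI: "Ipq r (n - r) \<in> carrier_mat n n" by (simp add: I)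
  have "A * Ipq r (n - r) * A = diag n f"
    unfolding A_def I diag_mult_diag using aa by (auto intro!: eq_matI)
  then have "mat_adjoint U * h * U = A * Ipq r (n - r) * A" using d by simp
  then have "h = U * (A * Ipq r (n - r) * A) * mat_adjoint U"
    using unitary_conj_eq[OF U h(1)] by simp
  also have "\<dots> = mat_adjoint (A * mat_adjoint U) * Ipq r (n - r) * (A * mat_adjoint U)"
    using U' c cI by (simp add: mat_adjoint_mult[of _ n] Aadj mat_simps[of _ n])
  finally have "h = mat_adjoint (A * mat_adjoint U) * Ipq r (n - r) * (A * mat_adjoint U)" .
  moreover have "(A * mat_adjoint U) * (U * A') = 1\<^sub>m n" "(U * A') * (A * mat_adjoint U) = 1\<^sub>m n"
    using U' c AA by (simp_all add: mat_simps[of _ n] mat_cancel[of _ n])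
  ultimately show ?thesis
    using that[of "A * mat_adjoint U" "U * A'" r "n - r"] U' c r(1) by (simp add: mat_closed[of _ n])
qed

lemma hom_Upq_iff:
  "\<rho> \<in> hom \<Gamma> (Upq p q) \<longleftrightarrow> \<rho> \<in> hom \<Gamma> (GL (p + q)) \<and>
    (\<forall>\<gamma>\<in>carrier \<Gamma>. mat_adjoint (\<rho> \<gamma>) * Ipq p q * \<rho> \<gamma> = Ipq p q)"
  by (auto simp: hom_def Upq_def Pi_iff)

text \<open>
  The relation \<open>\<rho>(\<gamma>)\<^sup>* I \<rho>(\<gamma>) = I\<close> for \<open>I = I\<^bsub>p,q\<^esub>\<close>, which is its own inverse, says that \<open>I\<close> conjugates \<open>\<rho>(\<gamma>)\<close> into
  the inverse of \<open>\<rho>(\<gamma>)\<^sup>*\<close>.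
\<close>

lemma X_U_subset_fixed:
  assumes \<Gamma>: "group \<Gamma>" and S: "S \<subseteq> carrier \<Gamma>"
  shows "X_U \<Gamma> S p q \<subseteq> X_GL_Phi2 \<Gamma> S (p + q)"
proof
  fix x assume "x \<in> X_U \<Gamma> S p q"
  then obtain \<rho> where x: "x = chi \<Gamma> S (p + q) \<rho>" and \<rho>: "\<rho> \<in> hom \<Gamma> (GL (p + q))"
    and inv: "\<And>\<gamma>. \<gamma> \<in> carrier \<Gamma> \<Longrightarrow> mat_adjoint (\<rho> \<gamma>) * Ipq p q * \<rho> \<gamma> = Ipq p q"
    by (auto simp: X_U_def hom_Upq_iff)
  let ?n = "p + q" and ?I = "Ipq p q"
  have cI: "?I \<in> carrier_mat ?n ?n" by (simp add: Ipq_diag)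
  have II: "?I * ?I = 1\<^sub>m ?n"
    unfolding Ipq_diag diag_mult_diag by (auto intro!: eq_matI)
  then have I: "?I \<in> carrier (GL ?n)" using cI by (auto simp: carrier_GL)
  have invI: "inv\<^bsub>GL ?n\<^esub> ?I = ?I"
    using group.inv_equality[OF group_GL[of ?n], of ?I ?I] I II by simp
  have dual: "dual_rep ?n \<rho> \<gamma> = conj_rep ?n ?I \<rho> \<gamma>" if \<gamma>: "\<gamma> \<in> carrier \<Gamma>" for \<gamma>
  proof -
    let ?A = "\<rho> \<gamma>"
    have A: "?A \<in> carrier (GL ?n)" by (rule hom_GL_carrier[OF \<rho> \<gamma>])
    note cA = GL_carrier_mat[OF A]
    have cC: "?I * ?A * ?I \<in> carrier_mat ?n ?n" using cA cI by (simp add: mat_closed[of _ ?n])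
    have "mat_adjoint ?A * (?I * ?A * ?I) = mat_adjoint ?A * (?I * ?A) * ?I"
      using cA cI by (intro assoc_mult_mat[of _ ?n ?n, symmetric] mat_closed) auto
    also have "mat_adjoint ?A * (?I * ?A) = mat_adjoint ?A * ?I * ?A"
      using cA cI by (intro assoc_mult_mat[of _ ?n ?n, symmetric]) auto
    also have "\<dots> = ?I" by (rule inv[OF \<gamma>])
    finally have 1: "mat_adjoint ?A * (?I * ?A * ?I) = 1\<^sub>m ?n" by (simp add: II)
    then have 2: "(?I * ?A * ?I) * mat_adjoint ?A = 1\<^sub>m ?n"
      using mat_mult_left_right_inverse[of "mat_adjoint ?A" ?n "?I * ?A * ?I"] cA cC by simp
    have "?I * ?A * ?I \<in> carrier (GL ?n)"
      unfolding carrier_GL using 1 2 cA cC by auto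
    then have "inv\<^bsub>GL ?n\<^esub> (mat_adjoint ?A) = ?I * ?A * ?I"
      using group.inv_equality[OF group_GL[of ?n], of "?I * ?A * ?I" "mat_adjoint ?A"] 2 mat_adjoint_GL(1)[OF A] by simp
    then show ?thesis by (simp add: dual_rep_def conj_rep_def invI)
  qed
  have "chi \<Gamma> S ?n (dual_rep ?n \<rho>) = chi \<Gamma> S ?n (conj_rep ?n ?I \<rho>)"
    unfolding chi_def
  proof (rule restrict_ext)
    fix f assume "f \<in> invariant_functions \<Gamma> S ?n"
    then obtain c where c: "c \<in> coord_functions S ?n" "f = restrict c (hom \<Gamma> (GL ?n))"
      by (auto simp: invariant_functions_def regular_functions_def)
    have "c (dual_rep ?n \<rho>) = c (conj_rep ?n ?I \<rho>)"
      by (rule coord_functions_cong[OF c(1)]) (use dual S in auto)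
    then show "f (dual_rep ?n \<rho>) = f (conj_rep ?n ?I \<rho>)"
      by (simp add: c(2) dual_rep_hom[OF \<rho>] conj_rep_hom[OF \<rho> I])
  qed
  then show "x \<in> X_GL_Phi2 \<Gamma> S ?n"
    using \<rho> by (simp add: X_GL_Phi2_def X_GL_def x Phi2_chi[OF S \<rho>] chi_conj_rep[OF \<rho> I])
qed

text \<open>
  A representation of minimal norm with the given character preserves a nondegenerate Hermitian form,
  and a change of basis brings this form to the standard one.
\<close>

lemma fixed_subset_X_U:
  assumes \<Gamma>: "group \<Gamma>" and S: "finite S" "S \<subseteq> carrier \<Gamma>" "generate \<Gamma> S = carrier \<Gamma>"
    and x: "x \<in> X_GL_Phi2 \<Gamma> S n"
  obtains p q where "p + q = n" "x \<in> X_U \<Gamma> S p q"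
proof -
  obtain \<rho> where \<rho>: "\<rho> \<in> hom \<Gamma> (GL n)" and x\<rho>: "x = chi \<Gamma> S n \<rho>"
    and fix_\<rho>: "chi \<Gamma> S n (dual_rep n \<rho>) = chi \<Gamma> S n \<rho>"
    using x Phi2_chi[OF S(2)] by (auto simp: X_GL_Phi2_def X_GL_def)
  obtain \<sigma> where \<sigma>: "\<sigma> \<in> hom \<Gamma> (GL n)" and chi\<sigma>: "chi \<Gamma> S n \<sigma> = chi \<Gamma> S n \<rho>"
    and min: "\<And>\<tau>. \<tau> \<in> hom \<Gamma> (GL n) \<Longrightarrow> chi \<Gamma> S n \<tau> = chi \<Gamma> S n \<rho> \<Longrightarrow> rep_norm2 \<Gamma> S \<sigma> \<le> rep_norm2 \<Gamma> S \<tau>"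
    using minimal_rep_exists[OF \<Gamma> S \<rho>] by blast
  let ?\<sigma>' = "dual_rep n \<sigma>"
  have bal: "balanced n (S \<times> UNIV) (gen_mat \<Gamma> \<sigma>)"
    using min chi\<sigma> by (intro minimal_rep_balanced[OF \<Gamma> S(1,2) \<sigma>]) simp
  have "chi \<Gamma> S n \<sigma> = chi \<Gamma> S n ?\<sigma>'"
    using chi_dual_rep_cong[OF S(2) \<sigma> \<rho> chi\<sigma>] chi\<sigma> fix_\<rho> by simp
  then have "tr (\<sigma> \<gamma>) = tr (?\<sigma>' \<gamma>)" if "\<gamma> \<in> carrier \<Gamma>" for \<gamma>
    using chi_eq_imp_tr_eq[OF \<Gamma> S(2,3) \<sigma> dual_rep_hom[OF \<sigma>] _ that] by simp
  then have sp: "selfdual_pairs n (rep_pairs (carrier \<Gamma>) \<sigma> ?\<sigma>')"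
    by (intro selfdual_rep_pairs[OF \<Gamma> S \<sigma> bal])
  obtain h k where h: "intertwines n (rep_pairs (carrier \<Gamma>) \<sigma> ?\<sigma>') h" "mat_adjoint h = h"
    and k: "k \<in> carrier_mat n n" "h * k = 1\<^sub>m n"
    using invertible_hermitian_intertwiner[OF sp] by blast
  have ch: "h \<in> carrier_mat n n" using h(1) by (simp add: intertwines_def)
  have h_inv: "mat_adjoint (\<sigma> \<gamma>) * h * \<sigma> \<gamma> = h" if \<gamma>: "\<gamma> \<in> carrier \<Gamma>" for \<gamma>
  proof -
    have A: "\<sigma> \<gamma> \<in> carrier (GL n)" by (rule hom_GL_carrier[OF \<sigma> \<gamma>])
    note cA = GL_carrier_mat[OF A] and Ad = mat_adjoint_GL(1)[OF A]
    have "?\<sigma>' \<gamma> * h = h * \<sigma> \<gamma>"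
      using h(1) rep_pairs.gen[OF \<gamma>, of \<sigma> ?\<sigma>'] by (auto simp: intertwines_def)
    then have "mat_adjoint (\<sigma> \<gamma>) * (h * \<sigma> \<gamma>) = mat_adjoint (\<sigma> \<gamma>) * (inv\<^bsub>GL n\<^esub> (mat_adjoint (\<sigma> \<gamma>)) * h)"
      by (simp add: dual_rep_def)
    also have "\<dots> = h"
      using inv_GL[OF Ad] GL_carrier_mat[OF inv_GL(1)[OF Ad]] cA ch by (simp add: mat_cancel[of _ n])
    finally show ?thesis using cA ch by (simp add: mat_assoc[of _ n])
  qed
  obtain R R' p q where R: "R \<in> carrier_mat n n" "R' \<in> carrier_mat n n" "R * R' = 1\<^sub>m n" "R' * R = 1\<^sub>m n"
    and pq: "p + q = n" and hR: "h = mat_adjoint R * Ipq p q * R"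
    using hermitian_congruent_Ipq[OF ch h(2) k] by blast
  have RG: "R \<in> carrier (GL n)" "R' \<in> carrier (GL n)" using R by (auto simp: carrier_GL)
  have invR: "inv\<^bsub>GL n\<^esub> R = R'"
    using group.inv_equality[OF group_GL[of n], of R' R] RG R(4) by simp
  have cI: "Ipq p q \<in> carrier_mat n n" using pq by (simp add: Ipq_diag)
  let ?\<tau> = "conj_rep n R \<sigma>"
  have Radj: "mat_adjoint R' * mat_adjoint R = 1\<^sub>m n"
    using R by (simp add: mat_adjoint_mult[of _ n, symmetric] mat_adjoint_one)
  have hR': "mat_adjoint R' * h * R' = Ipq p q"
    unfolding hR using R cI Radj by (simp add: mat_simps[of _ n] mat_cancel[of _ n])
  have "mat_adjoint (?\<tau> \<gamma>) * Ipq p q * ?\<tau> \<gamma> = Ipq p q" if \<gamma>: "\<gamma> \<in> carrier \<Gamma>" for \<gamma>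
  proof -
    note c = hom_GL_carrier_mat[OF \<sigma> \<gamma>]
    have "mat_adjoint (?\<tau> \<gamma>) * Ipq p q * ?\<tau> \<gamma> =
      mat_adjoint R' * (mat_adjoint (\<sigma> \<gamma>) * (mat_adjoint R * Ipq p q * R) * \<sigma> \<gamma>) * R'"
      using R c cI by (simp add: conj_rep_def invR mat_adjoint_mult[of _ n] mat_simps[of _ n])
    then show ?thesis by (simp add: hR[symmetric] h_inv[OF \<gamma>] hR')
  qed
  then have "?\<tau> \<in> hom \<Gamma> (Upq p q)"
    using conj_rep_hom[OF \<sigma> RG(1)] pq by (simp add: hom_Upq_iff)
  moreover have "x = chi \<Gamma> S (p + q) ?\<tau>"
    using x\<rho> chi\<sigma> chi_conj_rep[OF \<sigma> RG(1), of S] pq by simp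
  ultimately have "x \<in> X_U \<Gamma> S p q" by (auto simp: X_U_def)
  with pq show ?thesis using that by blast
qed

theorem theorem6p1:
  fixes \<Gamma> :: "('a, 'b) monoid_scheme" and S :: "'a set" and n :: nat
  assumes "group \<Gamma>"
    and "finite S" and "S \<subseteq> carrier \<Gamma>" and "generate \<Gamma> S = carrier \<Gamma>"
    and "n > 0"
  shows "X_GL_Phi2 \<Gamma> S n = (\<Union>(p, q) \<in> {(p, q). p + q = n}. X_U \<Gamma> S p q)"
proof (intro equalityI subsetI)
  fix x assume "x \<in> X_GL_Phi2 \<Gamma> S n"
  then show "x \<in> (\<Union>(p, q) \<in> {(p, q). p + q = n}. X_U \<Gamma> S p q)"
    using fixed_subset_X_U[OF assms(1-4)] by blast
next
  fix x assume "x \<in> (\<Union>(p, q) \<in> {(p, q). p + q = n}. X_U \<Gamma> S p q)"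
  then show "x \<in> X_GL_Phi2 \<Gamma> S n"
    using X_U_subset_fixed[OF assms(1,3)] by auto
qed

end
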